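(* Let $\bar X$ be an r.i. space on $(0,1)$ with $\underline{\alpha}_{\bar X}>0$, and let $k\ge1$ be an integer. Let $M$ be the smallest natural number such that $\underline{\alpha}_{\bar X}>1/M$. Let $\Omega\subset\mathbb R^n$ be a bounded domain with $|\Omega|=1$, and suppose that $n\ge M$. Then for all $f\in W_0^{k,\bar X}(\Omega)$, $$\|f\|_{\bar X_{k,\log}}\le c(M,k,\bar X)\left\||D^kf|^{\ast}\right\|_{\bar X},$$ where the constant $c(M,k,\bar X)$ does not depend on the dimension $n$.
   Context: For a measurable function $u$ on a set of measure one ($\Omega$ or $(0,1)$ with Lebesgue measure), $|u|^\ast(s)=\inf\{t\ge0:|\{|u|>t\}|\le s\}$, $s\in[0,1)$, is the decreasing rearrangement of $|u|$. A rearrangement invariant (r.i.) space $\bar X$ on $(0,1)$ is a Banach function space over $(0,1)$ with Lebesgue measure, with the Fatou property, such that if $g\in\bar X$ and $|f|^\ast=|g|^\ast$ then $f\in\bar X$ and $\|f\|_{\bar X}=\|g\|_{\bar X}$. Lower Boyd index: for $r>0$ let $E_rf(t)=|f|^\ast(t/r)$ for $t\in(0,1)$, $t<r$, and $E_rf(t)=0$ for $t\in(0,1)$, $t\ge r$; let $h_{\bar X}(r)$ be the norm of $E_r$ on $\bar X$. Then $\underline{\alpha}_{\bar X}=\sup_{0<r<1}\frac{\ln h_{\bar X}(r)}{\ln r}$. For $k\in\mathbb N$, the norm of $\bar X_{k,\log}$ is $$\|f\|_{\bar X_{k,\log}}=\int_0^1\left\||f|^\ast(s)\chi_{[0,t)}(s)\right\|_{\bar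 X}\frac{dt}{t\left(\ln\frac1t\right)^{1-k/2}},$$ the inner norm being in the variable $s$. $W_0^{k,1}(\Omega)$ is the space of $f\in L^1(\Omega)$ that are $k$ times weakly differentiable on $\Omega$ and whose continuations by $0$ outside $\Omega$ are $k$ times weakly differentiable functions on $\mathbb R^n$ (with $\||D^jf|\|_{L^1}<\infty$, $j=0,\dots,k$). $W_0^{k,\bar X}(\Omega)=\{f\in W_0^{k,1}(\Omega):\sum_{j=0}^k\||D^jf|^\ast\|_{\bar X}<\infty\}$. Here $|D^jf|$ denotes the Euclidean norm of the array of all weak partial derivatives $\partial_{i_1}\cdots\partial_{i_j}f$ of order $j$ (so $|D^0f|=|f|$ and $|D^1f|=|\nabla f|$). *)

theory Defs
  imports "HOL-Analysis.Analysis"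
begin

section \<open>Rearrangements and rearrangement invariant norms\<close>

text \<open>Norms are extended function norms on $[0,\infty]$-valued measurable functions. The
  space itself consists of the measurable real functions \<open>f\<close> for which \<open>\<rho> \<bar>f\<bar>\<close> is finite.\<close>

definition rearr :: "'a measure \<Rightarrow> ('a \<Rightarrow> ennreal) \<Rightarrow> real \<Rightarrow> ennreal" where
  "rearr N u s = Inf {t. emeasure N {x \<in> space N. t < u x} \<le> ennreal s}"

text \<open>The axioms of Bennett and Sharpley. The Fatou property is one of them, and completeness
  of the space is a consequence of it.\<close>

locale banach_function_norm =
  fixes N :: "'a measure" and \<rho> :: "('a \<Rightarrow> ennreal) \<Rightarrow> ennreal"
  assumes zero_iff: "f \<in> borel_measurable N \<Longrightarrow> \<rho> f = 0 \<longleftrightarrow> (AE x in N. f x = 0)"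
    and homogeneous: "f \<in> borel_measurable N \<Longrightarrow> 0 \<le> a \<Longrightarrow> \<rho> (\<lambda>x. ennreal a * f x) = ennreal a * \<rho> f"
    and triangle: "f \<in> borel_measurable N \<Longrightarrow> g \<in> borel_measurable N \<Longrightarrow> \<rho> (\<lambda>x. f x + g x) \<le> \<rho> f + \<rho> g"
    and monotone: "f \<in> borel_measurable N \<Longrightarrow> g \<in> borel_measurable N \<Longrightarrow>
      (AE x in N. f x \<le> g x) \<Longrightarrow> \<rho> f \<le> \<rho> g"
    and fatou: "(\<And>i::nat. F i \<in> borel_measurable N) \<Longrightarrow> f \<in> borel_measurable N \<Longrightarrow>
      (AE x in N. incseq (\<lambda>i. F i x) \<and> (SUP i. F i x) = f x) \<Longrightarrow> (SUP i. \<rho> (F i)) = \<rho> f"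
    and indicator_finite: "E \<in> sets N \<Longrightarrow> emeasure N E < \<infinity> \<Longrightarrow> \<rho> (indicator E) < \<infinity>"
    and locally_integrable: "E \<in> sets N \<Longrightarrow> emeasure N E < \<infinity> \<Longrightarrow>
      \<exists>C::real. \<forall>f \<in> borel_measurable N. (\<integral>\<^sup>+x\<in>E. f x \<partial>N) \<le> ennreal C * \<rho> f"

locale ri_norm = banach_function_norm "lebesgue_on {0<..<1::real}" \<rho>
  for \<rho> :: "(real \<Rightarrow> ennreal) \<Rightarrow> ennreal" +
  assumes rearrangement_invariant:
    "f \<in> borel_measurable (lebesgue_on {0<..<1}) \<Longrightarrow> g \<in> borel_measurable (lebesgue_on {0<..<1}) \<Longrightarrow>
     (\<forall>s\<in>{0..<1}. rearr (lebesgue_on {0<..<1}) f s = rearr (lebesgue_on {0<..<1}) g s) \<Longrightarrow> \<rho> f = \<rho> g"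

definition dilation :: "real \<Rightarrow> (real \<Rightarrow> ennreal) \<Rightarrow> real \<Rightarrow> ennreal" where
  "dilation r f t = (if t < r then rearr (lebesgue_on {0<..<1}) f (t / r) else 0)"

definition dilation_norm :: "((real \<Rightarrow> ennreal) \<Rightarrow> ennreal) \<Rightarrow> real \<Rightarrow> ennreal" where
  "dilation_norm \<rho> r =
     (SUP f \<in> {f \<in> borel_measurable (lebesgue_on {0<..<1}). \<rho> f \<le> 1}. \<rho> (dilation r f))"

text \<open>For a rearrangement invariant norm and $0<r<1$ the dilation norm lies in $[r,1]$, so neither
  the conversion to real nor the logarithm meets a junk value.\<close>

definition lower_boyd_index :: "((real \<Rightarrow> ennreal) \<Rightarrow> ennreal) \<Rightarrow> ereal" where
  "lower_boyd_index \<rho> = (SUP r \<in> {0<..<1}. ereal (ln (enn2real (dilation_norm \<rho> r)) / ln r))"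

definition log_norm :: "((real \<Rightarrow> ennreal) \<Rightarrow> ennreal) \<Rightarrow> nat \<Rightarrow> 'a measure \<Rightarrow> ('a \<Rightarrow> ennreal) \<Rightarrow> ennreal" where
  "log_norm \<rho> k N u =
     (\<integral>\<^sup>+t\<in>{0<..<1::real}. \<rho> (\<lambda>s. rearr N u s * indicator {0..<t} s) *
        ennreal (1 / (t * ln (1 / t) powr (1 - real k / 2))) \<partial>lborel)"


section \<open>Euclidean space of variable dimension\<close>

text \<open>The points of $\mathbb R^n$ are the functions in \<open>PiE {..<n} (\<lambda>_. UNIV)\<close>, so that
  \<open>n\<close> is a term and a constant can be required not to depend on it.\<close>

definition Rn_top :: "nat \<Rightarrow> (nat \<Rightarrow> real) topology" where
  "Rn_top n = product_topology (\<lambda>_. euclideanreal) {..<n}"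

definition Rn_leb :: "nat \<Rightarrow> (nat \<Rightarrow> real) measure" where
  "Rn_leb n = completion (Pi\<^sub>M {..<n} (\<lambda>_. lborel))"

definition bounded_domain :: "nat \<Rightarrow> (nat \<Rightarrow> real) set \<Rightarrow> bool" where
  "bounded_domain n \<Omega> \<longleftrightarrow> openin (Rn_top n) \<Omega> \<and> connectedin (Rn_top n) \<Omega> \<and> \<Omega> \<noteq> {} \<and>
     (\<exists>B. \<forall>x\<in>\<Omega>. L2_set x {..<n} \<le> B)"

definition partial_deriv :: "nat \<Rightarrow> ((nat \<Rightarrow> real) \<Rightarrow> real) \<Rightarrow> (nat \<Rightarrow> real) \<Rightarrow> real" where
  "partial_deriv i \<phi> x = deriv (\<lambda>t. \<phi> (x(i := t))) (x i)"

definition partial_derivs :: "nat list \<Rightarrow> ((nat \<Rightarrow> real) \<Rightarrow> real) \<Rightarrow> (nat \<Rightarrow> real) \<Rightarrow> real" where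
  "partial_derivs is \<phi> = foldr partial_deriv is \<phi>"

definition smooth :: "nat \<Rightarrow> ((nat \<Rightarrow> real) \<Rightarrow> real) \<Rightarrow> bool" where
  "smooth n \<phi> \<longleftrightarrow> (\<forall>is. set is \<subseteq> {..<n} \<longrightarrow>
     continuous_map (Rn_top n) euclideanreal (partial_derivs is \<phi>) \<and>
     (\<forall>x \<in> topspace (Rn_top n). \<forall>i<n.
        (\<lambda>t. partial_derivs is \<phi> (x(i := t))) differentiable (at (x i))))"

definition test_function :: "nat \<Rightarrow> (nat \<Rightarrow> real) set \<Rightarrow> ((nat \<Rightarrow> real) \<Rightarrow> real) \<Rightarrow> bool" where
  "test_function n U \<phi> \<longleftrightarrow> smooth n \<phi> \<and>
     (\<exists>K. compactin (Rn_top n) K \<and> K \<subseteq> U \<and> (\<forall>x \<in> topspace (Rn_top n) - K. \<phi> x = 0))"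


section \<open>Weak derivatives and Sobolev spaces\<close>

definition loc_integrable :: "nat \<Rightarrow> (nat \<Rightarrow> real) set \<Rightarrow> ((nat \<Rightarrow> real) \<Rightarrow> real) \<Rightarrow> bool" where
  "loc_integrable n U f \<longleftrightarrow>
     (\<forall>K. compactin (Rn_top n) K \<and> K \<subseteq> U \<longrightarrow> set_integrable (Rn_leb n) K f)"

definition is_weak_deriv ::
  "nat \<Rightarrow> (nat \<Rightarrow> real) set \<Rightarrow> nat list \<Rightarrow> ((nat \<Rightarrow> real) \<Rightarrow> real) \<Rightarrow> ((nat \<Rightarrow> real) \<Rightarrow> real) \<Rightarrow> bool" where
  "is_weak_deriv n U is f g \<longleftrightarrow> loc_integrable n U f \<and> loc_integrable n U g \<and>
     (\<forall>\<phi>. test_function n U \<phi> \<longrightarrow>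
        (LINT x:U|Rn_leb n. f x * partial_derivs is \<phi> x) =
        (-1) ^ length is * (LINT x:U|Rn_leb n. g x * \<phi> x))"

definition weakly_differentiable ::
  "nat \<Rightarrow> (nat \<Rightarrow> real) set \<Rightarrow> nat \<Rightarrow> ((nat \<Rightarrow> real) \<Rightarrow> real) \<Rightarrow> bool" where
  "weakly_differentiable n U k f \<longleftrightarrow>
     (\<forall>is. set is \<subseteq> {..<n} \<and> length is \<le> k \<longrightarrow> (\<exists>g. is_weak_deriv n U is f g))"

text \<open>The weak derivative is determined almost everywhere in \<open>U\<close>; any representative is chosen.\<close>

definition weak_deriv ::
  "nat \<Rightarrow> (nat \<Rightarrow> real) set \<Rightarrow> nat list \<Rightarrow> ((nat \<Rightarrow> real) \<Rightarrow> real) \<Rightarrow> (nat \<Rightarrow> real) \<Rightarrow> real" where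
  "weak_deriv n U is f = (SOME g. is_weak_deriv n U is f g)"

definition deriv_norm ::
  "nat \<Rightarrow> (nat \<Rightarrow> real) set \<Rightarrow> nat \<Rightarrow> ((nat \<Rightarrow> real) \<Rightarrow> real) \<Rightarrow> (nat \<Rightarrow> real) \<Rightarrow> ennreal" where
  "deriv_norm n U j f x =
     ennreal (L2_set (\<lambda>is. weak_deriv n U is f x) {is. set is \<subseteq> {..<n} \<and> length is = j})"

definition zero_extension :: "(nat \<Rightarrow> real) set \<Rightarrow> ((nat \<Rightarrow> real) \<Rightarrow> real) \<Rightarrow> (nat \<Rightarrow> real) \<Rightarrow> real" where
  "zero_extension \<Omega> f x = (if x \<in> \<Omega> then f x else 0)"

abbreviation leb_on :: "nat \<Rightarrow> (nat \<Rightarrow> real) set \<Rightarrow> (nat \<Rightarrow> real) measure" where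
  "leb_on n \<Omega> \<equiv> restrict_space (Rn_leb n) \<Omega>"

definition W0_1 :: "nat \<Rightarrow> (nat \<Rightarrow> real) set \<Rightarrow> nat \<Rightarrow> ((nat \<Rightarrow> real) \<Rightarrow> real) set" where
  "W0_1 n \<Omega> k = {f. integrable (leb_on n \<Omega>) f \<and>
     weakly_differentiable n \<Omega> k f \<and>
     weakly_differentiable n (topspace (Rn_top n)) k (zero_extension \<Omega> f) \<and>
     (\<forall>j\<le>k. (\<integral>\<^sup>+x. deriv_norm n \<Omega> j f x \<partial>leb_on n \<Omega>) < \<infinity>)}"

definition W0_X ::
  "((real \<Rightarrow> ennreal) \<Rightarrow> ennreal) \<Rightarrow> nat \<Rightarrow> (nat \<Rightarrow> real) set \<Rightarrow> nat \<Rightarrow> ((nat \<Rightarrow> real) \<Rightarrow> real) set" where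
  "W0_X \<rho> n \<Omega> k = {f \<in> W0_1 n \<Omega> k. (\<Sum>j\<le>k. \<rho> (rearr (leb_on n \<Omega>) (deriv_norm n \<Omega> j f))) < \<infinity>}"

end

theory Submission
  imports Defs
begin

text \<open>The Loomis-Whitney inequality on the lines parallel to the axes gives, for the level sets of
  $v=|D^jf|$, the weak type inequality
  $(b-a)\,|\{v>b\}|^{1-1/n}\le n^{-1/2}\int_{\{a<v<b\}}|D^{j+1}f|$ with the sharp order of the constant
  in \<open>n\<close>. Since the integrals are over disjoint sets, this yields for rearrangement invariant norms
  with dilation norm $h(q)<q^{1/M}$ for some $q<1$ an estimate of $\||D^jf|^*\chi_{[0,t)}\|$ that gains
  $n^{-1/2}$ and a factor $t^{1/n}$, the total exponent being capped at $1/M$. After \<open>k\<close> steps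
  $\|f^*\chi_{[0,t)}\|\le C^k n^{-k/2}t^{\theta}\||D^kf|^*\|$ with $\theta=\min(k/n,1/M)$, and
  $\int_0^1 t^{\theta-1}(\ln\frac1t)^{k/2-1}dt=\Gamma(k/2)\theta^{-k/2}$, where $n\theta\ge1$ because
  $n\ge M$.\<close>

section \<open>Distribution functions and rearrangements\<close>

text \<open>The constant may not see the dimension, so every step must lose only factors built from
  q, h(q), M and k. The powers of n balance exactly: k steps give n^(-k/2), the logarithmic weight
  with exponent 1-k/2 returns theta^(-k/2), and the product (n theta)^(-k/2) is at most 1. The cap
  at 1/M has its origin in the sum over dilations by q^l: their norms are controlled by h(q)^l
  alone, so the series can absorb a growth of at most q^(-l/M). The Boyd index is a supremum, hence
  its strict excess over 1/M is witnessed by one q, and only powers of this q occur; thus the unit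
  interval is cut into the blocks [q^j, q^(j-1)) and everything is estimated block by block. Two
  obstacles shape the rest. The norm is known only through its axioms, so averaging over level sets
  must be reduced to the triangle inequality, rearrangement invariance and the Fatou property. And
  D^jf is vector valued while the boundary of \<Omega> is arbitrary: the length of the vector is
  followed along lines for the zero extension, and a separate argument shows that the derivatives
  vanish almost everywhere outside \<Omega>.\<close>

abbreviation dist_fun :: "'a measure \<Rightarrow> ('a \<Rightarrow> ennreal) \<Rightarrow> ennreal \<Rightarrow> ennreal" where
  "dist_fun N u y \<equiv> emeasure N {x \<in> space N. y < u x}"

abbreviation unit_leb :: "real measure" where
  "unit_leb \<equiv> lebesgue_on {0<..<1::real}"

text \<open>The infimum in \<open>rearr\<close> is attained because the distribution function is
  right continuous: the sets where \<open>u\<close> exceeds t increase to the set where it exceeds y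
  as t decreases to y. Every later question on rearrangements is turned by this into one on measures
  of level sets.\<close>

lemma less_rearr_iff:
  assumes [measurable]: "u \<in> borel_measurable N"
  shows "y < rearr N u s \<longleftrightarrow> ennreal s < dist_fun N u y"
proof
  assume "y < rearr N u s"
  then show "ennreal s < dist_fun N u y"
    unfolding rearr_def by (metis (mono_tags, lifting) Inf_lower linorder_not_less mem_Collect_eq)
next
  assume less: "ennreal s < dist_fun N u y"
  then have "{x \<in> space N. y < u x} \<noteq> {}"
    by (metis emeasure_empty not_less_zero)
  then have "y \<noteq> top" by auto
  then obtain r where r: "y = ennreal r" "0 \<le> r" by (cases y) auto
  define t where "t m = ennreal (r + 1 / real (Suc m))" for m
  have eq: "{x \<in> space N. y < u x} = (\<Union>m. {x \<in> space N. t m < u x})"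
  proof (intro set_eqI iffI)
    fix x assume "x \<in> {x \<in> space N. y < u x}"
    then have x: "x \<in> space N" "y < u x" by auto
    then obtain c where c: "ennreal r < ennreal c" "ennreal c < u x" "0 \<le> c"
      by (metis r(1) dense ennreal_cases infinity_ennreal_def less_top_ennreal linorder_not_less top_greatest)
    then have "0 < c - r" using r by (simp add: ennreal_less_iff)
    then obtain m where "1 / real (Suc m) < c - r" using nat_approx_posE by metis
    then have "t m \<le> ennreal c" unfolding t_def by (intro ennreal_leI) simp
    then have "t m < u x" using c by (blast intro: le_less_trans)
    then show "x \<in> (\<Union>m. {x \<in> space N. t m < u x})" using x by auto
  next
    fix x assume "x \<in> (\<Union>m. {x \<in> space N. t m < u x})"
    then obtain m where "x \<in> space N" "t m < u x" by auto
    moreover have "y \<le> t m" unfolding t_def r by (intro ennreal_leI) simp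
    ultimately show "x \<in> {x \<in> space N. y < u x}" by auto
  qed
  have "incseq (\<lambda>m. {x \<in> space N. t m < u x})"
  proof (rule incseq_SucI, safe)
    fix m x assume "t m < u x"
    have "t (Suc m) \<le> t m" unfolding t_def by (intro ennreal_leI) (simp add: field_simps)
    then show "t (Suc m) < u x" using \<open>t m < u x\<close> by simp
  qed
  then have "dist_fun N u y = (SUP m. dist_fun N u (t m))"
    unfolding eq by (intro SUP_emeasure_incseq[symmetric]) auto
  then obtain m where m: "ennreal s < dist_fun N u (t m)"
    using less by (auto simp: less_SUP_iff)
  have "t m \<le> rearr N u s"
    unfolding rearr_def
  proof (rule Inf_greatest)
    fix z assume "z \<in> {t. dist_fun N u t \<le> ennreal s}"
    then have "dist_fun N u z < dist_fun N u (t m)" using m by auto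
    then show "t m \<le> z"
      by (rule contrapos_pp) (auto simp: not_le not_less intro!: emeasure_mono)
  qed
  moreover have "0 < r + 1 / real (Suc m)" using r by (intro add_nonneg_pos) auto
  then have "y < t m" unfolding t_def r by (intro ennreal_lessI) auto
  ultimately show "y < rearr N u s" by simp
qed

lemma rearr_le_iff:
  assumes "u \<in> borel_measurable N"
  shows "rearr N u s \<le> y \<longleftrightarrow> dist_fun N u y \<le> ennreal s"
  using less_rearr_iff[OF assms] by (meson not_less)

lemma rearr_antimono: "s \<le> s' \<Longrightarrow> rearr N u s' \<le> rearr N u s"
  unfolding rearr_def by (intro Inf_superset_mono) (auto intro: order_trans ennreal_leI)

lemma rearr_cong_dist:
  "(\<And>y. dist_fun N u y = dist_fun N' u' y) \<Longrightarrow> rearr N u = rearr N' u'"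
  by (simp add: rearr_def fun_eq_iff)

lemma rearr_mono_dist:
  "(\<And>y. dist_fun N u y \<le> dist_fun N' u' y) \<Longrightarrow> rearr N u s \<le> rearr N' u' s"
  unfolding rearr_def by (intro Inf_superset_mono) (auto intro: order_trans)

lemma borel_measurable_rearr [measurable]:
  assumes "u \<in> borel_measurable N"
  shows "rearr N u \<in> borel_measurable borel"
proof (rule borel_measurableI_greater)
  show "{s \<in> space borel. y < rearr N u s} \<in> sets borel" for y
  proof -
    have "{s \<in> space borel. y < rearr N u s} = {s. ennreal s < dist_fun N u y}"
      using less_rearr_iff[OF assms] by auto
    also have "\<dots> \<in> sets borel" by measurable
    finally show ?thesis .
  qed
qed

lemma borel_measurable_unit_leb:
  "f \<in> borel_measurable borel \<Longrightarrow> f \<in> borel_measurable unit_leb"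
  by (intro measurable_restrict_space1 measurable_completion) simp

lemma emeasure_unit_leb:
  assumes "A \<in> sets borel" "A \<subseteq> {0<..<1}"
  shows "emeasure unit_leb A = emeasure lborel A"
  using assms by (subst emeasure_restrict_space) auto

text \<open>Each level set of the rearrangement is an initial interval (0,c), where c is the measure
  of the level set of \<open>u\<close>; total mass at most one makes it fit into the unit interval.
  This carries functions on \<Omega> to the interval on which \<open>\<rho>\<close> acts.\<close>

lemma dist_rearr:
  assumes u [measurable]: "u \<in> borel_measurable N" and le: "emeasure N (space N) \<le> 1"
  shows "dist_fun unit_leb (rearr N u) y = dist_fun N u y"
proof -
  have "dist_fun N u y \<le> emeasure N (space N)" by (intro emeasure_mono) auto
  also note le
  finally obtain c where c: "dist_fun N u y = ennreal c" "0 \<le> c" "c \<le> 1"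
    by (cases "dist_fun N u y") (auto simp: top_unique)
  have "{s \<in> space unit_leb. y < rearr N u s} = {0<..<c}"
    using c by (auto simp: less_rearr_iff space_restrict_space ennreal_less_iff)
  then have "dist_fun unit_leb (rearr N u) y = emeasure unit_leb {0<..<c}" by simp
  also have "\<dots> = ennreal c" using c by (subst emeasure_unit_leb) auto
  finally show ?thesis using c by simp
qed

lemma emeasure_unit_leb_space: "emeasure unit_leb (space unit_leb) = 1"
  by (simp add: space_restrict_space emeasure_unit_leb)

lemma dist_rearr_unit:
  "f \<in> borel_measurable unit_leb \<Longrightarrow> dist_fun unit_leb (rearr unit_leb f) y = dist_fun unit_leb f y"
  by (rule dist_rearr) (simp_all only: emeasure_unit_leb_space order_refl)

section \<open>Consequences of the norm axioms: comparison, sums, dilations\<close>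

context ri_norm begin

lemma rho_rearr:
  assumes f: "f \<in> borel_measurable unit_leb"
  shows "\<rho> (rearr unit_leb f) = \<rho> f"
proof (rule rearrangement_invariant)
  have "rearr unit_leb (rearr unit_leb f) = rearr unit_leb f"
    by (rule rearr_cong_dist, rule dist_rearr[OF f]) (rule emeasure_unit_leb_space[THEN eq_refl])
  then show "\<forall>s\<in>{0..<1}. rearr unit_leb (rearr unit_leb f) s = rearr unit_leb f s" by simp
qed (use f in \<open>auto intro: borel_measurable_unit_leb\<close>)

text \<open>Passing to rearrangements turns the comparison of distribution functions into a
  pointwise one. Rearrangement invariance is used in this form when cells of a step function are
  permuted.\<close>

lemma rho_mono_dist:
  assumes f: "f \<in> borel_measurable unit_leb" and g: "g \<in> borel_measurable unit_leb"
    and le: "\<And>y. dist_fun unit_leb f y \<le> dist_fun unit_leb g y"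
  shows "\<rho> f \<le> \<rho> g"
proof -
  have "\<rho> (rearr unit_leb f) \<le> \<rho> (rearr unit_leb g)"
    by (rule monotone)
      (auto intro!: borel_measurable_unit_leb borel_measurable_rearr rearr_mono_dist le f g simp del: space_restrict_space2)
  then show ?thesis using rho_rearr f g by simp
qed

lemma rho_mono:
  assumes "f \<in> borel_measurable unit_leb" "g \<in> borel_measurable unit_leb"
    and "\<And>x. 0 < x \<Longrightarrow> x < 1 \<Longrightarrow> f x \<le> g x"
  shows "\<rho> f \<le> \<rho> g"
  using assms by (intro monotone AE_I2) (auto simp: space_restrict_space)

lemma rho_sum:
  assumes "finite A" "\<And>i. i \<in> A \<Longrightarrow> f i \<in> borel_measurable unit_leb"
  shows "\<rho> (\<lambda>x. \<Sum>i\<in>A. f i x) \<le> (\<Sum>i\<in>A. \<rho> (f i))"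
  using assms
proof (induction A rule: finite_induct)
  case empty
  then show ?case using zero_iff[of "\<lambda>x. 0"] by simp
next
  case (insert i A)
  have "\<rho> (\<lambda>x. \<Sum>i\<in>insert i A. f i x) = \<rho> (\<lambda>x. f i x + (\<Sum>i\<in>A. f i x))"
    using insert by simp
  also have "\<dots> \<le> \<rho> (f i) + \<rho> (\<lambda>x. \<Sum>i\<in>A. f i x)"
    using insert.prems by (intro triangle borel_measurable_sum) auto
  also have "\<dots> \<le> \<rho> (f i) + (\<Sum>i\<in>A. \<rho> (f i))"
    using insert by (intro add_mono) auto
  finally show ?case using insert by simp
qed

text \<open>Countable subadditivity is the Fatou property for the increasing partial sums.\<close>

lemma rho_suminf:
  assumes [measurable]: "\<And>i::nat. f i \<in> borel_measurable unit_leb"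
  shows "\<rho> (\<lambda>x. \<Sum>i. f i x) \<le> (\<Sum>i. \<rho> (f i))"
proof -
  have "(SUP n. \<rho> (\<lambda>x. \<Sum>i<n. f i x)) = \<rho> (\<lambda>x. \<Sum>i. f i x)"
    by (rule fatou) (auto simp: suminf_eq_SUP incseq_def intro!: sum_mono2 AE_I2)
  moreover have "(SUP n. \<rho> (\<lambda>x. \<Sum>i<n. f i x)) \<le> (SUP n. \<Sum>i<n. \<rho> (f i))"
    by (intro SUP_mono') (auto intro: rho_sum)
  ultimately show ?thesis by (simp add: suminf_eq_SUP)
qed

text \<open>\<open>dilation\<close> rearranges its argument first. Scaling by \<open>q\<close>
  multiplies every distribution function by \<open>q\<close>, so dilating \<open>f\<close> itself
  gives a function equimeasurable with \<open>dilation q f\<close>, and the bound holds for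
  functions that are not decreasing.\<close>

lemma rho_dilation:
  assumes q: "0 < q" "q < 1" and [measurable]: "f \<in> borel_measurable borel"
    and pos: "dilation_norm \<rho> q > 0"
  shows "\<rho> (\<lambda>t. if t < q then f (t / q) else 0) \<le> dilation_norm \<rho> q * \<rho> f"
proof -
  let ?D = "\<lambda>t. if t < q then f (t / q) else 0"
  have f: "f \<in> borel_measurable unit_leb" by (rule borel_measurable_unit_leb) simp
  have dist: "dist_fun unit_leb (\<lambda>t. if t < q then g (t / q) else 0) y = ennreal q * dist_fun unit_leb g y"
    if [measurable]: "g \<in> borel_measurable borel" for g :: "real \<Rightarrow> ennreal" and y
  proof -
    have eq: "{t \<in> space unit_leb. y < (if t < q then g (t / q) else 0)} =
       (\<lambda>t. q *\<^sub>R t + 0) ` {t \<in> space unit_leb. y < g t}" (is "_ = _ ` ?B")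
    proof (intro set_eqI iffI)
      fix t assume "t \<in> {t \<in> space unit_leb. y < (if t < q then g (t / q) else 0)}"
      then have "t / q \<in> ?B" using q by (auto simp: space_restrict_space split: if_splits)
      moreover have "t = q *\<^sub>R (t / q) + 0" using q by simp
      ultimately show "t \<in> (\<lambda>t. q *\<^sub>R t + 0) ` ?B" by blast
    next
      fix t assume "t \<in> (\<lambda>t. q *\<^sub>R t + 0) ` ?B"
      then obtain s where s: "t = q * s" "0 < s" "s < 1" "y < g s" by (auto simp: space_restrict_space)
      have "q * s < 1 * 1" by (rule mult_strict_mono) (use q s in auto)
      with s q show "t \<in> {t \<in> space unit_leb. y < (if t < q then g (t / q) else 0)}"
        by (auto simp: space_restrict_space)
    qed
    have B: "?B \<subseteq> {0<..<1}" by (auto simp: space_restrict_space)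
    have "emeasure unit_leb ((\<lambda>t. q *\<^sub>R t + 0) ` ?B) = emeasure lebesgue ((\<lambda>t. q *\<^sub>R t + 0) ` ?B)"
      unfolding eq[symmetric] by (intro emeasure_restrict_space) (auto simp: space_restrict_space)
    also have "\<dots> = ennreal q * emeasure lebesgue ?B"
      using q by (subst emeasure_lebesgue_affine) simp
    also have "emeasure lebesgue ?B = emeasure unit_leb ?B"
      using B by (intro emeasure_restrict_space[symmetric]) auto
    finally show ?thesis unfolding eq .
  qed
  have "\<rho> ?D = \<rho> (dilation q f)"
  proof (rule rearrangement_invariant)
    have eq: "dilation q f = (\<lambda>t. if t < q then rearr unit_leb f (t / q) else 0)"
      by (auto simp: dilation_def)
    have [measurable]: "rearr unit_leb f \<in> borel_measurable borel" using f by measurable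
    show m: "dilation q f \<in> borel_measurable unit_leb"
      unfolding eq by (rule borel_measurable_unit_leb) measurable
    have "rearr unit_leb ?D = rearr unit_leb (dilation q f)"
      unfolding eq
      by (rule rearr_cong_dist) (simp only: dist[OF assms(3)] dist[OF \<open>rearr unit_leb f \<in> borel_measurable borel\<close>] dist_rearr_unit[OF f])
    then show "\<forall>s\<in>{0..<1}. rearr unit_leb ?D s = rearr unit_leb (dilation q f) s" by simp
    show "?D \<in> borel_measurable unit_leb" by (rule borel_measurable_unit_leb) measurable
  qed
  also have "\<dots> \<le> dilation_norm \<rho> q * \<rho> f"
  \<comment> \<open>The dilation norm is a supremum over the unit ball, so \<open>f\<close> has to
    be normalised. For \<open>\<rho> f = top\<close> the right side is infinite because the dilation
    norm is positive; for \<open>\<rho> f = 0\<close> the dilated function is null as well.\<close>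
  proof (cases "\<rho> f = 0 \<or> \<rho> f = top")
    case True
    then consider "\<rho> f = 0" | "\<rho> f = top" by blast
    then show ?thesis
    proof cases
      case 1
      then have "AE x in unit_leb. f x = 0" using zero_iff f by auto
      then have 0: "dist_fun unit_leb f y = 0" for y
        using AE_iff_measurable[of _ unit_leb] f
        by (intro emeasure_eq_0_AE) (auto elim!: eventually_mono)
      have "\<rho> ?D \<le> \<rho> f"
        by (rule rho_mono_dist) (simp_all only: f dist[OF assms(3)] 0, auto intro!: borel_measurable_unit_leb)
      with 1 \<open>\<rho> ?D = \<rho> (dilation q f)\<close> show ?thesis by simp
    next
      case 2
      then show ?thesis using pos by (simp add: ennreal_mult_top)
    qed
  next
    case False
    then obtain r where r: "\<rho> f = ennreal r" "0 < r"
      by (cases "\<rho> f") (auto simp: order_less_le)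
    let ?g = "\<lambda>x. ennreal (1/r) * f x"
    have g: "\<rho> ?g \<le> 1" using r f
      by (subst homogeneous) (auto simp: ennreal_mult[symmetric])
    have gm: "?g \<in> borel_measurable unit_leb" using f by measurable
    have gb: "?g \<in> borel_measurable borel" by measurable
    have "\<rho> (dilation q ?g) \<le> dilation_norm \<rho> q"
      unfolding dilation_norm_def by (rule SUP_upper) (use g gm in auto)
    moreover have "\<rho> (dilation q ?g) = \<rho> (\<lambda>t. if t < q then ?g (t/q) else 0)"
    proof (rule rearrangement_invariant)
      have eq: "dilation q ?g = (\<lambda>t. if t < q then rearr unit_leb ?g (t / q) else 0)"
        by (auto simp: dilation_def)
      have [measurable]: "rearr unit_leb ?g \<in> borel_measurable borel" using gm by measurable
      show m: "dilation q ?g \<in> borel_measurable unit_leb"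
        unfolding eq by (rule borel_measurable_unit_leb) measurable
      have "rearr unit_leb (\<lambda>t. if t < q then ?g (t/q) else 0) = rearr unit_leb (dilation q ?g)"
        unfolding eq
      by (rule rearr_cong_dist) (simp only: dist[OF gb] dist[OF \<open>rearr unit_leb ?g \<in> borel_measurable borel\<close>] dist_rearr_unit[OF gm])
      then show "\<forall>s\<in>{0..<1}. rearr unit_leb (dilation q ?g) s = rearr unit_leb (\<lambda>t. if t < q then ?g (t/q) else 0) s" by simp
      show "(\<lambda>t. if t < q then ?g (t/q) else 0) \<in> borel_measurable unit_leb" by (rule borel_measurable_unit_leb) measurable
    qed
    moreover have "\<dots> = \<rho> (\<lambda>t. ennreal (1/r) * ?D t)"
      by (intro arg_cong[where f=\<rho>]) auto
    moreover have "\<dots> = ennreal (1/r) * \<rho> ?D"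
      using r by (intro homogeneous borel_measurable_unit_leb) auto
    ultimately have "ennreal (1/r) * \<rho> ?D \<le> dilation_norm \<rho> q" by simp
    then have "ennreal r * (ennreal (1/r) * \<rho> ?D) \<le> ennreal r * dilation_norm \<rho> q"
      by (intro mult_left_mono) auto
    then show ?thesis using r \<open>\<rho> ?D = \<rho> (dilation q f)\<close>
      by (simp add: mult.assoc[symmetric] ennreal_mult[symmetric] mult.commute)
  qed
  finally show ?thesis .
qed

end

section \<open>Lower sums and geometric blocks\<close>

lemma nn_integral_subgraph: "(\<integral>\<^sup>+y. indicator {y. 0 \<le> y \<and> ennreal y < c} y \<partial>lborel) = c"
proof (cases c)
  case (real r)
  then have "{y. 0 \<le> y \<and> ennreal y < c} = {0..<r}" by (auto simp: ennreal_less_iff)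
  then show ?thesis using real by simp
next
  case top
  have "emeasure lborel {0::real..} = top"
  proof -
    have *: "ennreal (real n) \<le> emeasure lborel {0::real..}" for n
    proof -
      have "emeasure lborel {0..real n} \<le> emeasure lborel {0::real..}" by (intro emeasure_mono) auto
      then show ?thesis by simp
    qed
    show ?thesis
    proof (cases "emeasure lborel {0::real..}")
      case (real r)
      obtain n where "r < real n" using reals_Archimedean2 by blast
      then show ?thesis using *[of n] real by (simp add: ennreal_le_iff)
    qed simp
  qed
  moreover have "{y. 0 \<le> y \<and> ennreal y < c} = {0..}" using top by auto
  ultimately show ?thesis using top by simp
qed

text \<open>Tonelli on the region below the graph; infinite values of \<open>u\<close> are covered,
  since \<open>nn_integral_subgraph\<close> holds for \<open>top\<close> too.\<close>

lemma nn_integral_layer_cake: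
  assumes "sigma_finite_measure N" and [measurable]: "u \<in> borel_measurable N"
  shows "(\<integral>\<^sup>+x. u x \<partial>N) = (\<integral>\<^sup>+y. indicator {0..} y * dist_fun N u (ennreal y) \<partial>lborel)"
proof -
  interpret sigma_finite_measure N by fact
  interpret P: pair_sigma_finite N lborel by unfold_locales
  have "(\<integral>\<^sup>+x. u x \<partial>N) = (\<integral>\<^sup>+x. \<integral>\<^sup>+y. indicator {y. 0 \<le> y \<and> ennreal y < u x} y \<partial>lborel \<partial>N)"
    by (simp only: nn_integral_subgraph)
  also have "\<dots> = (\<integral>\<^sup>+y. \<integral>\<^sup>+x. indicator {y. 0 \<le> y \<and> ennreal y < u x} y \<partial>N \<partial>lborel)"
    by (rule P.Fubini'[symmetric]) (simp add: case_prod_beta')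
  also have "\<dots> = (\<integral>\<^sup>+y. indicator {0..} y * dist_fun N u (ennreal y) \<partial>lborel)"
  proof (intro nn_integral_cong)
    fix y :: real
    have "(\<integral>\<^sup>+x. indicator {y. 0 \<le> y \<and> ennreal y < u x} y \<partial>N)
        = (\<integral>\<^sup>+x. indicator {0..} y * indicator {x\<in>space N. ennreal y < u x} x \<partial>N)"
      by (intro nn_integral_cong) (auto split: split_indicator)
    also have "\<dots> = indicator {0..} y * dist_fun N u (ennreal y)"
      by (subst nn_integral_cmult) auto
    finally show "(\<integral>\<^sup>+x. indicator {y. 0 \<le> y \<and> ennreal y < u x} y \<partial>N) = indicator {0..} y * dist_fun N u (ennreal y)" .
  qed
  finally show ?thesis .
qed

text \<open>The mean over [0,l] of the step function that takes, on each of \<open>m\<close> equal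
  cells, the value of the decreasing function \<open>rearr N u\<close> at the right endpoint. Equal
  cells are chosen because they can later be permuted.\<close>

definition lower_sum :: "'a measure \<Rightarrow> ('a \<Rightarrow> ennreal) \<Rightarrow> real \<Rightarrow> nat \<Rightarrow> ennreal" where
  "lower_sum N u l m = (\<Sum>i<m. rearr N u (real (Suc i) * l / real m)) * ennreal (1 / real m)"

text \<open>With \<open>d = dist_fun N u y\<close> this counts the cells on which the step function
  of \<open>lower_sum\<close> exceeds the height y; it is the layer cake counterpart of the lower
  sum.\<close>

definition cell_count :: "real \<Rightarrow> nat \<Rightarrow> ennreal \<Rightarrow> nat" where
  "cell_count l m d = card {i. i < m \<and> ennreal (real (Suc i) * l / real m) < d}"

lemma cell_count_le:
  assumes "0 < l" "0 < m"
  shows "ennreal (real (cell_count l m d) * l / real m) \<le> d"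
proof (cases "cell_count l m d = 0")
  case False
  let ?S = "{i. i < m \<and> ennreal (real (Suc i) * l / real m) < d}"
  have fin: "finite ?S" by auto
  have "?S \<noteq> {}" using False unfolding cell_count_def by (metis card.empty)
  then have "Max ?S \<in> ?S" using Max_in fin by blast
  moreover have "?S \<subseteq> {..Max ?S}" using fin by (auto intro: Max_ge)
  then have "cell_count l m d \<le> Suc (Max ?S)" unfolding cell_count_def
    using card_mono[of "{..Max ?S}" ?S] by simp
  then have "ennreal (real (cell_count l m d) * l / real m) \<le> ennreal (real (Suc (Max ?S)) * l / real m)"
    using assms by (intro ennreal_leI divide_right_mono mult_right_mono) auto
  ultimately show ?thesis by auto
qed simp

text \<open>Pigeonhole: among the first \<open>Suc (cell_count l m d)\<close> indices one is not
  counted, so either its right endpoint is at least \<open>d\<close> or it lies beyond the last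
  cell, where \<open>d \<le> ennreal l\<close> applies.\<close>

lemma cell_count_ge:
  assumes "0 < l" "0 < m" "d \<le> ennreal l"
  shows "d \<le> ennreal (real (Suc (cell_count l m d)) * l / real m)"
proof -
  let ?S = "{i. i < m \<and> ennreal (real (Suc i) * l / real m) < d}"
  have "\<not> {..cell_count l m d} \<subseteq> ?S"
    using card_mono[of ?S "{..cell_count l m d}"] by (auto simp: cell_count_def simp del: of_nat_Suc)
  then obtain i where "i \<le> cell_count l m d" "\<not> (i < m \<and> ennreal (real (Suc i) * l / real m) < d)"
    by (auto simp del: of_nat_Suc)
  then have i: "i \<le> cell_count l m d" "i \<ge> m \<or> d \<le> ennreal (real (Suc i) * l / real m)"
    by (auto simp: not_less simp del: of_nat_Suc)
  from i(2) have "d \<le> ennreal (real (Suc i) * l / real m)"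
  proof
    assume "i \<ge> m"
    then have "real m * l \<le> real (Suc i) * l" using assms by (intro mult_right_mono) auto
    then have "l \<le> real (Suc i) * l / real m" using assms by (simp add: field_simps)
    then show ?thesis using assms(3) by (meson ennreal_leI order_trans)
  qed
  also have "\<dots> \<le> ennreal (real (Suc (cell_count l m d)) * l / real m)"
    using assms i(1) by (intro ennreal_leI divide_right_mono mult_right_mono) auto
  finally show ?thesis .
qed

text \<open>The coarse cell \<open>i\<close> splits into the fine cells \<open>2 * i\<close> and
  \<open>2 * i + 1\<close>, whose right endpoints do not exceed the coarse one.\<close>

lemma cell_count_double:
  assumes "0 < l" "0 < m"
  shows "2 * cell_count l m d \<le> cell_count l (2 * m) d"
proof -
  let ?S = "\<lambda>m. {i. i < m \<and> ennreal (real (Suc i) * l / real m) < d}"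
  let ?f = "\<lambda>(i,b::nat). 2 * i + b"
  have inj: "inj_on ?f (?S m \<times> {0,1})"
    by (auto simp: inj_on_def) presburger+
  have "?f ` (?S m \<times> {0,1}) \<subseteq> ?S (2 * m)"
  proof (rule image_subsetI)
    fix z assume "z \<in> ?S m \<times> {0,1::nat}"
    then obtain i b where z: "z = (i, b)" and i: "i < m" "ennreal (real (Suc i) * l / real m) < d" and b: "b \<le> 1"
      by (auto simp del: of_nat_Suc)
    have "real (Suc (2 * i + b)) * l / real (2 * m) \<le> real (2 * Suc i) * l / real (2 * m)"
      using assms b by (intro divide_right_mono mult_right_mono) auto
    also have "\<dots> = real (Suc i) * l / real m" by (simp only: of_nat_mult mult.assoc) (simp del: of_nat_Suc)
    finally have "ennreal (real (Suc (2 * i + b)) * l / real (2 * m)) < d"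
      using i(2) by (meson ennreal_leI le_less_trans)
    then show "?f z \<in> ?S (2 * m)" using i b unfolding z by (simp del: of_nat_Suc of_nat_mult)
  qed
  then have "card (?f ` (?S m \<times> {0,1})) \<le> card (?S (2 * m))" by (intro card_mono) auto
  then show ?thesis using inj by (simp add: card_image cell_count_def card_cartesian_product)
qed

lemma cell_count_mono:
  assumes "0 < l" "0 < m"
  shows "real (cell_count l m d) * l / real m \<le> real (cell_count l (2 * m) d) * l / real (2 * m)"
proof -
  have "2 * real (cell_count l m d) \<le> real (cell_count l (2 * m) d)"
    using cell_count_double[OF assms, of d] by (metis of_nat_le_iff of_nat_mult of_nat_numeral)
  then have "2 * real (cell_count l m d) * l / (2 * real m) \<le> real (cell_count l (2 * m) d) * l / (2 * real m)"
    using assms by (intro divide_right_mono mult_right_mono) auto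
  then show ?thesis by simp
qed

lemma mult_indicator_count:
  assumes "0 \<le> l"
  shows "ennreal (l / real m) * (a * of_nat c) = a * ennreal (real c * l / real m)"
proof -
  have "ennreal (real c * l / real m) = ennreal ((l / real m) * real c)" by (simp add: mult.commute)
  also have "\<dots> = ennreal (l / real m) * of_nat c"
    using assms by (simp only: ennreal_mult' divide_nonneg_nonneg of_nat_0_le_iff ennreal_of_nat_eq_real_of_nat)
  finally show ?thesis by (simp add: mult.left_commute)
qed

text \<open>Each value of \<open>rearr\<close> is the length of the heights below it; exchanging sum
  and integral leaves, at every height, the number of cells that reach above it.\<close>

lemma lower_sum_eq:
  assumes [measurable]: "u \<in> borel_measurable N" and m: "0 < m" and l: "0 < l"
  shows "ennreal l * lower_sum N u l m =
    (\<integral>\<^sup>+y. indicator {0..} y * ennreal (real (cell_count l m (dist_fun N u (ennreal y))) * l / real m) \<partial>lborel)"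
proof -
  have "ennreal l * lower_sum N u l m = ennreal (l / real m) * (\<Sum>i<m. rearr N u (real (Suc i) * l / real m))"
    unfolding lower_sum_def using l by (simp add: mult.assoc mult.left_commute divide_inverse ennreal_mult' mult.commute)
  also have "(\<Sum>i<m. rearr N u (real (Suc i) * l / real m)) =
     (\<Sum>i<m. \<integral>\<^sup>+y. indicator {y. 0 \<le> y \<and> ennreal y < rearr N u (real (Suc i) * l / real m)} y \<partial>lborel)"
    by (simp only: nn_integral_subgraph)
  also have "\<dots> = (\<integral>\<^sup>+y. (\<Sum>i<m. indicator {y. 0 \<le> y \<and> ennreal y < rearr N u (real (Suc i) * l / real m)} y) \<partial>lborel)"
    by (subst nn_integral_sum) auto
  also have "ennreal (l / real m) * \<dots> = (\<integral>\<^sup>+y. ennreal (l / real m) * (\<Sum>i<m. indicator {y. 0 \<le> y \<and> ennreal y < rearr N u (real (Suc i) * l / real m)} y) \<partial>lborel)"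
    by (subst nn_integral_cmult) auto
  also have "\<dots> = (\<integral>\<^sup>+y. indicator {0..} y * ennreal (real (cell_count l m (dist_fun N u (ennreal y))) * l / real m) \<partial>lborel)"
  proof (intro nn_integral_cong)
    fix y :: real
    have "(\<Sum>i<m. indicator {y. 0 \<le> y \<and> ennreal y < rearr N u (real (Suc i) * l / real m)} y)
      = (indicator {0..} y * of_nat (cell_count l m (dist_fun N u (ennreal y))) :: ennreal)"
      unfolding cell_count_def by (cases "0 \<le> y") (auto simp: less_rearr_iff indicator_def sum.If_cases Int_def)
    then show "ennreal (l / real m) * (\<Sum>i<m. indicator {y. 0 \<le> y \<and> ennreal y < rearr N u (real (Suc i) * l / real m)} y)
      = indicator {0..} y * ennreal (real (cell_count l m (dist_fun N u (ennreal y))) * l / real m)"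
      using l by (simp only: mult_indicator_count[OF less_imp_le])
  qed
  finally show ?thesis .
qed

text \<open>Monotonicity holds under doubling, where partitions are nested, and may fail from
  \<open>m\<close> to \<open>m + 1\<close>. This is why all limits run along
  \<open>2 ^ r\<close>.\<close>

lemma lower_sum_mono:
  assumes [measurable]: "u \<in> borel_measurable N" and m: "0 < m" and l: "0 < l"
  shows "lower_sum N u l m \<le> lower_sum N u l (2 * m)"
proof -
  have "ennreal l * lower_sum N u l m \<le> ennreal l * lower_sum N u l (2 * m)"
    unfolding lower_sum_eq[OF assms] lower_sum_eq[OF assms(1) mult_pos_pos[OF pos2 m] l]
    by (intro nn_integral_mono mult_left_mono ennreal_leI cell_count_mono m l) simp
  then show ?thesis using l by (subst (asm) ennreal_mult_le_mult_iff) auto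
qed

text \<open>The last hypothesis says that \<open>u\<close> is positive on a set of measure at most
  \<open>l\<close>, so its rearrangement vanishes beyond \<open>l\<close> and the cells in [0,l]
  miss nothing. At each height the error is one cell, which disappears under dyadic
  refinement.\<close>

lemma nn_integral_le_lower_sum:
  assumes "sigma_finite_measure N" and u[measurable]: "u \<in> borel_measurable N" and l: "0 < l"
    and le: "dist_fun N u 0 \<le> ennreal l"
  shows "(\<integral>\<^sup>+x. u x \<partial>N) \<le> ennreal l * (SUP r. lower_sum N u l (2 ^ r))"
proof -
  let ?c = "\<lambda>r y. indicator {0..} y * ennreal (real (cell_count l (2^r) (dist_fun N u (ennreal y))) * l / real (2^r))"
  interpret sigma_finite_measure N by fact
  have meas: "?c r \<in> borel_measurable lborel" for r
  proof -
    have eq: "?c r y = ennreal (l / real (2^r)) * (\<Sum>i<2^r. indicator {y. 0 \<le> y \<and> ennreal y < rearr N u (real (Suc i) * l / real (2^r))} y)" for y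
    proof -
      have "(\<Sum>i<2^r. indicator {y. 0 \<le> y \<and> ennreal y < rearr N u (real (Suc i) * l / real (2^r))} y)
        = (indicator {0..} y * of_nat (cell_count l (2^r) (dist_fun N u (ennreal y))) :: ennreal)"
        unfolding cell_count_def by (cases "0 \<le> y") (auto simp: less_rearr_iff indicator_def sum.If_cases Int_def)
      then show ?thesis
        using l by (simp only: mult_indicator_count[OF less_imp_le])
    qed
    show ?thesis unfolding eq by measurable
  qed
  have inc: "incseq ?c"
  proof (rule incseq_SucI, rule le_funI)
    fix r y
    show "?c r y \<le> ?c (Suc r) y"
      unfolding power_Suc by (intro mult_left_mono ennreal_leI cell_count_mono l) auto
  qed
  have "(\<integral>\<^sup>+x. u x \<partial>N) = (\<integral>\<^sup>+y. indicator {0..} y * dist_fun N u (ennreal y) \<partial>lborel)"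
    by (rule nn_integral_layer_cake[OF assms(1,2)])
  also have "\<dots> \<le> (\<integral>\<^sup>+y. (SUP r. ?c r y) \<partial>lborel)"
  proof (intro nn_integral_mono)
    fix y :: real
    let ?d = "dist_fun N u (ennreal y)"
    show "indicator {0..} y * ?d \<le> (SUP r. ?c r y)"
    proof (cases "0 \<le> y")
      case True
      have "?d \<le> dist_fun N u 0" by (intro emeasure_mono) (auto intro: le_less_trans[rotated])
      with le have d: "?d \<le> ennreal l" by simp
      then obtain d where d': "?d = ennreal d" "0 \<le> d" by (cases ?d) (auto simp: top_unique)
      \<comment> \<open>By \<open>cell_count_ge\<close> the counted cells miss at most one cell of
        width l/2^r.\<close>
      have "?d \<le> (SUP r. ennreal (real (cell_count l (2^r) ?d) * l / real (2^r)))"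
      proof (rule ennreal_le_epsilon)
        fix e :: real assume "0 < e"
        obtain r where r: "(1/2)^r < e / l" using \<open>0 < e\<close> l real_arch_pow_inv[of "e/l" "1/2"] by auto
        have "?d \<le> ennreal (real (Suc (cell_count l (2^r) ?d)) * l / real (2^r))"
          by (rule cell_count_ge) (use l d in auto)
        also have "\<dots> \<le> ennreal (real (cell_count l (2^r) ?d) * l / real (2^r) + e)"
        proof (rule ennreal_leI)
          have "l / 2^r \<le> e" using r l by (simp add: field_simps power_one_over)
          then show "real (Suc (cell_count l (2^r) ?d)) * l / real (2^r) \<le> real (cell_count l (2^r) ?d) * l / real (2^r) + e"
            by (simp add: distrib_right add_divide_distrib)
        qed
        also have "\<dots> = ennreal (real (cell_count l (2^r) ?d) * l / real (2^r)) + ennreal e"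
          using l \<open>0 < e\<close> by (intro ennreal_plus) auto
        also have "\<dots> \<le> (SUP r. ennreal (real (cell_count l (2^r) ?d) * l / real (2^r))) + ennreal e"
          by (intro add_right_mono SUP_upper) auto
        finally show "?d \<le> (SUP r. ennreal (real (cell_count l (2^r) ?d) * l / real (2^r))) + ennreal e" .
      qed
      then show ?thesis using True by simp
    qed simp
  qed
  also have "\<dots> = (SUP r. \<integral>\<^sup>+y. ?c r y \<partial>lborel)"
    by (intro nn_integral_monotone_convergence_SUP inc meas)
  also have "\<dots> = (SUP r. ennreal l * lower_sum N u l (2 ^ r))"
    using lower_sum_eq[OF u _ l, of "2^_"] by simp
  also have "\<dots> = ennreal l * (SUP r. lower_sum N u l (2 ^ r))"
    by (rule SUP_mult_left_ennreal[symmetric])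
  finally show ?thesis .
qed

text \<open>For $0<q<1$ and $0<t<1$, \<open>blk q t\<close> is the index $j\ge1$ with $q^j\le t<q^{j-1}$.\<close>

definition blk :: "real \<Rightarrow> real \<Rightarrow> nat" where
  "blk q t = (LEAST j. q ^ j \<le> t)"

lemma blk_measurable [measurable]: "blk q \<in> measurable borel (count_space UNIV)"
  unfolding blk_def by measurable

context
  fixes q :: real
  assumes q: "0 < q" "q < 1"
begin

lemma blk_le: "0 < t \<Longrightarrow> q ^ blk q t \<le> t"
  unfolding blk_def using real_arch_pow_inv[of t q] q by (metis LeastI less_imp_le)

lemma less_blk_iff: "0 < t \<Longrightarrow> p < blk q t \<longleftrightarrow> t < q ^ p"
proof
  assume "p < blk q t" then show "t < q ^ p"
    unfolding blk_def using not_less_Least by fastforce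
next
  assume "0 < t" "t < q ^ p"
  then have "q ^ blk q t < q ^ p" using blk_le by fastforce
  then show "p < blk q t" using q by (metis linorder_neqE_nat power_strict_decreasing less_asym less_irrefl)
qed

lemma blk_pos: "0 < t \<Longrightarrow> t < 1 \<Longrightarrow> 0 < blk q t"
  using less_blk_iff[of t 0] by simp

text \<open>Dilation by \<open>q ^ l\<close> acts on block-constant functions as a shift of the
  index. The truncated subtraction is harmless, since t < q^l forces l <
  \<open>blk q t\<close>.\<close>

lemma blk_div:
  assumes "0 < t" "t < q ^ l"
  shows "blk q (t / q ^ l) = blk q t - l"
proof -
  have "p < blk q (t / q ^ l) \<longleftrightarrow> p + l < blk q t" for p
    using assms q by (simp add: less_blk_iff power_add field_simps)
  then show ?thesis by (metis less_diff_conv linorder_neqE_nat less_irrefl)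
qed

end

section \<open>Block averages in rearrangement invariant spaces\<close>

text \<open>A cyclic shift permutes the residues: adding \<open>(m - 1) * c\<close> further makes
  the total shift a multiple of \<open>m\<close>, which inverts the shift without leaving the
  natural numbers.\<close>

lemma sum_mod_shift:
  fixes g :: "nat \<Rightarrow> 'b::comm_monoid_add"
  assumes "0 < m"
  shows "(\<Sum>k<m. g ((c + k) mod m)) = (\<Sum>i<m. g i)"
proof -
  have inj: "inj_on (\<lambda>k. (c + k) mod m) {..<m}"
  proof (rule inj_onI)
    fix x y assume "x \<in> {..<m}" "y \<in> {..<m}" "(c + x) mod m = (c + y) mod m"
    then have "((c + x) + (m - 1) * c) mod m = ((c + y) + (m - 1) * c) mod m"
      by (metis mod_add_left_eq)
    moreover have "(c + z) + (m - 1) * c = z + m * c" for z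
      using assms by (cases m) auto
    ultimately have "(x + m * c) mod m = (y + m * c) mod m" by (simp only:)
    then show "x = y" using \<open>x \<in> {..<m}\<close> \<open>y \<in> {..<m}\<close> by simp
  qed
  moreover have "(\<lambda>k. (c + k) mod m) ` {..<m} \<subseteq> {..<m}" using assms by auto
  ultimately have "bij_betw (\<lambda>k. (c + k) mod m) {..<m} {..<m}"
    by (simp add: bij_betw_def endo_inj_surj)
  then show ?thesis by (rule sum.reindex_bij_betw)
qed

lemma card_mod_shift:
  fixes m :: nat
  assumes "0 < m"
  shows "card {i. i < m \<and> P ((i + k) mod m)} = card {i. i < m \<and> P i}"
proof -
  have "(\<Sum>i<m. if P ((k + i) mod m) then 1 else 0) = (\<Sum>i<m. if P i then 1 else 0 :: nat)"
    by (rule sum_mod_shift[OF assms])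
  then show ?thesis by (simp add: sum.If_cases Int_def add.commute)
qed

context ri_norm begin

text \<open>Averaging over blocks does not increase the norm, although the norm need not dominate
  the maximal function $G^{**}$. Place a decreasing step function below the rearrangement of
  $G\chi_{A_j}$ on the $j$-th block, cut into \<open>m\<close> cells; its \<open>m\<close> cyclic shifts are
  equimeasurable and their mean is constant on the block.\<close>

lemma rho_block_average:
  fixes N :: "'a measure" and a :: "nat \<Rightarrow> ennreal"
  assumes q: "0 < q" "q < 1"
    and N: "emeasure N (space N) \<le> 1"
    and G [measurable]: "G \<in> borel_measurable N"
    and A [measurable]: "\<And>j. A j \<in> sets N"
    and disj: "disjoint_family A"
    and small: "\<And>j. 0 < j \<Longrightarrow> emeasure N (A j) \<le> ennreal (q ^ (j - 1) - q ^ j)"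
    and a: "\<And>j. 0 < j \<Longrightarrow> ennreal (q ^ (j - 1) - q ^ j) * a j \<le> (\<integral>\<^sup>+x. G x * indicator (A j) x \<partial>N)"
  shows "\<rho> (\<lambda>t. if t < q ^ p then a (blk q t) else 0) \<le> \<rho> (\<lambda>t. rearr N G t * indicator {0..<q ^ p} t)"
proof -
  define u where "u j x = G x * indicator (A j) x" for j x
  define len where "len j = q ^ (j - 1) - q ^ j" for j
  let ?T = "\<lambda>t. rearr N G t * indicator {0..<q ^ p} t"
  have u [measurable]: "u j \<in> borel_measurable N" for j unfolding u_def by measurable
  have len: "0 < len j" if "0 < j" for j
    using that q unfolding len_def by (cases j) auto
  have fin: "finite_measure N" using N by (intro finite_measureI) (auto simp: top_unique)
  have T [measurable]: "?T \<in> borel_measurable unit_leb"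
    using G by (intro borel_measurable_unit_leb) measurable
  \<comment> \<open>Truncation to [0, q^p) removes from a level set (0,c) only the part beyond
    q^p.\<close>
  have distT: "min (dist_fun N G y) (ennreal (q ^ p)) \<le> dist_fun unit_leb ?T y" for y
  proof -
    have "dist_fun N G y \<le> 1" using N by (rule order_trans[rotated]) (intro emeasure_mono, auto)
    then obtain c where c: "dist_fun N G y = ennreal c" "0 \<le> c" "c \<le> 1"
      by (cases "dist_fun N G y") (auto simp: top_unique)
    have "min (dist_fun N G y) (ennreal (q ^ p)) = ennreal (min c (q ^ p))"
      using c q by (simp add: min_def)
    also have "\<dots> = emeasure unit_leb {0<..<min c (q ^ p)}"
      using c q by (subst emeasure_unit_leb) auto
    also have "\<dots> \<le> dist_fun unit_leb ?T y"
    proof (rule emeasure_mono)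
      show "{0<..<min c (q ^ p)} \<subseteq> {x \<in> space unit_leb. y < ?T x}"
        using c q by (auto simp: less_rearr_iff ennreal_less_iff)
    qed measurable
    finally show ?thesis .
  qed
  \<comment> \<open>Block values obtained from the r-th dyadic step function below the rearrangement
    of G on A_j; they increase with r to values at least \<open>a j\<close>.\<close>
  define S where "S r j = lower_sum N (u j) (len j) (2 ^ r)" for r j
  have main: "\<rho> (\<lambda>t. if t < q ^ p then S r (blk q t) else 0) \<le> \<rho> ?T" for r
  proof -
    define m :: nat where "m = 2 ^ r"
    have m: "0 < m" by (simp add: m_def)
    \<comment> \<open>The position of t among the \<open>m\<close> equal cells of its own block.
      \<open>H k\<close> below is the step function with its cells moved cyclically by
      \<open>k\<close> in every block at once.\<close>
    define cell where "cell t = nat \<lfloor>real m * (t - q ^ blk q t) / len (blk q t)\<rfloor>" for t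
    define e where "e j i = rearr N (u j) (real (Suc i) * len j / real m)" for j i
    define H where "H k t = (if t < q ^ p then e (blk q t) ((cell t + k) mod m) else 0)" for k t
    have [measurable]: "(\<lambda>t. q ^ blk q t) \<in> borel_measurable borel" "(\<lambda>t. len (blk q t)) \<in> borel_measurable borel"
      by (rule measurable_compose[OF blk_measurable], simp)+
    have cell [measurable]: "cell \<in> measurable borel (count_space UNIV)"
      unfolding cell_def by measurable
    have "(\<lambda>t. e (blk q t) ((cell t + k) mod m)) \<in> borel_measurable borel" for k
      by (rule measurable_compose_countable[OF measurable_compose_countable[OF _ cell] blk_measurable]) simp
    then have H [measurable]: "H k \<in> borel_measurable borel" for k
      unfolding H_def by measurable
    \<comment> \<open>Two bounds are combined. \<open>H k\<close> vanishes beyond q^p. In block j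
      the shift does not change how many cells exceed y, and these cells have total length at most
      the measure of {u_j > y}; since the A_j are disjoint, these measures add up to at most that of
      {G > y}.\<close>
    have distH: "dist_fun unit_leb (H k) y \<le> dist_fun unit_leb ?T y" for k y
    proof -
      let ?E = "{t \<in> space unit_leb. y < H k t}"
      have E: "?E \<in> sets borel" "?E \<subseteq> {0<..<1}" by auto
      have eE: "emeasure unit_leb ?E = emeasure lborel ?E"
        using E by (rule emeasure_unit_leb)
      have "emeasure lborel ?E \<le> emeasure lborel {0<..<q ^ p}"
        by (rule emeasure_mono) (auto simp: H_def split: if_splits)
      then have 1: "emeasure unit_leb ?E \<le> ennreal (q ^ p)" using eE q by simp
      define C where "C j i = {q ^ j + real i * len j / real m ..< q ^ j + real (Suc i) * len j / real m}" for j i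
      define I where "I j = {i. i < m \<and> y < e j ((i + k) mod m)}" for j
      define B where "B j = (if 0 < j then \<Union>i\<in>I j. C j i else {})" for j
      have [simp]: "finite (I j)" for j by (simp add: I_def)
      have cover: "?E \<subseteq> (\<Union>j. B j)"
      proof
        fix t assume "t \<in> ?E"
        then have t: "0 < t" "t < 1" "y < H k t" by auto
        define j where "j = blk q t"
        have "0 < j" using blk_pos q t unfolding j_def by blast
        have "t < q ^ (j - 1)" using less_blk_iff[OF q, of t "j - 1"] \<open>0 < j\<close> t unfolding j_def by auto
        have "q ^ j \<le> t" using blk_le[OF q] t unfolding j_def by auto
        have l: "0 < len j" using len \<open>0 < j\<close> .
        define z where "z = real m * (t - q ^ j) / len j"
        have z: "0 \<le> z" "z < real m"
          using \<open>q ^ j \<le> t\<close> \<open>t < q ^ (j - 1)\<close> l m by (auto simp: z_def len_def field_simps)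
        have c: "cell t = nat \<lfloor>z\<rfloor>" by (simp add: cell_def z_def j_def)
        then have "real (cell t) \<le> z" "z < real (Suc (cell t))" using z by auto linarith+
        then have "t \<in> C j (cell t)" using l m by (auto simp: C_def z_def field_simps)
        moreover have "cell t < m" using \<open>real (cell t) \<le> z\<close> z by linarith
        moreover have "y < e j ((cell t + k) mod m)" using t by (auto simp: H_def j_def split: if_splits)
        ultimately show "t \<in> (\<Union>j. B j)" using \<open>0 < j\<close> unfolding B_def I_def by (intro UN_I[of j]) auto
      qed
      have [measurable]: "B j \<in> sets borel" for j by (auto simp: B_def C_def)
      have "emeasure lborel ?E \<le> emeasure lborel (\<Union>j. B j)"
        by (intro emeasure_mono cover) auto
      also have "\<dots> \<le> (\<Sum>j. emeasure lborel (B j))"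
        by (intro emeasure_subadditive_countably) auto
      also have "\<dots> \<le> (\<Sum>j. dist_fun N (u j) y)"
      proof (intro suminf_le)
        fix j
        show "emeasure lborel (B j) \<le> dist_fun N (u j) y"
        proof (cases "0 < j")
          case True
          have l: "0 < len j" using len True .
          have "emeasure lborel (B j) \<le> (\<Sum>i\<in>I j. emeasure lborel (C j i))"
            using True unfolding B_def by (simp, intro emeasure_subadditive_finite) (auto simp: C_def)
          also have "\<dots> = (\<Sum>i\<in>I j. ennreal (len j / real m))"
          proof (intro sum.cong refl)
            fix i
            have "q ^ j + real i * len j / real m \<le> q ^ j + real (Suc i) * len j / real m"
              using l m by (intro add_left_mono divide_right_mono mult_right_mono) auto
            moreover have "(q ^ j + real (Suc i) * len j / real m) - (q ^ j + real i * len j / real m) = len j / real m"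
              by (simp add: distrib_right add_divide_distrib)
            ultimately show "emeasure lborel (C j i) = ennreal (len j / real m)"
              unfolding C_def by (simp only: emeasure_lborel_Ico)
          qed
          also have "\<dots> = ennreal (real (card (I j)) * len j / real m)"
            using l by (simp add: ennreal_of_nat_eq_real_of_nat ennreal_mult[symmetric])
          also have "card (I j) = cell_count (len j) m (dist_fun N (u j) y)"
            unfolding I_def e_def cell_count_def by (subst card_mod_shift[OF m]) (simp add: less_rearr_iff)
          also have "ennreal (real \<dots> * len j / real m) \<le> dist_fun N (u j) y"
            by (rule cell_count_le[OF l m])
          finally show ?thesis .
        qed (simp add: B_def)
      qed auto
      also have "\<dots> = emeasure N (\<Union>j. {x \<in> space N. y < u j x})"
      proof (rule suminf_emeasure)
        have "{x \<in> space N. y < u j x} \<subseteq> A j" for j by (auto simp: u_def indicator_def split: if_splits)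
        then show "disjoint_family (\<lambda>j. {x \<in> space N. y < u j x})"
          using disj by (rule disjoint_family_subset[rotated])
      qed auto
      also have "\<dots> \<le> dist_fun N G y"
        by (rule emeasure_mono) (auto simp: u_def indicator_def split: if_splits)
      finally have 2: "emeasure unit_leb ?E \<le> dist_fun N G y" using eE by simp
      have "emeasure unit_leb ?E \<le> min (dist_fun N G y) (ennreal (q ^ p))" using 1 2 by simp
      then show ?thesis using distT[of y] by (rule order_trans)
    qed
    have HU: "H k \<in> borel_measurable unit_leb" for k by (intro borel_measurable_unit_leb H)
    have avg: "(\<lambda>t. if t < q ^ p then S r (blk q t) else 0) = (\<lambda>t. \<Sum>k<m. ennreal (1 / real m) * H k t)"
    proof
      fix t
      have "(\<Sum>k<m. e (blk q t) ((cell t + k) mod m)) = (\<Sum>i<m. e (blk q t) i)"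
        by (rule sum_mod_shift[OF m])
      then show "(if t < q ^ p then S r (blk q t) else 0) = (\<Sum>k<m. ennreal (1 / real m) * H k t)"
        by (auto simp: H_def sum_distrib_left[symmetric] S_def lower_sum_def e_def m_def mult.commute)
    qed
    have "\<rho> (\<lambda>t. if t < q ^ p then S r (blk q t) else 0) \<le> (\<Sum>k<m. \<rho> (\<lambda>t. ennreal (1 / real m) * H k t))"
      unfolding avg using HU by (intro rho_sum) auto
    also have "\<dots> = (\<Sum>k<m. ennreal (1 / real m) * \<rho> (H k))"
      by (intro sum.cong refl homogeneous HU) auto
    also have "\<dots> \<le> (\<Sum>k<m. ennreal (1 / real m) * \<rho> ?T)"
      by (intro sum_mono mult_left_mono rho_mono_dist distH HU T) auto
    also have "\<dots> = \<rho> ?T"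
      using m by (simp add: mult.assoc[symmetric] ennreal_of_nat_eq_real_of_nat ennreal_mult[symmetric])
    finally show ?thesis .
  qed
  have fm: "(\<lambda>t. if t < q ^ p then b (blk q t) else 0) \<in> borel_measurable unit_leb" for b :: "nat \<Rightarrow> ennreal"
  proof -
    have [measurable]: "(\<lambda>t. b (blk q t)) \<in> borel_measurable borel"
      by (rule measurable_compose[OF blk_measurable]) simp
    show ?thesis by (rule borel_measurable_unit_leb) measurable
  qed
  have inc: "incseq (\<lambda>r. S r j)" for j
  proof (cases "0 < j")
    case True
    show ?thesis unfolding S_def
    proof (rule incseq_SucI)
      fix r show "lower_sum N (u j) (len j) (2 ^ r) \<le> lower_sum N (u j) (len j) (2 ^ Suc r)"
        unfolding power_Suc by (rule lower_sum_mono[OF u _ len[OF True]]) simp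
    qed
  next
    case False
    then have "len j = 0" by (simp add: len_def)
    then have "S r j = rearr N (u j) 0" for r
      by (simp add: S_def lower_sum_def ennreal_of_nat_eq_real_of_nat ennreal_mult[symmetric] mult.commute mult.left_commute)
    then show ?thesis by (simp add: incseq_def)
  qed
  \<comment> \<open>The block length bounds the measure of A_j, so the lower sums exhaust the
    integral over A_j and their supremum dominates \<open>a j\<close>. The Fatou property then
    carries the bound \<open>main\<close> to the limit in r.\<close>
  have "\<rho> (\<lambda>t. if t < q ^ p then a (blk q t) else 0) \<le> \<rho> (\<lambda>t. if t < q ^ p then SUP r. S r (blk q t) else 0)"
  proof (rule rho_mono[OF fm fm])
    fix t :: real assume t: "0 < t" "t < 1"
    define j where "j = blk q t"
    have j: "0 < j" using blk_pos q t unfolding j_def by blast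
    have "ennreal (len j) * a j \<le> (\<integral>\<^sup>+x. u j x \<partial>N)" using a[OF j] by (simp add: len_def u_def)
    also have "\<dots> \<le> ennreal (len j) * (SUP r. lower_sum N (u j) (len j) (2 ^ r))"
    proof (rule nn_integral_le_lower_sum[OF _ u len[OF j]])
      show "sigma_finite_measure N" using fin by (rule finite_measure.axioms)
      have "dist_fun N (u j) 0 \<le> emeasure N (A j)"
        by (intro emeasure_mono A) (auto simp: u_def indicator_def split: if_splits)
      also have "\<dots> \<le> ennreal (len j)" using small[OF j] by (simp add: len_def)
      finally show "dist_fun N (u j) 0 \<le> ennreal (len j)" .
    qed
    finally have "a j \<le> (SUP r. S r j)"
      using len[OF j] unfolding S_def by (subst (asm) ennreal_mult_le_mult_iff) auto
    then show "(if t < q ^ p then a (blk q t) else 0) \<le> (if t < q ^ p then SUP r. S r (blk q t) else 0)"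
      by (simp add: j_def)
  qed
  also have "\<dots> = (SUP r. \<rho> (\<lambda>t. if t < q ^ p then S r (blk q t) else 0))"
  proof (rule fatou[symmetric, OF fm fm], rule AE_I2, intro conjI)
    fix t
    show "incseq (\<lambda>r. if t < q ^ p then S r (blk q t) else 0)" using inc by (auto simp: incseq_def)
  qed simp
  also have "\<dots> \<le> \<rho> ?T" by (intro SUP_least main)
  finally show ?thesis .
qed

end

text \<open>For every c below \<open>rearr N u s\<close> the set {u > c} has measure above s, while
  {u > rearr N u s'} has measure at most s'; subtraction bounds the shell up to c. Both ends are
  excluded because a plateau of \<open>u\<close> at one of the two levels may carry additional
  mass.\<close>

lemma emeasure_between_rearr:
  assumes u [measurable]: "u \<in> borel_measurable N" and s: "0 \<le> s" "s \<le> s'"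
  shows "emeasure N {x \<in> space N. rearr N u s' < u x \<and> u x < rearr N u s} \<le> ennreal (s' - s)"
proof (cases "rearr N u s' < rearr N u s")
  case False
  then have "{x \<in> space N. rearr N u s' < u x \<and> u x < rearr N u s} = {}" by auto
  then show ?thesis by (metis emeasure_empty zero_le)
next
  case True
  let ?v = "rearr N u s'" and ?w = "rearr N u s"
  obtain b where b: "\<And>m. b m < ?w" "b \<longlonglongrightarrow> ?w"
    using approx_from_below_dense_linorder[OF True] by auto
  \<comment> \<open>The approximating sequence \<open>b\<close> need not be monotone; its running
    maxima are, so that the shells increase.\<close>
  define c where "c m = Max (b ` {..m})" for m :: nat
  have c: "c m < ?w" for m unfolding c_def using b by (subst Max_less_iff) auto
  have "incseq c" unfolding c_def by (intro incseq_SucI Max_mono) auto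
  have bc: "b m \<le> c m" for m unfolding c_def by (intro Max_ge) auto
  have le: "emeasure N {x \<in> space N. ?v < u x \<and> u x \<le> c m} \<le> ennreal (s' - s)" for m
  proof (cases "?v \<le> c m")
    case False
    then have "{x \<in> space N. ?v < u x \<and> u x \<le> c m} = {}" by auto
    then show ?thesis by (metis emeasure_empty zero_le)
  next
    case True
    have "emeasure N {x \<in> space N. ?v < u x \<and> u x \<le> c m} + ennreal s
        \<le> emeasure N {x \<in> space N. ?v < u x \<and> u x \<le> c m} + dist_fun N u (c m)"
      using less_rearr_iff[OF u, of "c m" s] c[of m] by (intro add_left_mono) auto
    also have "\<dots> = emeasure N ({x \<in> space N. ?v < u x \<and> u x \<le> c m} \<union> {x \<in> space N. c m < u x})"
      by (rule plus_emeasure) auto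
    also have "\<dots> \<le> dist_fun N u ?v"
      using True by (intro emeasure_mono) auto
    also have "\<dots> \<le> ennreal s'"
      using rearr_le_iff[OF u, of s' ?v] by simp
    also have "\<dots> = ennreal (s' - s) + ennreal s" using s by (simp flip: ennreal_plus)
    finally show ?thesis using s by simp
  qed
  have eq: "{x \<in> space N. ?v < u x \<and> u x < ?w} \<subseteq> (\<Union>m. {x \<in> space N. ?v < u x \<and> u x \<le> c m})"
  proof
    fix x assume x: "x \<in> {x \<in> space N. ?v < u x \<and> u x < ?w}"
    then have "eventually (\<lambda>m. u x < b m) sequentially" using b(2) by (intro order_tendstoD(1)) auto
    then obtain m where "u x < b m" by (auto simp: eventually_sequentially)
    then have "u x \<le> c m" using bc[of m] by auto
    then show "x \<in> (\<Union>m. {x \<in> space N. ?v < u x \<and> u x \<le> c m})" using x by auto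
  qed
  have "emeasure N {x \<in> space N. ?v < u x \<and> u x < ?w} \<le> emeasure N (\<Union>m. {x \<in> space N. ?v < u x \<and> u x \<le> c m})"
    by (intro emeasure_mono eq) auto
  also have "\<dots> = (SUP m. emeasure N {x \<in> space N. ?v < u x \<and> u x \<le> c m})"
  proof (rule SUP_emeasure_incseq[symmetric])
    show "incseq (\<lambda>m. {x \<in> space N. ?v < u x \<and> u x \<le> c m})"
      using \<open>incseq c\<close> by (fastforce simp: incseq_def)
  qed auto
  also have "\<dots> \<le> ennreal (s' - s)" by (intro SUP_least le)
  finally show ?thesis .
qed

context ri_norm begin

text \<open>Iterating a single dilation uses the dilation norm at \<open>q\<close> only, which is
  all that the Boyd index provides.\<close>

lemma rho_dilation_pow:
  assumes q: "0 < q" "q < 1" and f [measurable]: "f \<in> borel_measurable borel"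
    and h: "dilation_norm \<rho> q = ennreal h" "0 < h"
  shows "\<rho> (\<lambda>t. if t < q ^ l then f (t / q ^ l) else 0) \<le> ennreal (h ^ l) * \<rho> f"
proof (induction l)
  case 0
  have "\<rho> (\<lambda>t. if t < q ^ 0 then f (t / q ^ 0) else 0) \<le> \<rho> f"
    by (intro rho_mono borel_measurable_unit_leb) auto
  then show ?case by simp
next
  case (Suc l)
  let ?f = "\<lambda>l t. if t < q ^ l then f (t / q ^ l) else 0"
  have eq: "?f (Suc l) = (\<lambda>t. if t < q then ?f l (t / q) else 0)"
  proof
    fix t
    have "t / q < q ^ l \<longleftrightarrow> t < q ^ Suc l" using q by (simp add: field_simps)
    moreover have "q ^ Suc l \<le> q" using q by (simp add: mult_left_le power_le_one)
    ultimately show "?f (Suc l) t = (if t < q then ?f l (t / q) else 0)" by auto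
  qed
  have "\<rho> (\<lambda>t. if t < q then ?f l (t / q) else 0) \<le> dilation_norm \<rho> q * \<rho> (?f l)"
    using h by (intro rho_dilation q) auto
  also have "\<dots> \<le> ennreal h * (ennreal (h ^ l) * \<rho> f)"
    unfolding h by (intro mult_left_mono Suc.IH) auto
  finally show ?case using h unfolding eq by (simp add: ennreal_mult mult.assoc)
qed

text \<open>One derivative. With $u^*$ the rearrangement, the hypothesis \<open>weak\<close> applied on the
  level sets $A_j$ between $u^*(q^{j-1})$ and $u^*(q^j)$ bounds $u^*(q^j)$ by a sum of terms
  $q^{i\sigma}a_i$, $i\le j$, with $a_i$ the mean of $G$ over $A_i$. Regrouping by $l=j-i$ turns
  this into a series of dilations by $q^l$ of block averages, which converges geometrically
  because the dilation norm \<open>h\<close> is below $q^\mu$. Working with truncations to $[0,q^m)$ rather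
  than with powers of \<open>s\<close> as weights avoids rearranging products.\<close>

lemma rho_step:
  fixes N :: "'a measure"
  assumes q: "0 < q" "q < 1" and h: "dilation_norm \<rho> q = ennreal h" "0 < h"
    and x: "h * q powr (- \<mu>) < 1"
    and N: "emeasure N (space N) \<le> 1"
    and u [measurable]: "u \<in> borel_measurable N" and G [measurable]: "G \<in> borel_measurable N"
    and K: "0 \<le> K"
    and weak: "\<And>a b s. 0 \<le> a \<Longrightarrow> a < b \<Longrightarrow> 0 < s \<Longrightarrow> s < 1 \<Longrightarrow> ennreal s < dist_fun N u (ennreal b) \<Longrightarrow>
       ennreal ((b - a) * s powr (1 - \<sigma>)) \<le>
       ennreal K * (\<integral>\<^sup>+x. G x * indicator {x. ennreal a < u x \<and> u x < ennreal b} x \<partial>N)"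
    and bound: "\<And>p. \<rho> (\<lambda>t. rearr N G t * indicator {0..<q ^ p} t) \<le> C * ennreal (q powr (real p * \<theta>))"
    and exps: "0 \<le> \<theta>" "0 \<le> \<sigma>" "0 \<le> \<theta>'" "\<theta>' \<le> \<theta> + \<sigma>" "\<theta>' \<le> \<mu>"
  shows "\<rho> (\<lambda>t. rearr N u t * indicator {0..<q ^ m} t) \<le>
     ennreal ((1 / q - 1) / (1 - h * q powr (- \<mu>)) * K) * C * ennreal (q powr (real m * \<theta>'))"
proof -
  define v where "v j = rearr N u (q ^ j)" for j :: nat
  define A where "A j = (if j = 0 then {} else {x \<in> space N. v (j - 1) < u x \<and> u x < v j})" for j
  define len where "len j = q ^ (j - 1) - q ^ j" for j
  define I where "I j = (\<integral>\<^sup>+x. G x * indicator (A j) x \<partial>N)" for j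
  define a where "a j = ennreal (1 / len j) * I j" for j
  \<comment> \<open>Block j has length q^j (1/q - 1). Dividing \<open>K * len j\<close> by
    (q^j)^(1-\<sigma>), the factor from \<open>weak\<close> at s = q^j, leaves \<kappa>
    q^(j\<sigma>).\<close>
  define \<kappa> where "\<kappa> = K * (1 / q - 1)"
  have \<kappa>: "0 \<le> \<kappa>" using K q by (simp add: \<kappa>_def)
  have [measurable]: "A j \<in> sets N" for j by (simp add: A_def)
  have len: "0 < len j" "len j = q ^ j * (1 / q - 1)" if "0 < j" for j
    using that q unfolding len_def by (cases j; simp add: field_simps)+
  have I: "I j = ennreal (len j) * a j" if "0 < j" for j
    using len(1)[OF that] by (simp add: a_def mult.assoc[symmetric] ennreal_mult[symmetric])
  have v_mono: "v i \<le> v j" if "i \<le> j" for i j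
    unfolding v_def using that q by (intro rearr_antimono power_decreasing) auto
  have disj: "disjoint_family A"
    unfolding disjoint_family_on_def
  proof (intro ballI impI)
    fix i j :: nat assume "i \<noteq> j"
    have *: "A i \<inter> A j = {}" if "i < j" for i j
      using v_mono[of i "j - 1"] that by (force simp: A_def)
    show "A i \<inter> A j = {}" using *[of i j] *[of j i] \<open>i \<noteq> j\<close> by (cases "i < j") auto
  qed
  have small: "emeasure N (A j) \<le> ennreal (q ^ (j - 1) - q ^ j)" if "0 < j" for j
    using that q emeasure_between_rearr[OF u, of "q ^ j" "q ^ (j - 1)"]
    by (auto simp: A_def v_def intro: power_decreasing)
  \<comment> \<open>For v_(j-1) < y < v_j the set {u > y} has measure above q^j, so
    \<open>weak\<close> applies with s = q^j and the levels v_(j-1) and y; this shell lies in A_j.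
    Letting y increase to v_j gives the claim, also for infinite v_j.\<close>
  have level: "v j \<le> v (j - 1) + ennreal (\<kappa> * q powr (real j * \<sigma>)) * a j" if j: "0 < j" for j
  proof (rule dense_le)
    fix y assume y: "y < v j"
    then obtain b where b: "y = ennreal b" "0 \<le> b" by (cases y) auto
    show "y \<le> v (j - 1) + ennreal (\<kappa> * q powr (real j * \<sigma>)) * a j"
    proof (cases "y \<le> v (j - 1)")
      case True
      then show ?thesis by (simp add: add_increasing2)
    next
      case False
      then obtain \<alpha> where \<alpha>: "v (j - 1) = ennreal \<alpha>" "0 \<le> \<alpha>" "\<alpha> < b"
        using b by (cases "v (j - 1)") (auto simp: not_le ennreal_less_iff)
      have qj: "0 < q ^ j" "q ^ j < 1" using q j by (auto simp: power_less_one_iff)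
      have "ennreal ((b - \<alpha>) * (q ^ j) powr (1 - \<sigma>)) \<le>
         ennreal K * (\<integral>\<^sup>+x. G x * indicator {x. ennreal \<alpha> < u x \<and> u x < ennreal b} x \<partial>N)"
        using y b unfolding v_def by (intro weak \<alpha> qj) (simp add: less_rearr_iff)
      also have "\<dots> \<le> ennreal K * I j"
        unfolding I_def
      proof (intro mult_left_mono nn_integral_mono)
        fix x assume "x \<in> space N"
        then show "indicator {x. ennreal \<alpha> < u x \<and> u x < ennreal b} x \<le> (indicator (A j) x :: ennreal)"
          using y j \<alpha> b by (auto simp: A_def indicator_def)
      qed auto
      also have "\<dots> = ennreal (K * len j) * a j"
        using K len[OF j] by (simp add: I[OF j] ennreal_mult mult.assoc)
      finally have *: "ennreal ((b - \<alpha>) * (q ^ j) powr (1 - \<sigma>)) \<le> ennreal (K * len j) * a j" .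
      have qq: "(q ^ j) powr (1 - \<sigma>) * (q powr (real j * \<sigma>) / q ^ j) = 1"
        using q by (simp add: powr_realpow[symmetric] powr_powr powr_diff[symmetric] powr_add[symmetric] algebra_simps)
      have "ennreal (b - \<alpha>) = ennreal ((b - \<alpha>) * (q ^ j) powr (1 - \<sigma>)) * ennreal (q powr (real j * \<sigma>) / q ^ j)"
        using \<alpha> qq q by (subst ennreal_mult[symmetric]) (auto simp: mult.assoc)
      also have "\<dots> \<le> ennreal (K * len j) * a j * ennreal (q powr (real j * \<sigma>) / q ^ j)"
        by (intro mult_right_mono *) auto
      also have "\<dots> = ennreal (K * len j) * ennreal (q powr (real j * \<sigma>) / q ^ j) * a j"
        by (simp only: mult_ac)
      also have "\<dots> = ennreal (K * len j * (q powr (real j * \<sigma>) / q ^ j)) * a j"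
        using K len(1)[OF j] q by (subst ennreal_mult[symmetric]) auto
      also have "K * len j * (q powr (real j * \<sigma>) / q ^ j) = \<kappa> * q powr (real j * \<sigma>)"
        using q by (simp add: len(2)[OF j] \<kappa>_def)
      finally have "ennreal (b - \<alpha>) \<le> ennreal (\<kappa> * q powr (real j * \<sigma>)) * a j" .
      then have "ennreal \<alpha> + ennreal (b - \<alpha>) \<le> v (j - 1) + ennreal (\<kappa> * q powr (real j * \<sigma>)) * a j"
        unfolding \<alpha> by (intro add_left_mono)
      then show ?thesis using b \<alpha> by (simp flip: ennreal_plus)
    qed
  qed
  \<comment> \<open>Mass at most one makes the rearrangement vanish at 1, so the telescoping sum
    starts from zero.\<close>
  have v0: "v 0 = 0"
  proof -
    have "dist_fun N u 0 \<le> 1" using N by (rule order_trans[rotated]) (intro emeasure_mono, auto)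
    then show ?thesis using rearr_le_iff[OF u, of 1 0] by (simp add: v_def)
  qed
  have vsum: "v j \<le> (\<Sum>l<j. ennreal (\<kappa> * q powr (real (j - l) * \<sigma>)) * a (j - l))" for j
  proof (induction j)
    case 0
    then show ?case by (simp add: v0)
  next
    case (Suc j)
    have "v (Suc j) \<le> v j + ennreal (\<kappa> * q powr (real (Suc j) * \<sigma>)) * a (Suc j)"
      using level[of "Suc j"] by (simp del: of_nat_Suc)
    also have "\<dots> \<le> (\<Sum>l<j. ennreal (\<kappa> * q powr (real (j - l) * \<sigma>)) * a (j - l))
         + ennreal (\<kappa> * q powr (real (Suc j) * \<sigma>)) * a (Suc j)"
      by (intro add_right_mono Suc.IH)
    also have "\<dots> = (\<Sum>l<Suc j. ennreal (\<kappa> * q powr (real (Suc j - l) * \<sigma>)) * a (Suc j - l))"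
      by (subst sum.lessThan_Suc_shift) (simp add: add.commute del: of_nat_Suc)
    finally show ?case .
  qed
  \<comment> \<open>If t < q^m and t < q^l, then t/q^l < q^(m-l), also with truncated subtraction:
    for l > m the bound is q^0 = 1. Hence the truncation to [0, q^m) survives the regrouping, and
    \<open>F l\<close> is the dilation by q^l of the truncated block function
    \<open>B l\<close>.\<close>
  define B where "B l t = (if t < q ^ (m - l) then ennreal (\<kappa> * q powr (real (blk q t) * \<sigma>)) * a (blk q t) else 0)" for l t
  define F where "F l t = (if t < q ^ l then B l (t / q ^ l) else 0)" for l t
  have blkm: "(\<lambda>t. f (blk q t)) \<in> borel_measurable borel" for f :: "nat \<Rightarrow> ennreal"
    by (rule measurable_compose[OF blk_measurable]) simp
  have [measurable]: "B l \<in> borel_measurable borel" for l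
    unfolding B_def using blkm[of "\<lambda>j. ennreal (\<kappa> * q powr (real j * \<sigma>)) * a j"] by measurable
  have [measurable]: "F l \<in> borel_measurable borel" for l unfolding F_def by measurable
  have "\<rho> (\<lambda>t. rearr N u t * indicator {0..<q ^ m} t) \<le> \<rho> (\<lambda>t. \<Sum>l. F l t)"
  proof (rule rho_mono)
    show "(\<lambda>t. rearr N u t * indicator {0..<q ^ m} t) \<in> borel_measurable unit_leb"
      using u by (intro borel_measurable_unit_leb) measurable
    show "(\<lambda>t. \<Sum>l. F l t) \<in> borel_measurable unit_leb"
      by (intro borel_measurable_unit_leb) measurable
    fix t :: real assume t: "0 < t" "t < 1"
    show "rearr N u t * indicator {0..<q ^ m} t \<le> (\<Sum>l. F l t)"
    proof (cases "t < q ^ m")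
      case True
      let ?j = "blk q t"
      have "rearr N u t \<le> v ?j" unfolding v_def by (intro rearr_antimono blk_le q t)
      also have "\<dots> \<le> (\<Sum>l<?j. ennreal (\<kappa> * q powr (real (?j - l) * \<sigma>)) * a (?j - l))" by (rule vsum)
      also have "\<dots> = (\<Sum>l<?j. F l t)"
      proof (intro sum.cong refl)
        fix l assume "l \<in> {..<?j}"
        then have l: "t < q ^ l" using less_blk_iff[OF q t(1)] by simp
        have "t / q ^ l < q ^ (m - l)"
        proof (cases "l \<le> m")
          case True
          then have "q ^ m = q ^ (m - l) * q ^ l" by (simp flip: power_add)
          then show ?thesis using \<open>t < q ^ m\<close> q by (simp add: field_simps)
        next
          case False
          then show ?thesis using l q by simp
        qed
        then show "ennreal (\<kappa> * q powr (real (?j - l) * \<sigma>)) * a (?j - l) = F l t"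
          using l blk_div[OF q t(1) l] by (simp add: F_def B_def)
      qed
      also have "\<dots> \<le> (\<Sum>l. F l t)" by (intro sum_le_suminf) auto
      finally show ?thesis using True t by simp
    qed simp
  qed
  also have "\<dots> \<le> (\<Sum>l. \<rho> (F l))"
    by (intro rho_suminf borel_measurable_unit_leb) measurable
  also have "\<dots> \<le> (\<Sum>l. ennreal (\<kappa> * q powr (real m * \<theta>') * (h * q powr (- \<mu>)) ^ l) * C)"
  proof (intro suminf_le)
    fix l
    define p where "p = m - l"
    have aint: "ennreal (q ^ (j - 1) - q ^ j) * a j \<le> (\<integral>\<^sup>+x. G x * indicator (A j) x \<partial>N)" if "0 < j" for j
      using I[OF that] by (simp add: len_def I_def)
    have "\<rho> (F l) \<le> ennreal (h ^ l) * \<rho> (B l)"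
      unfolding F_def by (intro rho_dilation_pow q h) measurable
    also have "\<rho> (B l) \<le> \<rho> (\<lambda>t. ennreal (\<kappa> * q powr (real p * \<sigma>)) * (if t < q ^ p then a (blk q t) else 0))"
    proof (rule rho_mono)
      show "B l \<in> borel_measurable unit_leb" by (intro borel_measurable_unit_leb) measurable
      show "(\<lambda>t. ennreal (\<kappa> * q powr (real p * \<sigma>)) * (if t < q ^ p then a (blk q t) else 0)) \<in> borel_measurable unit_leb"
        using blkm[of a] by (intro borel_measurable_unit_leb) measurable
      fix t :: real assume t: "0 < t" "t < 1"
      have "q powr (real (blk q t) * \<sigma>) \<le> q powr (real p * \<sigma>)" if "t < q ^ p"
        using that less_blk_iff[OF q t(1), of p] q exps by (intro powr_mono' mult_right_mono) auto
      then show "B l t \<le> ennreal (\<kappa> * q powr (real p * \<sigma>)) * (if t < q ^ p then a (blk q t) else 0)"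
        using \<kappa> by (auto simp: B_def p_def intro!: mult_right_mono mult_left_mono ennreal_leI)
    qed
    also have "\<dots> = ennreal (\<kappa> * q powr (real p * \<sigma>)) * \<rho> (\<lambda>t. if t < q ^ p then a (blk q t) else 0)"
    proof (rule homogeneous)
      show "(\<lambda>t. if t < q ^ p then a (blk q t) else 0) \<in> borel_measurable unit_leb"
        using blkm[of a] by (intro borel_measurable_unit_leb) measurable
    qed (use \<kappa> in simp)
    also have "\<rho> (\<lambda>t. if t < q ^ p then a (blk q t) else 0) \<le> \<rho> (\<lambda>t. rearr N G t * indicator {0..<q ^ p} t)"
      by (rule rho_block_average[OF q N G _ disj small aint]) auto
    also have "\<dots> \<le> C * ennreal (q powr (real p * \<theta>))" by (rule bound)
    finally have "\<rho> (F l) \<le> ennreal (h ^ l) * (ennreal (\<kappa> * q powr (real p * \<sigma>)) * (C * ennreal (q powr (real p * \<theta>))))"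
      by (simp add: mult_left_mono)
    also have "\<dots> = ennreal (h ^ l * (\<kappa> * (q powr (real p * \<sigma>) * q powr (real p * \<theta>)))) * C"
      using \<kappa> h by (simp add: ennreal_mult mult_ac)
    also have "\<dots> \<le> ennreal (\<kappa> * q powr (real m * \<theta>') * (h * q powr (- \<mu>)) ^ l) * C"
    proof (intro mult_right_mono ennreal_leI)
      \<comment> \<open>Dilation by q^l leaves only p = m - l steps of truncation. The missing
        factor q^(l \<theta>') is paid for by writing h^l = (h q^(-\<mu>))^l q^(l\<mu>), which
        requires \<theta>' \<le> \<mu>; this is the cap on the exponent. For l > m, where p = 0, the
        same inequality suffices since m < l.\<close>
      have "real m * \<theta>' - real l * \<mu> \<le> real p * (\<theta> + \<sigma>)"
      proof (cases "l \<le> m")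
        case True
        then have p: "real p = real m - real l" by (simp add: p_def)
        have "real m * \<theta>' - real l * \<mu> \<le> real m * \<theta>' - real l * \<theta>'"
          using exps by (simp add: mult_left_mono)
        also have "\<dots> = real p * \<theta>'" by (simp only: p left_diff_distrib)
        also have "\<dots> \<le> real p * (\<theta> + \<sigma>)" using exps by (intro mult_left_mono) auto
        finally show ?thesis .
      next
        case False
        then have "real m * \<theta>' \<le> real l * \<mu>" using exps by (intro mult_mono) auto
        then show ?thesis using False by (simp add: p_def)
      qed
      then have "q powr (real p * (\<theta> + \<sigma>)) \<le> q powr (real m * \<theta>' - real l * \<mu>)"
        using q by (intro powr_mono') auto
      also have "\<dots> = q powr (real m * \<theta>' + real l * (- \<mu>))" by simp
      also have "\<dots> = q powr (real m * \<theta>') * (q powr (- \<mu>)) ^ l"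
        using q by (simp only: powr_add) (simp add: powr_power mult.commute)
      finally have "q powr (real p * \<sigma>) * q powr (real p * \<theta>) \<le> q powr (real m * \<theta>') * (q powr (- \<mu>)) ^ l"
        by (simp add: powr_add[symmetric] algebra_simps)
      then have "h ^ l * (\<kappa> * (q powr (real p * \<sigma>) * q powr (real p * \<theta>))) \<le> h ^ l * (\<kappa> * (q powr (real m * \<theta>') * (q powr (- \<mu>)) ^ l))"
        using h \<kappa> by (intro mult_left_mono) auto
      then show "h ^ l * (\<kappa> * (q powr (real p * \<sigma>) * q powr (real p * \<theta>))) \<le> \<kappa> * q powr (real m * \<theta>') * (h * q powr (- \<mu>)) ^ l"
        by (simp add: power_mult_distrib mult_ac)
    qed auto
    finally show "\<rho> (F l) \<le> ennreal (\<kappa> * q powr (real m * \<theta>') * (h * q powr (- \<mu>)) ^ l) * C" .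
  qed auto
  also have "\<dots> = (\<Sum>l. ennreal (\<kappa> * q powr (real m * \<theta>') * (h * q powr (- \<mu>)) ^ l)) * C"
    by (rule ennreal_suminf_multc)
  also have "(\<Sum>l. ennreal (\<kappa> * q powr (real m * \<theta>') * (h * q powr (- \<mu>)) ^ l)) =
     ennreal (\<kappa> * q powr (real m * \<theta>') * (1 / (1 - h * q powr (- \<mu>))))"
    using x h \<kappa> by (intro suminf_ennreal_eq sums_mult geometric_sums) auto
  also have "\<dots> * C = ennreal ((1 / q - 1) / (1 - h * q powr (- \<mu>)) * K) * C * ennreal (q powr (real m * \<theta>'))"
  proof -
    have "\<kappa> * q powr (real m * \<theta>') * (1 / (1 - h * q powr (- \<mu>))) = ((1 / q - 1) / (1 - h * q powr (- \<mu>)) * K) * q powr (real m * \<theta>')"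
      by (simp add: \<kappa>_def)
    moreover have "0 \<le> (1 / q - 1) / (1 - h * q powr (- \<mu>)) * K" using K x q by (intro mult_nonneg_nonneg divide_nonneg_nonneg) auto
    ultimately show ?thesis by (simp only: ennreal_mult powr_ge_zero) (simp add: mult_ac)
  qed
  finally show ?thesis .
qed

end

section \<open>The Loomis-Whitney inequality\<close>

text \<open>The root on [0,\<infinity>]. The branch is there because \<open>enn2real\<close> sends
  \<open>top\<close> to 0.\<close>

definition eroot :: "nat \<Rightarrow> ennreal \<Rightarrow> ennreal" where
  "eroot k x = (if x = top then top else ennreal (root k (enn2real x)))"

lemma borel_measurable_eroot [measurable (raw)]:
  "f \<in> borel_measurable N \<Longrightarrow> (\<lambda>x. eroot k (f x)) \<in> borel_measurable N"
  unfolding eroot_def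
  by (intro measurable_If measurable_compose[OF _ measurable_ennreal] borel_measurable_root) auto

lemma eroot_power: "0 < k \<Longrightarrow> eroot k x ^ k = x"
  by (cases x) (auto simp: eroot_def ennreal_power power_0_left)

lemma eroot_ennreal: "0 \<le> x \<Longrightarrow> eroot k (ennreal x) = ennreal (root k x)"
  by (simp add: eroot_def)

lemma eroot_0 [simp]: "eroot k 0 = 0"
  by (simp add: eroot_def)

lemma eroot_top [simp]: "eroot k top = top"
  by (simp add: eroot_def)

lemma eroot_eq_0_iff: "0 < k \<Longrightarrow> eroot k x = 0 \<longleftrightarrow> x = 0"
  by (cases x) (auto simp: eroot_def ennreal_eq_0_iff)

lemma eroot_mono: "0 < k \<Longrightarrow> x \<le> y \<Longrightarrow> eroot k x \<le> eroot k y"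
  by (cases x; cases y) (auto simp: eroot_def top_unique)

lemma prod_root_le_sum:
  fixes y :: "'i \<Rightarrow> real"
  assumes "finite J" "card J = k" "0 < k" "\<And>i. i \<in> J \<Longrightarrow> 0 \<le> y i"
  shows "(\<Prod>i\<in>J. root k (y i)) \<le> (\<Sum>i\<in>J. y i) / k"
proof -
  have "J \<noteq> {}" using assms by auto
  have "(\<Prod>i\<in>J. root k (y i)) = root k (\<Prod>i\<in>J. y i)"
    using assms(1) by (induction J rule: finite_induct) (use assms(3) in \<open>auto simp: real_root_mult\<close>)
  also have "\<dots> = (\<Prod>i\<in>J. y i) powr (1 / k)"
    using assms by (intro root_powr_inverse prod_nonneg) auto
  also have "\<dots> \<le> (\<Sum>i\<in>J. y i / k)"
    using arith_geom_mean[OF assms(1) \<open>J \<noteq> {}\<close>, of y] assms by simp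
  finally show ?thesis by (simp add: sum_divide_distrib)
qed

lemma ennreal_prod_mono:
  fixes f g :: "'i \<Rightarrow> ennreal"
  assumes "\<And>i. i \<in> J \<Longrightarrow> f i \<le> g i"
  shows "prod f J \<le> prod g J"
  using assms by (induction J rule: infinite_finite_induct) (auto intro: mult_mono)

text \<open>Hoelder's inequality for \<open>k\<close> functions with all exponents equal to
  \<open>k\<close>. When some integral vanishes the product is zero almost everywhere; when none
  vanishes and one is infinite, the right side is infinite; otherwise each function is divided by
  its integral.\<close>

lemma nn_integral_prod_eroot_le:
  assumes J: "finite J" "card J = k" "0 < k"
    and F [measurable]: "\<And>i. i \<in> J \<Longrightarrow> F i \<in> borel_measurable N"
  shows "(\<integral>\<^sup>+x. (\<Prod>i\<in>J. eroot k (F i x)) \<partial>N) \<le> (\<Prod>i\<in>J. eroot k (\<integral>\<^sup>+x. F i x \<partial>N))"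
proof -
  consider (zero) i where "i \<in> J" "(\<integral>\<^sup>+x. F i x \<partial>N) = 0"
    | (inf) i where "\<And>i. i \<in> J \<Longrightarrow> (\<integral>\<^sup>+x. F i x \<partial>N) \<noteq> 0" "i \<in> J" "(\<integral>\<^sup>+x. F i x \<partial>N) = top"
    | (fin) "\<And>i. i \<in> J \<Longrightarrow> (\<integral>\<^sup>+x. F i x \<partial>N) \<noteq> 0" "\<And>i. i \<in> J \<Longrightarrow> (\<integral>\<^sup>+x. F i x \<partial>N) \<noteq> top"
    by blast
  then show ?thesis
  proof cases
    case zero
    then have "AE x in N. F i x = 0" using F by (subst (asm) nn_integral_0_iff_AE) auto
    then have "AE x in N. (\<Prod>i\<in>J. eroot k (F i x)) = 0"
      by eventually_elim (use zero J in \<open>auto intro!: bexI[of _ i]\<close>)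
    then have "(\<integral>\<^sup>+x. (\<Prod>i\<in>J. eroot k (F i x)) \<partial>N) = (\<integral>\<^sup>+x. 0 \<partial>N)" by (rule nn_integral_cong_AE)
    then show ?thesis by simp
  next
    case inf
    then have "(\<Prod>j\<in>J. eroot k (\<integral>\<^sup>+x. F j x \<partial>N)) = eroot k top * (\<Prod>j\<in>J - {i}. eroot k (\<integral>\<^sup>+x. F j x \<partial>N))"
      using J by (subst prod.remove[of _ i]) auto
    moreover have "(\<Prod>j\<in>J - {i}. eroot k (\<integral>\<^sup>+x. F j x \<partial>N)) \<noteq> 0"
      using inf J by (auto simp: eroot_eq_0_iff)
    ultimately have "(\<Prod>j\<in>J. eroot k (\<integral>\<^sup>+x. F j x \<partial>N)) = top"
      by (simp only: eroot_top ennreal_top_mult if_False)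
    then show ?thesis by simp
  next
    case fin
    define c where "c i = enn2real (\<integral>\<^sup>+x. F i x \<partial>N)" for i
    have c: "(\<integral>\<^sup>+x. F i x \<partial>N) = ennreal (c i)" "0 < c i" if "i \<in> J" for i
      using fin[OF that] unfolding c_def by (auto simp: enn2real_positive_iff less_top zero_less_iff_neq_zero)
    \<comment> \<open>The pointwise arithmetic-geometric mean inequality for the normalised
      functions F_i / c_i. Integrating the right side gives \<open>k\<close> terms equal to
      1/k.\<close>
    have pt: "(\<Prod>i\<in>J. eroot k (F i x)) \<le> (\<Prod>i\<in>J. eroot k (ennreal (c i))) * (\<Sum>i\<in>J. ennreal (1 / (k * c i)) * F i x)" for x
    proof (cases "\<exists>i\<in>J. F i x = top")
      case True
      then obtain i where i: "i \<in> J" "F i x = top" by auto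
      have "(\<Sum>i\<in>J. ennreal (1 / (k * c i)) * F i x) = top"
        using i c(2)[OF i(1)] J by (subst sum.remove[of _ i]) (auto simp: ennreal_mult_top)
      moreover have "(\<Prod>i\<in>J. eroot k (ennreal (c i))) \<noteq> 0"
        using J c(2) by (auto simp: eroot_eq_0_iff) force
      ultimately have "(\<Prod>i\<in>J. eroot k (ennreal (c i))) * (\<Sum>i\<in>J. ennreal (1 / (k * c i)) * F i x) = top"
        by (simp only: ennreal_mult_top if_False)
      then show ?thesis by simp
    next
      case False
      define y where "y i = enn2real (F i x)" for i
      have y: "F i x = ennreal (y i)" "0 \<le> y i" if "i \<in> J" for i
        using False that by (auto simp: y_def less_top)
      have rc: "0 \<le> root k (c i)" if "i \<in> J" for i using c(2)[OF that] J by simp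
      have "(\<Prod>i\<in>J. root k (y i)) = (\<Prod>i\<in>J. root k (c i)) * (\<Prod>i\<in>J. root k (y i / c i))"
        unfolding prod.distrib[symmetric] using c(2) J
        by (intro prod.cong refl) (fastforce simp: real_root_divide)
      also have "\<dots> \<le> (\<Prod>i\<in>J. root k (c i)) * ((\<Sum>i\<in>J. y i / c i) / k)"
        using c(2) y(2) J
        by (intro mult_left_mono prod_root_le_sum prod_nonneg) (auto simp: less_imp_le intro: rc)
      also have "(\<Sum>i\<in>J. y i / c i) / k = (\<Sum>i\<in>J. 1 / (k * c i) * y i)"
        by (simp add: sum_divide_distrib mult.commute)
      finally have "ennreal (\<Prod>i\<in>J. root k (y i)) \<le> ennreal ((\<Prod>i\<in>J. root k (c i)) * (\<Sum>i\<in>J. 1 / (k * c i) * y i))"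
        by (rule ennreal_leI)
      also have "\<dots> = ennreal (\<Prod>i\<in>J. root k (c i)) * ennreal (\<Sum>i\<in>J. 1 / (k * c i) * y i)"
        using c(2) y(2) by (intro ennreal_mult prod_nonneg sum_nonneg) (auto simp: less_imp_le intro: rc)
      also have "ennreal (\<Prod>i\<in>J. root k (c i)) = (\<Prod>i\<in>J. eroot k (ennreal (c i)))"
        using c(2) by (subst prod_ennreal[symmetric]) (auto simp: less_imp_le eroot_ennreal intro: rc)
      also have "ennreal (\<Sum>i\<in>J. 1 / (k * c i) * y i) = (\<Sum>i\<in>J. ennreal (1 / (k * c i)) * F i x)"
      proof (subst sum_ennreal[symmetric])
        show "(\<Sum>i\<in>J. ennreal (1 / (k * c i) * y i)) = (\<Sum>i\<in>J. ennreal (1 / (k * c i)) * F i x)"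
        proof (rule sum.cong[OF refl])
          fix i assume i: "i \<in> J"
          show "ennreal (1 / (k * c i) * y i) = ennreal (1 / (k * c i)) * F i x"
            unfolding y(1)[OF i] using c(2)[OF i] y(2)[OF i] by (intro ennreal_mult) auto
        qed
        show "0 \<le> 1 / (k * c i) * y i" if "i \<in> J" for i
          using c(2)[OF that] y(2)[OF that] by simp
      qed
      also have "ennreal (\<Prod>i\<in>J. root k (y i)) = (\<Prod>i\<in>J. eroot k (F i x))"
        using y J by (subst prod_ennreal[symmetric]) (auto simp: eroot_ennreal)
      finally show ?thesis .
    qed
    have "(\<integral>\<^sup>+x. (\<Prod>i\<in>J. eroot k (F i x)) \<partial>N) \<le> (\<integral>\<^sup>+x. (\<Prod>i\<in>J. eroot k (ennreal (c i))) * (\<Sum>i\<in>J. ennreal (1 / (k * c i)) * F i x) \<partial>N)"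
      by (intro nn_integral_mono pt)
    also have "\<dots> = (\<Prod>i\<in>J. eroot k (ennreal (c i))) * (\<Sum>i\<in>J. ennreal (1 / (k * c i)) * (\<integral>\<^sup>+x. F i x \<partial>N))"
      by (simp add: nn_integral_cmult nn_integral_sum)
    also have "(\<Sum>i\<in>J. ennreal (1 / (k * c i)) * (\<integral>\<^sup>+x. F i x \<partial>N)) = (\<Sum>i\<in>J. ennreal (1 / k))"
    proof (rule sum.cong[OF refl])
      fix i assume i: "i \<in> J"
      show "ennreal (1 / (k * c i)) * (\<integral>\<^sup>+x. F i x \<partial>N) = ennreal (1 / k)"
        unfolding c(1)[OF i] using c(2)[OF i] J by (subst ennreal_mult[symmetric]) auto
    qed
    also have "\<dots> = 1" using J by (simp add: ennreal_of_nat_eq_real_of_nat ennreal_mult[symmetric])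
    finally show ?thesis using c by simp
  qed
qed

section \<open>Loomis-Whitney by integrating out coordinates\<close>

interpretation lebP: product_sigma_finite "\<lambda>_::nat. lborel :: real measure"
  by unfold_locales

abbreviation leb_Pi :: "nat set \<Rightarrow> (nat \<Rightarrow> real) measure" where
  "leb_Pi I \<equiv> Pi\<^sub>M I (\<lambda>_. lborel)"

lemma measurable_upd_remove [measurable]:
  assumes "i \<in> I"
  shows "(\<lambda>x. x(i := y)) \<in> measurable (leb_Pi (I - {i})) (leb_Pi I)"
proof -
  have "(\<lambda>x. x(i := y)) \<in> measurable (leb_Pi (I - {i})) (leb_Pi (insert i (I - {i})))"
    by (rule measurable_fun_upd[where J="I - {i}"]) auto
  then show ?thesis using assms by (simp add: insert_absorb)
qed

lemma measurable_remove_coordinate: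
  assumes f: "f \<in> borel_measurable (leb_Pi I)" and i: "i \<in> I" and "\<And>x y. f (x(i := y)) = f x"
  shows "f \<in> borel_measurable (leb_Pi (I - {i}))"
proof -
  have "(\<lambda>x. f (x(i := 0))) \<in> borel_measurable (leb_Pi (I - {i}))"
    using f measurable_upd_remove[OF i] by (rule measurable_compose[rotated])
  then show ?thesis using assms(3) by simp
qed

text \<open>Integrating out one coordinate at a time leaves a single use of Hoelder's inequality.\<close>

lemma loomis_whitney_nn_integral:
  assumes J: "finite J" "card J = Suc k" "0 < k"
    and "finite I" "I \<subseteq> J"
    and "\<And>i. i \<in> J \<Longrightarrow> F i \<in> borel_measurable (leb_Pi I)"
    and "\<And>i x y. i \<in> I \<Longrightarrow> F i (x(i := y)) = F i x"
  shows "(\<integral>\<^sup>+x. (\<Prod>i\<in>J. eroot k (F i x)) \<partial>leb_Pi I) \<le> (\<Prod>i\<in>J. eroot k (\<integral>\<^sup>+x. F i x \<partial>leb_Pi (I - {i})))"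
  using assms(4-)
proof (induction I arbitrary: F rule: finite_induct)
  case empty
  show ?case by (simp add: PiM_empty nn_integral_count_space_finite)
next
  case (insert m I)
  then have m: "m \<in> J" "m \<notin> I" by auto
  note meas [measurable] = insert.prems(2)
  have Fm: "F m (x(m := y)) = F m x" for x y using insert.prems(3) by blast
  have upd [measurable]: "(\<lambda>z. F i (x(m := z))) \<in> borel_measurable lborel" if "i \<in> J" "x \<in> space (leb_Pi I)" for i x
    using measurable_comp[OF measurable_component_update[OF that(2) m(2)] meas[OF that(1)]] by (simp add: comp_def)
  \<comment> \<open>F_m does not depend on coordinate m and is kept; all other functions are
    integrated over it, which preserves their independence of their own coordinate.\<close>
  define F' where "F' i x = (if i = m then F m x else \<integral>\<^sup>+y. F i (x(m := y)) \<partial>lborel)" for i x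
  have pair: "(\<lambda>(x, y). F i (x(m := y))) \<in> borel_measurable (leb_Pi I \<Otimes>\<^sub>M lborel)" if "i \<in> J" for i
    using measurable_compose[OF measurable_add_dim meas[OF that]] unfolding split_beta' .
  have "(\<integral>\<^sup>+x. (\<Prod>i\<in>J. eroot k (F i x)) \<partial>leb_Pi (insert m I)) =
      (\<integral>\<^sup>+x. \<integral>\<^sup>+y. (\<Prod>i\<in>J. eroot k (F i (x(m := y)))) \<partial>lborel \<partial>leb_Pi I)"
    using insert.hyps by (intro lebP.product_nn_integral_insert) auto
  also have "\<dots> \<le> (\<integral>\<^sup>+x. (\<Prod>i\<in>J. eroot k (F' i x)) \<partial>leb_Pi I)"
  proof (intro nn_integral_mono)
    fix x assume x: "x \<in> space (leb_Pi I)"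
    have "(\<integral>\<^sup>+y. (\<Prod>i\<in>J. eroot k (F i (x(m := y)))) \<partial>lborel)
       = (\<integral>\<^sup>+y. eroot k (F m x) * (\<Prod>i\<in>J - {m}. eroot k (F i (x(m := y)))) \<partial>lborel)"
      using J m Fm by (intro nn_integral_cong) (simp add: prod.remove[of _ m])
    also have "\<dots> = eroot k (F m x) * (\<integral>\<^sup>+y. (\<Prod>i\<in>J - {m}. eroot k (F i (x(m := y)))) \<partial>lborel)"
      using x by (intro nn_integral_cmult borel_measurable_prod) auto
    \<comment> \<open>With F_m taken out, exactly \<open>k\<close> of the \<open>Suc k\<close>
      factors remain, which matches the exponent 1/k.\<close>
    also have "\<dots> \<le> eroot k (F m x) * (\<Prod>i\<in>J - {m}. eroot k (\<integral>\<^sup>+y. F i (x(m := y)) \<partial>lborel))"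
      using J m x by (intro mult_left_mono nn_integral_prod_eroot_le) auto
    also have "\<dots> = (\<Prod>i\<in>J. eroot k (F' i x))"
      using J m by (simp add: prod.remove[of _ m] F'_def)
    finally show "(\<integral>\<^sup>+y. (\<Prod>i\<in>J. eroot k (F i (x(m := y)))) \<partial>lborel) \<le> (\<Prod>i\<in>J. eroot k (F' i x))" .
  qed
  also have "\<dots> \<le> (\<Prod>i\<in>J. eroot k (\<integral>\<^sup>+x. F' i x \<partial>leb_Pi (I - {i})))"
  proof (rule insert.IH)
    show "I \<subseteq> J" using insert by auto
    show "F' i \<in> borel_measurable (leb_Pi I)" if "i \<in> J" for i
    proof (cases "i = m")
      case True
      have "F m \<in> borel_measurable (leb_Pi (insert m I - {m}))"
        by (rule measurable_remove_coordinate[OF meas[OF m(1)]]) (simp_all only: Fm insertI1)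
      then show ?thesis using True m by (simp add: F'_def[abs_def])
    next
      case False
      then show ?thesis using pair[OF that]
        unfolding F'_def[abs_def] by (simp add: lborel.borel_measurable_nn_integral)
    qed
    show "F' i (x(i := y)) = F' i x" if "i \<in> I" for i x y
    proof -
      have im: "i \<noteq> m" and indep: "\<And>z. F i ((x(m := z))(i := y)) = F i (x(m := z))"
        using that m insert.prems(3)[of i] by blast+
      show ?thesis by (simp only: F'_def im if_False fun_upd_twist[OF im] indep)
    qed
  qed
  also have "\<dots> = (\<Prod>i\<in>J. eroot k (\<integral>\<^sup>+x. F i x \<partial>leb_Pi (insert m I - {i})))"
  proof (intro prod.cong refl arg_cong[where f="eroot k"])
    fix i assume i: "i \<in> J"
    show "(\<integral>\<^sup>+x. F' i x \<partial>leb_Pi (I - {i})) = (\<integral>\<^sup>+x. F i x \<partial>leb_Pi (insert m I - {i}))"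
    proof (cases "i = m")
      case True
      then show ?thesis using m by (simp add: F'_def)
    next
      case False
      have "F i \<in> borel_measurable (leb_Pi (insert m I - {i}))"
      proof (cases "i \<in> I")
        case True
        show ?thesis by (rule measurable_remove_coordinate[OF meas[OF i]]) (use True insert.prems(3) in auto)
      next
        case F: False
        then show ?thesis using meas[OF i] False by simp
      qed
      then have "F i \<in> borel_measurable (leb_Pi (insert m (I - {i})))" using False by (simp add: insert_Diff_if)
      then show ?thesis using False m insert.hyps
        by (simp add: F'_def insert_Diff_if lebP.product_nn_integral_insert)
    qed
  qed
  finally show ?case .
qed

text \<open>On E the product of the (n-1)-th roots of the F_i is at least the n-th power of the
  (n-1)-th root of c. Integrating this lower bound and raising to the power n-1 removes all roots.
  In the application F_i is an integral over lines in direction i.\<close>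

lemma loomis_whitney:
  assumes n: "0 < n" and E [measurable]: "E \<in> sets (leb_Pi {..<n})" and pos: "emeasure (leb_Pi {..<n}) E \<noteq> 0"
    and F [measurable]: "\<And>i. i < n \<Longrightarrow> F i \<in> borel_measurable (leb_Pi {..<n})"
    and indep: "\<And>i x y. i < n \<Longrightarrow> F i (x(i := y)) = F i x"
    and ge: "AE x in leb_Pi {..<n}. x \<in> E \<longrightarrow> (\<forall>i<n. c \<le> F i x)"
  shows "c ^ n * emeasure (leb_Pi {..<n}) E ^ (n - 1) \<le> (\<Prod>i<n. \<integral>\<^sup>+x. F i x \<partial>leb_Pi ({..<n} - {i}))"
proof (cases "n = 1")
  case True
  \<comment> \<open>For n = 1 the root of order n-1 degenerates. Here \<open>F 0\<close> is a
    constant, and the positive mass of E supplies a point at which the lower bound c can be read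
    off.\<close>
  have "\<not> (AE x in leb_Pi {..<n}. x \<notin> E)"
    using pos AE_iff_null[of "leb_Pi {..<n}" "\<lambda>x. x \<notin> E"] sets.sets_into_space[OF E]
    by (auto simp: null_sets_def Int_absorb1 Collect_conj_eq Int_commute)
  with ge obtain x where "x \<in> E" "\<forall>i<n. c \<le> F i x"
    by (metis (mono_tags, lifting) eventually_mono)
  then have "c \<le> F 0 (\<lambda>_. undefined)"
  proof -
    have "x \<in> space (leb_Pi {..<n})" using \<open>x \<in> E\<close> sets.sets_into_space[OF E] by auto
    then have "(\<lambda>_. undefined) = x(0 := undefined)" using True by (auto simp: space_PiM PiE_def extensional_def fun_eq_iff)
    then show ?thesis using indep[of 0 x undefined] n \<open>\<forall>i<n. c \<le> F i x\<close> by simp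
  qed
  then show ?thesis using True by (simp add: PiM_empty nn_integral_count_space_finite lessThan_Suc)
next
  case False
  define k where "k = n - 1"
  have k: "0 < k" "card {..<n} = Suc k" using False n by (auto simp: k_def)
  have "eroot k c ^ n * emeasure (leb_Pi {..<n}) E = (\<integral>\<^sup>+x. eroot k c ^ n * indicator E x \<partial>leb_Pi {..<n})"
    by (simp add: nn_integral_cmult_indicator)
  also have "\<dots> \<le> (\<integral>\<^sup>+x. (\<Prod>i<n. eroot k (F i x)) \<partial>leb_Pi {..<n})"
  proof (rule nn_integral_mono_AE)
    show "AE x in leb_Pi {..<n}. eroot k c ^ n * indicator E x \<le> (\<Prod>i<n. eroot k (F i x))"
      using ge
    proof eventually_elim
      case (elim x)
      have "(\<Prod>i<n. eroot k c) \<le> (\<Prod>i<n. eroot k (F i x))" if "x \<in> E"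
        using elim that k by (intro ennreal_prod_mono) (auto intro: eroot_mono)
      then show ?case by (auto split: split_indicator)
    qed
  qed
  also have "\<dots> \<le> (\<Prod>i<n. eroot k (\<integral>\<^sup>+x. F i x \<partial>leb_Pi ({..<n} - {i})))"
    by (rule loomis_whitney_nn_integral) (use k indep F in auto)
  finally have "(eroot k c ^ n * emeasure (leb_Pi {..<n}) E) ^ k \<le> (\<Prod>i<n. eroot k (\<integral>\<^sup>+x. F i x \<partial>leb_Pi ({..<n} - {i}))) ^ k"
    by (rule power_mono) simp
  moreover have "(eroot k c ^ n) ^ k = c ^ n"
    by (metis power_mult mult.commute eroot_power[OF k(1)])
  ultimately show ?thesis
    by (simp only: power_mult_distrib prod_power_distrib eroot_power[OF k(1)] k_def[symmetric])
qed

section \<open>Smooth bumps and product test functions\<close>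

text \<open>The derivative is quantified rather than computed, so closure under sums, products and
  affine substitution is proved by induction on the order.\<close>

fun ndiff :: "nat \<Rightarrow> (real \<Rightarrow> real) \<Rightarrow> bool" where
  "ndiff 0 r = True"
| "ndiff (Suc n) r = (\<exists>r'. (\<forall>x. (r has_real_derivative r' x) (at x)) \<and> ndiff n r')"

definition smooth1 :: "(real \<Rightarrow> real) \<Rightarrow> bool" where
  "smooth1 r \<longleftrightarrow> (\<forall>n. ndiff n r)"

lemma ndiff_Suc_imp: "ndiff (Suc n) r \<Longrightarrow> ndiff n r"
proof (induction n arbitrary: r)
  case (Suc n)
  from Suc.prems obtain r' where r': "\<forall>x. (r has_real_derivative r' x) (at x)" "ndiff (Suc n) r'"
    unfolding ndiff.simps(2)[of "Suc n"] by blast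
  show ?case unfolding ndiff.simps(2)[of n] using r'(1) Suc.IH[OF r'(2)] by blast
qed simp

lemma ndiff_add: "ndiff n r \<Longrightarrow> ndiff n s \<Longrightarrow> ndiff n (\<lambda>x. r x + s x)"
proof (induction n arbitrary: r s)
  case (Suc n)
  then obtain r' s' where "\<forall>x. (r has_real_derivative r' x) (at x)" "ndiff n r'"
    "\<forall>x. (s has_real_derivative s' x) (at x)" "ndiff n s'" by auto
  then show ?case using Suc.IH by (auto intro!: exI[of _ "\<lambda>x. r' x + s' x"] derivative_intros)
qed simp

lemma ndiff_mult: "ndiff n r \<Longrightarrow> ndiff n s \<Longrightarrow> ndiff n (\<lambda>x. r x * s x)"
proof (induction n arbitrary: r s)
  case (Suc n)
  then obtain r' s' where *: "\<forall>x. (r has_real_derivative r' x) (at x)" "ndiff n r'"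
    "\<forall>x. (s has_real_derivative s' x) (at x)" "ndiff n s'" by auto
  have "ndiff n (\<lambda>x. r' x * s x + r x * s' x)"
    using Suc.prems * by (intro ndiff_add Suc.IH) (auto intro: ndiff_Suc_imp simp del: ndiff.simps(2))
  moreover have "((\<lambda>x. r x * s x) has_real_derivative r' x * s x + r x * s' x) (at x)" for x
    using DERIV_mult'[of r "r' x" x UNIV s "s' x"] * by (simp add: add.commute)
  ultimately show ?case unfolding ndiff.simps by (intro exI[of _ "\<lambda>x. r' x * s x + r x * s' x"]) blast
qed simp

lemma ndiff_affine: "ndiff n r \<Longrightarrow> ndiff n (\<lambda>x. c * r (\<alpha> * x + \<beta>))"
proof (induction n arbitrary: r c)
  case (Suc n)
  then obtain r' where *: "\<forall>x. (r has_real_derivative r' x) (at x)" "ndiff n r'" by auto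
  have "((\<lambda>x. c * r (\<alpha> * x + \<beta>)) has_real_derivative (c * \<alpha>) * r' (\<alpha> * x + \<beta>)) (at x)" for x
    using *(1) by (auto intro!: derivative_eq_intros DERIV_chain2[of r])
  then show ?case unfolding ndiff.simps using Suc.IH[OF *(2), of "c * \<alpha>"]
    by (intro exI[of _ "\<lambda>x. c * \<alpha> * r' (\<alpha> * x + \<beta>)"]) blast
qed simp

lemma smooth1_mult: "smooth1 r \<Longrightarrow> smooth1 s \<Longrightarrow> smooth1 (\<lambda>x. r x * s x)"
  by (simp add: smooth1_def ndiff_mult)

lemma smooth1_affine: "smooth1 r \<Longrightarrow> smooth1 (\<lambda>x. c * r (\<alpha> * x + \<beta>))"
  by (simp add: smooth1_def ndiff_affine)

lemma smooth1_diff: "smooth1 r \<Longrightarrow> smooth1 s \<Longrightarrow> smooth1 (\<lambda>x. r x - s x)"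
  using ndiff_add[of _ r "\<lambda>x. - s x"] ndiff_affine[of _ s "-1" 1 0] by (simp add: smooth1_def)

lemma smooth1_primitive: "smooth1 r \<Longrightarrow> (\<And>x. (R has_real_derivative r x) (at x)) \<Longrightarrow> smooth1 R"
  unfolding smooth1_def
proof
  fix n
  assume "\<forall>n. ndiff n r" "\<And>x. (R has_real_derivative r x) (at x)"
  then show "ndiff n R" by (cases n) auto
qed

lemma smooth1_deriv:
  assumes "smooth1 r"
  shows "(r has_real_derivative deriv r x) (at x)" "smooth1 (deriv r)"
proof -
  have D: "\<exists>r'. (\<forall>x. (r has_real_derivative r' x) (at x)) \<and> ndiff n r'" for n
    using assms unfolding smooth1_def by (metis ndiff.simps(2))
  have eq: "r' = deriv r" if "\<forall>x. (r has_real_derivative r' x) (at x)" for r'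
    using that by (auto simp: fun_eq_iff intro!: DERIV_imp_deriv[symmetric])
  show "(r has_real_derivative deriv r x) (at x)" using D[of 0] eq by blast
  show "smooth1 (deriv r)" unfolding smooth1_def using D eq by blast
qed

section \<open>Flat functions, bumps and their primitives\<close>

definition exp_inv :: "real poly \<Rightarrow> real \<Rightarrow> real" where
  "exp_inv p x = (if 0 < x then poly p (1 / x) * exp (- (1 / x)) else 0)"

lemma poly_exp_tendsto_0: "((\<lambda>y. poly p y * exp (- y)) \<longlongrightarrow> (0::real)) at_top"
proof -
  have "((\<lambda>y. \<Sum>i\<le>degree p. coeff p i * (y ^ i / exp y)) \<longlongrightarrow> (\<Sum>i\<le>degree p. coeff p i * 0)) at_top"
    by (intro tendsto_sum tendsto_mult tendsto_const tendsto_power_div_exp_0)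
  then show ?thesis
    by (simp add: poly_altdef sum_distrib_right exp_minus divide_inverse mult.assoc)
qed

text \<open>With y = 1/x the derivative of p(y) exp(-y) is y^2 (p(y) - p'(y)) exp(-y). The
  polynomial factor thus makes the family closed under differentiation, and smoothness follows by
  induction over all \<open>p\<close> at once.\<close>

lemma DERIV_exp_inv: "(exp_inv p has_real_derivative exp_inv ([:0, 0, 1:] * (p - pderiv p)) x) (at x)"
proof -
  consider "x > 0" | "x < 0" | "x = 0" by linarith
  then show ?thesis
  proof cases
    case 1
    have "((\<lambda>x. poly p (1 / x) * exp (- (1 / x))) has_real_derivative exp_inv ([:0, 0, 1:] * (p - pderiv p)) x) (at x)"
      using 1 by (auto intro!: derivative_eq_intros DERIV_chain2[OF poly_DERIV] simp: exp_inv_def)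
         (simp add: field_simps power2_eq_square)
    then show ?thesis
      by (rule has_field_derivative_transform_within_open[of _ _ _ "{0<..}"]) (use 1 in \<open>auto simp: exp_inv_def\<close>)
  next
    case 2
    have "((\<lambda>x. 0) has_real_derivative exp_inv ([:0, 0, 1:] * (p - pderiv p)) x) (at x)"
      using 2 by (simp add: exp_inv_def)
    then show ?thesis
      by (rule has_field_derivative_transform_within_open[of _ _ _ "{..<0}"]) (use 2 in \<open>auto simp: exp_inv_def\<close>)
  next
    case 3
    have "((\<lambda>h. exp_inv p h / h) \<longlongrightarrow> 0) (at 0)"
    proof (rule filterlim_split_at)
      show "((\<lambda>h. exp_inv p h / h) \<longlongrightarrow> 0) (at_left 0)"
        by (rule tendsto_eventually) (auto simp: exp_inv_def eventually_at_filter)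
      \<comment> \<open>Dividing by h multiplies the polynomial by y = 1/h, so the difference
        quotient at 0 is again a polynomial times exp(-y).\<close>
      have "((\<lambda>h. poly ([:0, 1:] * p) (inverse h) * exp (- inverse h)) \<longlongrightarrow> 0) (at_right 0)"
        by (rule filterlim_compose[OF poly_exp_tendsto_0 filterlim_inverse_at_top_right])
      then show "((\<lambda>h. exp_inv p h / h) \<longlongrightarrow> 0) (at_right 0)"
        by (rule Lim_transform_eventually) (auto simp: exp_inv_def eventually_at_filter divide_inverse)
    qed
    then show ?thesis using 3 by (simp add: DERIV_def exp_inv_def)
  qed
qed

lemma smooth1_exp_inv: "smooth1 (exp_inv p)"
proof -
  have "ndiff n (exp_inv p)" for n
    by (induction n arbitrary: p) (use DERIV_exp_inv in auto)
  then show ?thesis by (simp add: smooth1_def)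
qed

text \<open>Scaling the argument of $e^{-1/x}$ makes the bumps increase to the indicator function.\<close>

definition bump :: "nat \<Rightarrow> real \<Rightarrow> real \<Rightarrow> real \<Rightarrow> real" where
  "bump m a b x = exp_inv 1 (real (Suc m) * (x - a)) * exp_inv 1 (real (Suc m) * (b - x))"

lemma smooth1_bump: "smooth1 (bump m a b)"
proof -
  have "smooth1 (\<lambda>x. (1 * exp_inv 1 (real (Suc m) * x + - real (Suc m) * a)) * (1 * exp_inv 1 ((- real (Suc m)) * x + real (Suc m) * b)))"
    by (intro smooth1_mult smooth1_affine smooth1_exp_inv)
  also have "(\<lambda>x. (1 * exp_inv 1 (real (Suc m) * x + - real (Suc m) * a)) * (1 * exp_inv 1 ((- real (Suc m)) * x + real (Suc m) * b))) = bump m a b"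
    unfolding bump_def by (intro ext arg_cong2[where f="(*)"]) (auto simp: algebra_simps)
  finally show ?thesis .
qed

lemma bump_nonneg: "0 \<le> bump m a b x" and bump_le_1: "bump m a b x \<le> 1"
proof -
  have *: "0 \<le> exp_inv 1 x" "exp_inv 1 x \<le> 1" for x by (auto simp: exp_inv_def)
  show "0 \<le> bump m a b x" "bump m a b x \<le> 1" unfolding bump_def using * by (auto intro: mult_le_one)
qed

lemma bump_eq_0: "x \<notin> {a<..<b} \<Longrightarrow> bump m a b x = 0"
  by (auto simp: bump_def exp_inv_def not_less zero_less_mult_iff)

lemma bump_tendsto: "(\<lambda>m. bump m a b x) \<longlonglongrightarrow> indicator {a<..<b} x"
proof (cases "x \<in> {a<..<b}")
  case True
  have *: "(\<lambda>m. exp_inv 1 (real (Suc m) * c)) \<longlonglongrightarrow> 1" if "0 < c" for c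
  proof -
    have "(\<lambda>m. exp (- (inverse (real (Suc m)) * (1/c)))) \<longlonglongrightarrow> exp (- (0 * (1/c)))"
      by (intro tendsto_exp tendsto_minus tendsto_mult tendsto_const LIMSEQ_inverse_real_of_nat)
    then show ?thesis using that
      by (simp add: exp_inv_def zero_less_mult_iff divide_inverse inverse_mult_distrib mult.commute del: of_nat_Suc)
  qed
  have "(\<lambda>m. bump m a b x) \<longlonglongrightarrow> 1 * 1"
    unfolding bump_def by (intro tendsto_mult *) (use True in auto)
  then show ?thesis using True by simp
qed (simp add: bump_eq_0)

lemma continuous_bump: "continuous_on UNIV (bump m a b)"
  using smooth1_deriv(1)[OF smooth1_bump] by (meson DERIV_isCont continuous_at_imp_continuous_on)

lemma bump_measurable [measurable]: "bump m a b \<in> borel_measurable borel"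
  by (rule borel_measurable_continuous_onI[OF continuous_bump])

lemma integrable_bump: "integrable lborel (bump m a b)"
proof (rule Bochner_Integration.integrable_bound[where f="indicator {a<..<b} :: real \<Rightarrow> real"])
  show "integrable lborel (indicator {a<..<b} :: real \<Rightarrow> real)"
    by (cases "a \<le> b") (auto simp: integrable_indicator_iff)
  show "AE x in lborel. norm (bump m a b x) \<le> norm (indicator {a<..<b} x :: real)"
    using bump_nonneg bump_le_1 bump_eq_0 by (intro AE_I2) (auto simp: indicator_def)
qed simp

text \<open>The integral over the whole half line below t is the form that Fubini produces from
  \<open>tail_int\<close>.\<close>

definition bump_primitive :: "nat \<Rightarrow> real \<Rightarrow> real \<Rightarrow> real \<Rightarrow> real" where
  "bump_primitive m a b t = (LINT s|lborel. bump m a b s * indicator {..t} s)"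

lemma bump_primitive_eq_0: "t \<le> a \<Longrightarrow> bump_primitive m a b t = 0"
proof -
  assume "t \<le> a"
  then have "(\<lambda>s. bump m a b s * indicator {..t} s) = (\<lambda>s. 0)"
    by (intro ext) (auto simp: bump_eq_0 indicator_def)
  then show ?thesis by (simp only: bump_primitive_def) simp
qed

lemma bump_primitive_const:
  assumes "b \<le> t" shows "bump_primitive m a b t = bump_primitive m a b b"
proof -
  have "(\<lambda>s. bump m a b s * indicator {..t} s) = (\<lambda>s. bump m a b s * indicator {..b} s)"
    using assms by (intro ext) (auto simp: bump_eq_0 indicator_def)
  then show ?thesis by (simp only: bump_primitive_def)
qed

lemma DERIV_bump_primitive: "(bump_primitive m a b has_real_derivative bump m a b x) (at x)"
proof (cases "x < a")
  case True
  have "((\<lambda>x. 0) has_real_derivative bump m a b x) (at x)" using True by (simp add: bump_eq_0)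
  then show ?thesis
    by (rule has_field_derivative_transform_within_open[of _ _ _ "{..<a}"])
      (use True in \<open>auto simp: bump_primitive_eq_0\<close>)
next
  case False
  \<comment> \<open>The integrand vanishes below \<open>a\<close>, so a lower limit with some margin
    changes nothing; together with the upper end x + 1 it makes x an interior point of the
    interval.\<close>
  define c where "c = a - 1"
  have eq: "bump_primitive m a b t = integral {c..t} (bump m a b)" for t
  proof -
    have "bump_primitive m a b t = (LINT s:{c..t}|lborel. bump m a b s)"
      unfolding bump_primitive_def set_lebesgue_integral_def
      by (intro Bochner_Integration.integral_cong refl) (auto simp: indicator_def c_def bump_eq_0)
    also have "\<dots> = integral {c..t} (bump m a b)"
      using integrable_mult_indicator[OF _ integrable_bump, of "{c..t}"]
      by (intro set_borel_integral_eq_integral) (simp add: set_integrable_def)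
    finally show ?thesis .
  qed
  have "((\<lambda>t. integral {c..t} (bump m a b)) has_real_derivative bump m a b x) (at x within {c..x + 1})"
    using False by (intro integral_has_real_derivative continuous_on_subset[OF continuous_bump]) (auto simp: c_def)
  then have "((\<lambda>t. integral {c..t} (bump m a b)) has_real_derivative bump m a b x) (at x)"
    using False by (subst (asm) at_within_interior) (auto simp: c_def)
  then show ?thesis by (simp add: eq[abs_def])
qed

text \<open>The difference of two primitives is compactly supported, and it agrees with the first one
  to the left of the translated bump.\<close>

definition bump_step :: "nat \<Rightarrow> real \<Rightarrow> real \<Rightarrow> real \<Rightarrow> real \<Rightarrow> real" where
  "bump_step m a b \<tau> t = bump_primitive m a b t - bump_primitive m a b (t - \<tau>)"

lemma DERIV_bump_step: "(bump_step m a b \<tau> has_real_derivative bump m a b t - bump m a b (t - \<tau>)) (at t)"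
  unfolding bump_step_def[abs_def]
  by (auto intro!: derivative_eq_intros DERIV_bump_primitive DERIV_chain2[OF DERIV_bump_primitive])

lemma smooth1_bump_step: "smooth1 (bump_step m a b \<tau>)"
proof (rule smooth1_primitive[OF smooth1_diff DERIV_bump_step])
  show "smooth1 (\<lambda>t. bump m a b (t - \<tau>))"
    using smooth1_affine[OF smooth1_bump, of 1 m a b 1 "- \<tau>"] by simp
qed (rule smooth1_bump)

lemma bump_step_eq_0: "0 \<le> \<tau> \<Longrightarrow> t \<notin> {a..b + \<tau>} \<Longrightarrow> bump_step m a b \<tau> t = 0"
  using bump_primitive_const[of b t m a] bump_primitive_const[of b "t - \<tau>" m a]
  by (cases "t \<le> a") (auto simp: bump_step_def bump_primitive_eq_0)

lemma bump_step_eq: "t \<le> a + \<tau> \<Longrightarrow> bump_step m a b \<tau> t = bump_primitive m a b t"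
  by (simp add: bump_step_def bump_primitive_eq_0)

section \<open>Tensor product test functions\<close>

definition prod_fun :: "nat \<Rightarrow> (nat \<Rightarrow> real \<Rightarrow> real) \<Rightarrow> (nat \<Rightarrow> real) \<Rightarrow> real" where
  "prod_fun n r x = (\<Prod>j<n. r j (x j))"

lemma prod_fun_upd: "i < n \<Longrightarrow> prod_fun n r (x(i := t)) = r i t * (\<Prod>j\<in>{..<n} - {i}. r j (x j))"
  unfolding prod_fun_def by (subst prod.remove[of _ i]) (auto intro!: prod.cong)

lemma partial_deriv_prod_fun:
  assumes "i < n" "smooth1 (r i)"
  shows "partial_deriv i (prod_fun n r) = prod_fun n (r(i := deriv (r i)))"
proof
  fix x :: "nat \<Rightarrow> real"
  have "((\<lambda>t. prod_fun n r (x(i := t))) has_real_derivative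
      deriv (r i) (x i) * (\<Prod>j\<in>{..<n} - {i}. r j (x j))) (at (x i))"
    unfolding prod_fun_upd[OF assms(1)]
    by (intro DERIV_cmult_right smooth1_deriv assms)
  then have "partial_deriv i (prod_fun n r) x = deriv (r i) (x i) * (\<Prod>j\<in>{..<n} - {i}. r j (x j))"
    unfolding partial_deriv_def by (rule DERIV_imp_deriv)
  also have "\<dots> = prod_fun n (r(i := deriv (r i))) x"
    unfolding prod_fun_def by (subst (2) prod.remove[of _ i]) (use assms in \<open>auto intro!: prod.cong\<close>)
  finally show "partial_deriv i (prod_fun n r) x = prod_fun n (r(i := deriv (r i))) x" .
qed

text \<open>Products of one-variable functions are closed under partial derivatives, which reduces
  smoothness in n variables to that of the factors.\<close>

lemma partial_derivs_prod_fun: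
  assumes "\<And>j. smooth1 (r j)" "set is \<subseteq> {..<n}"
  shows "\<exists>r'. (\<forall>j. smooth1 (r' j)) \<and> partial_derivs is (prod_fun n r) = prod_fun n r'"
  using assms(2)
proof (induction "is")
  case Nil
  then show ?case using assms(1) by (auto simp: partial_derivs_def)
next
  case (Cons i "is")
  then obtain r' where r': "\<forall>j. smooth1 (r' j)" "partial_derivs is (prod_fun n r) = prod_fun n r'" by auto
  have "partial_derivs (i # is) (prod_fun n r) = prod_fun n (r'(i := deriv (r' i)))"
    using r' Cons.prems partial_deriv_prod_fun[of i n r'] by (simp add: partial_derivs_def)
  moreover have "\<forall>j. smooth1 ((r'(i := deriv (r' i))) j)" using r' smooth1_deriv(2) by auto
  ultimately show ?case by blast
qed

lemma topspace_Rn_top: "topspace (Rn_top n) = PiE {..<n} (\<lambda>_. UNIV)"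
  by (simp add: Rn_top_def)

lemma continuous_map_prod_fun:
  assumes "\<And>j. smooth1 (r j)"
  shows "continuous_map (Rn_top n) euclideanreal (prod_fun n r)"
proof -
  have *: "continuous_map (Rn_top n) euclideanreal (\<lambda>x. r j (x j))" if "j < n" for j
  proof -
    have "continuous_on UNIV (r j)"
      using smooth1_deriv(1)[OF assms] by (meson DERIV_isCont continuous_at_imp_continuous_on)
    moreover have "continuous_map (Rn_top n) euclideanreal (\<lambda>x. x j)"
      unfolding Rn_top_def using that by (intro continuous_map_product_projection) auto
    ultimately show ?thesis
      using continuous_map_compose[of "Rn_top n" euclideanreal "\<lambda>x. x j" euclideanreal "r j"] by (simp add: comp_def)
  qed
  have "continuous_map (Rn_top n) euclideanreal (\<lambda>x. \<Prod>j<k. r j (x j))" if "k \<le> n" for k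
    using that by (induction k) (auto intro!: continuous_map_real_mult *)
  then show ?thesis by (simp add: prod_fun_def[abs_def])
qed

lemma smooth_prod_fun:
  assumes "\<And>j. smooth1 (r j)"
  shows "smooth n (prod_fun n r)"
  unfolding smooth_def
proof (intro allI impI conjI ballI)
  fix "is" assume "is": "set is \<subseteq> {..<n}"
  obtain r' where r': "\<forall>j. smooth1 (r' j)" "partial_derivs is (prod_fun n r) = prod_fun n r'"
    using partial_derivs_prod_fun[of r "is" n] assms "is" by blast
  show "continuous_map (Rn_top n) euclideanreal (partial_derivs is (prod_fun n r))"
    unfolding r' using r' by (intro continuous_map_prod_fun) auto
  fix x i assume i: "i < n"
  have "((\<lambda>t. prod_fun n r' (x(i := t))) has_real_derivative
      deriv (r' i) (x i) * (\<Prod>j\<in>{..<n} - {i}. r' j (x j))) (at (x i))"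
    unfolding prod_fun_upd[OF i] using r' by (intro DERIV_cmult_right smooth1_deriv) auto
  then show "(\<lambda>t. partial_derivs is (prod_fun n r) (x(i := t))) differentiable at (x i)"
    unfolding r' using real_differentiable_def by blast
qed

definition cbox_Pi :: "nat \<Rightarrow> (nat \<Rightarrow> real) \<Rightarrow> (nat \<Rightarrow> real) \<Rightarrow> (nat \<Rightarrow> real) set" where
  "cbox_Pi n a b = PiE {..<n} (\<lambda>j. {a j..b j})"

lemma compactin_cbox_Pi: "compactin (Rn_top n) (cbox_Pi n a b)"
  unfolding Rn_top_def cbox_Pi_def by (simp add: compactin_PiE)

lemma test_function_prod_fun:
  assumes "\<And>j. smooth1 (r j)" "\<And>j t. j < n \<Longrightarrow> t \<notin> {a j..b j} \<Longrightarrow> r j t = 0" "cbox_Pi n a b \<subseteq> U"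
  shows "test_function n U (prod_fun n r)"
  unfolding test_function_def
proof (intro conjI exI[of _ "cbox_Pi n a b"] ballI smooth_prod_fun compactin_cbox_Pi)
  fix x assume x: "x \<in> topspace (Rn_top n) - cbox_Pi n a b"
  then obtain j where "j < n" "x j \<notin> {a j..b j}"
    by (auto simp: topspace_Rn_top cbox_Pi_def PiE_iff)
  then show "prod_fun n r x = 0" using assms(2) unfolding prod_fun_def by (intro prod_zero) auto
qed (use assms in auto)

text \<open>The same compact set serves as support: it is closed in the Hausdorff space, so near a
  point outside it the function vanishes on a piece of the coordinate line.\<close>

lemma test_function_partial_deriv:
  assumes "test_function n U \<phi>" "i < n"
  shows "test_function n U (partial_deriv i \<phi>)"
proof -
  obtain K where K: "compactin (Rn_top n) K" "K \<subseteq> U" "\<forall>x\<in>topspace (Rn_top n) - K. \<phi> x = 0"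
    using assms by (auto simp: test_function_def)
  have sm: "smooth n (partial_deriv i \<phi>)"
    unfolding smooth_def
  proof (intro allI impI)
    fix "is" assume "set is \<subseteq> {..<n}"
    then have "set (is @ [i]) \<subseteq> {..<n}" using assms by auto
    moreover have "partial_derivs is (partial_deriv i \<phi>) = partial_derivs (is @ [i]) \<phi>"
      by (simp add: partial_derivs_def)
    ultimately show "continuous_map (Rn_top n) euclideanreal (partial_derivs is (partial_deriv i \<phi>)) \<and>
      (\<forall>x\<in>topspace (Rn_top n). \<forall>ia<n. (\<lambda>t. partial_derivs is (partial_deriv i \<phi>) (x(ia := t))) differentiable at (x ia))"
      using assms(1) unfolding test_function_def smooth_def by metis
  qed
  have "Hausdorff_space (Rn_top n)"
    unfolding Rn_top_def by (simp add: Hausdorff_space_product_topology)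
  then have cl: "closedin (Rn_top n) K" using K(1) by (rule compactin_imp_closedin)
  have "partial_deriv i \<phi> x = 0" if x: "x \<in> topspace (Rn_top n) - K" for x
  proof -
    have "continuous_map euclideanreal (Rn_top n) (\<lambda>t. x(i := t))"
      unfolding Rn_top_def
    proof (rule continuous_map_componentwise[THEN iffD2], intro conjI ballI)
      show "(\<lambda>t. x(i := t)) ` topspace euclideanreal \<subseteq> extensional {..<n}"
        using x assms(2) by (auto simp: topspace_Rn_top extensional_def PiE_def)
      show "continuous_map euclideanreal euclideanreal (\<lambda>t. (x(i := t)) k)" for k
        by (cases "k = i") auto
    qed
    then have "openin euclideanreal {t \<in> topspace euclideanreal. x(i := t) \<in> topspace (Rn_top n) - K}"
      by (rule openin_continuous_map_preimage) (use cl in auto)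
    then have op: "open {t. x(i := t) \<in> topspace (Rn_top n) - K}" by simp
    have "((\<lambda>t. \<phi> (x(i := t))) has_real_derivative 0) (at (x i))"
    proof (rule has_field_derivative_transform_within_open[OF DERIV_const op])
      show "x i \<in> {t. x(i := t) \<in> topspace (Rn_top n) - K}" using x by simp
      show "0 = \<phi> (x(i := t))" if "t \<in> {t. x(i := t) \<in> topspace (Rn_top n) - K}" for t
        using that K(3) by (metis mem_Collect_eq)
    qed
    then show ?thesis unfolding partial_deriv_def by (rule DERIV_imp_deriv)
  qed
  then show ?thesis using sm K unfolding test_function_def by blast
qed

section \<open>The fundamental lemma of the calculus of variations\<close>

text \<open>No order between \<open>a\<close> and \<open>b\<close> is imposed; empty boxes are
  allowed, which makes the family closed under intersection.\<close>

definition obox_Pi :: "nat \<Rightarrow> (nat \<Rightarrow> real) \<Rightarrow> (nat \<Rightarrow> real) \<Rightarrow> (nat \<Rightarrow> real) set" where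
  "obox_Pi n a b = PiE {..<n} (\<lambda>j. {a j<..<b j})"

lemma obox_Pi_sets [measurable]: "obox_Pi n a b \<in> sets (leb_Pi {..<n})"
  unfolding obox_Pi_def by (intro sets_PiM_I_finite) auto

lemma cbox_Pi_sets [measurable]: "cbox_Pi n a b \<in> sets (leb_Pi {..<n})"
  unfolding cbox_Pi_def by (intro sets_PiM_I_finite) auto

lemma obox_Pi_subset: "obox_Pi n a b \<subseteq> cbox_Pi n a b"
  unfolding obox_Pi_def cbox_Pi_def by (intro PiE_mono) auto

lemma obox_Pi_Int: "obox_Pi n a b \<inter> obox_Pi n c d = obox_Pi n (\<lambda>j. max (a j) (c j)) (\<lambda>j. min (b j) (d j))"
  by (simp only: obox_Pi_def PiE_Int Int_greaterThanLessThan)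

lemma cbox_Pi_mono:
  assumes "\<And>j. a j \<le> c j" "\<And>j. d j \<le> b j" shows "cbox_Pi n c d \<subseteq> cbox_Pi n a b"
  unfolding cbox_Pi_def using assms by (intro PiE_mono) (simp add: atLeastatMost_subset_iff)

lemma space_leb_Pi: "space (leb_Pi I) = PiE I (\<lambda>_. UNIV)"
  by (simp add: space_PiM)

lemma obox_Pi_exhaust: "(\<Union>m::nat. obox_Pi n (\<lambda>_. - real m) (\<lambda>_. real m)) = space (leb_Pi {..<n})"
proof (intro equalityI subsetI)
  fix x :: "nat \<Rightarrow> real" assume x: "x \<in> space (leb_Pi {..<n})"
  obtain m where m: "(\<Sum>j<n. \<bar>x j\<bar>) < real m" using reals_Archimedean2 by blast
  have "\<bar>x j\<bar> < real m" if "j < n" for j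
  proof -
    have "\<bar>x j\<bar> \<le> (\<Sum>j<n. \<bar>x j\<bar>)" using that by (intro member_le_sum) auto
    with m show ?thesis by simp
  qed
  then have "x \<in> obox_Pi n (\<lambda>_. - real m) (\<lambda>_. real m)"
    using x by (auto simp: obox_Pi_def space_leb_Pi PiE_iff abs_less_iff) (metis minus_less_iff)
  then show "x \<in> (\<Union>m::nat. obox_Pi n (\<lambda>_. - real m) (\<lambda>_. real m))" by blast
qed (auto simp: obox_Pi_def space_leb_Pi PiE_iff)

lemma sets_leb_Pi_eq_sigma:
  "sets (leb_Pi {..<n}) = sigma_sets (space (leb_Pi {..<n})) (range (\<lambda>(a, b). obox_Pi n a b))"
  (is "_ = sigma_sets ?\<Omega> ?E")
proof
  have sub: "?E \<subseteq> sets (leb_Pi {..<n})" by auto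
  show "sigma_sets ?\<Omega> ?E \<subseteq> sets (leb_Pi {..<n})"
    by (rule sets.sigma_sets_subset) (use sub in auto)
  let ?S = "sigma ?\<Omega> ?E"
  have pow: "?E \<subseteq> Pow ?\<Omega>" by (auto simp: obox_Pi_def space_leb_Pi PiE_iff)
  have spS: "space ?S = ?\<Omega>" by (rule space_measure_of[OF pow])
  have obox: "obox_Pi n a b \<in> sets ?S" for a b
    using pow by (subst sets_measure_of) auto
  have "(\<lambda>x. x i) \<in> borel_measurable ?S" if i: "i < n" for i
  proof (rule borel_measurableI_less)
    fix y :: real
    \<comment> \<open>A half space is the union of the boxes of half-width m cut at y in coordinate
      i.\<close>
    have "{x \<in> space ?S. x i < y} = (\<Union>m::nat. obox_Pi n (\<lambda>_. - real m) ((\<lambda>_. real m)(i := min y (real m))))"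
    proof (intro set_eqI iffI)
      fix x assume "x \<in> {x \<in> space ?S. x i < y}"
      then have x: "x \<in> ?\<Omega>" "x i < y" by (auto simp: spS)
      then obtain m where "x \<in> obox_Pi n (\<lambda>_. - real m) (\<lambda>_. real m)" using obox_Pi_exhaust by blast
      then have "x \<in> obox_Pi n (\<lambda>_. - real m) ((\<lambda>_. real m)(i := min y (real m)))"
        using x by (auto simp: obox_Pi_def PiE_iff)
      then show "x \<in> (\<Union>m::nat. obox_Pi n (\<lambda>_. - real m) ((\<lambda>_. real m)(i := min y (real m))))" by blast
    next
      fix x assume "x \<in> (\<Union>m::nat. obox_Pi n (\<lambda>_. - real m) ((\<lambda>_. real m)(i := min y (real m))))"
      then obtain m where m: "x \<in> obox_Pi n (\<lambda>_. - real m) ((\<lambda>_. real m)(i := min y (real m)))" by blast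
      have "x i < min y (real m)"       proof -
        have "x i \<in> {- real m<..<((\<lambda>_. real m)(i := min y (real m))) i}"
          using m i unfolding obox_Pi_def by (elim PiE_mem) simp
        then show ?thesis by simp
      qed
      moreover have "x \<in> ?\<Omega>" using m by (auto simp: obox_Pi_def PiE_iff space_leb_Pi)
      ultimately show "x \<in> {x \<in> space ?S. x i < y}" by (simp add: spS)
    qed
    also have "\<dots> \<in> sets ?S" by (intro sets.countable_UN) (use obox in auto)
    finally show "{x \<in> space ?S. x i < y} \<in> sets ?S" .
  qed
  then have m: "{x \<in> space ?S. x i \<in> A} \<in> sets ?S" if "i \<in> {..<n}" "A \<in> sets lborel" for i A
    using that measurable_sets[of "\<lambda>x. x i" ?S borel A] by (simp add: vimage_def Int_def conj_commute)
  have "sets (leb_Pi {..<n}) \<subseteq> sets ?S"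
    by (rule sets_PiM_in_sets[OF _ m]) (simp only: spS, simp only: space_PiM)
  also have "sets ?S = sigma_sets ?\<Omega> ?E" using pow by (rule sets_measure_of)
  finally show "sets (leb_Pi {..<n}) \<subseteq> sigma_sets ?\<Omega> ?E" .
qed

text \<open>The positive and the negative part of \<open>f\<close> are densities of finite measures
  that agree on boxes. Boxes form a generator stable under intersection, so the measures coincide
  and with them the densities almost everywhere.\<close>

lemma AE_eq_0_if_obox_integrals:
  assumes f: "integrable (leb_Pi {..<n}) f"
    and 0: "\<And>a b. (LINT x|leb_Pi {..<n}. f x * indicator (obox_Pi n a b) x) = (0::real)"
  shows "AE x in leb_Pi {..<n}. f x = 0"
proof -
  let ?P = "leb_Pi {..<n}"
  have [measurable]: "f \<in> borel_measurable ?P" using f by auto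
  define p where "p x = max (f x) 0" for x
  define q where "q x = max (- f x) 0" for x
  have pm [measurable]: "p \<in> borel_measurable ?P" "q \<in> borel_measurable ?P" by (auto simp: p_def[abs_def] q_def[abs_def])
  have int: "integrable ?P p" "integrable ?P q"
    using f unfolding p_def[abs_def] q_def[abs_def] by auto
  have nn: "0 \<le> p x" "0 \<le> q x" "f x = p x - q x" for x by (auto simp: p_def q_def)
  have box: "emeasure (density ?P (\<lambda>x. ennreal (p x))) (obox_Pi n a b) = emeasure (density ?P (\<lambda>x. ennreal (q x))) (obox_Pi n a b)" for a b
  proof -
    have i: "integrable ?P (\<lambda>x. p x * indicator (obox_Pi n a b) x)" "integrable ?P (\<lambda>x. q x * indicator (obox_Pi n a b) x)"
      by (intro integrable_real_mult_indicator int obox_Pi_sets)+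
    have "(LINT x|?P. p x * indicator (obox_Pi n a b) x) - (LINT x|?P. q x * indicator (obox_Pi n a b) x) =
       (LINT x|?P. p x * indicator (obox_Pi n a b) x - q x * indicator (obox_Pi n a b) x)"
      using i by (rule Bochner_Integration.integral_diff[symmetric])
    also have "\<dots> = 0" using 0[of a b] by (simp add: nn(3) left_diff_distrib)
    finally have eq: "(LINT x|?P. p x * indicator (obox_Pi n a b) x) = (LINT x|?P. q x * indicator (obox_Pi n a b) x)" by simp
    have e: "emeasure (density ?P (\<lambda>x. ennreal (g x))) (obox_Pi n a b) = ennreal (LINT x|?P. g x * indicator (obox_Pi n a b) x)"
      if "integrable ?P (\<lambda>x. g x * indicator (obox_Pi n a b) x)" "\<And>x. 0 \<le> g x" and [measurable]: "g \<in> borel_measurable ?P" for g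
    proof -
      have "emeasure (density ?P (\<lambda>x. ennreal (g x))) (obox_Pi n a b) = (\<integral>\<^sup>+x. ennreal (g x * indicator (obox_Pi n a b) x) \<partial>?P)"
        by (subst emeasure_density) (auto intro!: nn_integral_cong split: split_indicator)
      also have "\<dots> = ennreal (LINT x|?P. g x * indicator (obox_Pi n a b) x)"
        using that by (intro nn_integral_eq_integral) auto
      finally show ?thesis .
    qed
    show ?thesis using e[OF i(1) nn(1) pm(1)] e[OF i(2) nn(2) pm(2)] eq by simp
  qed
  have "density ?P (\<lambda>x. ennreal (p x)) = density ?P (\<lambda>x. ennreal (q x))"
  proof (rule measure_eqI_generator_eq[where E="(range (\<lambda>(a, b). obox_Pi n a b))" and A="\<lambda>m. obox_Pi n (\<lambda>_. - real m) (\<lambda>_. real m)"])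
    show "Int_stable (range (\<lambda>(a, b). obox_Pi n a b))"
      unfolding Int_stable_def using obox_Pi_Int by (auto simp del: Int_iff)
    show "(range (\<lambda>(a, b). obox_Pi n a b)) \<subseteq> Pow (space ?P)" by (auto simp: obox_Pi_def space_leb_Pi PiE_iff)
    show "emeasure (density ?P (\<lambda>x. ennreal (p x))) X = emeasure (density ?P (\<lambda>x. ennreal (q x))) X"
      if "X \<in> (range (\<lambda>(a, b). obox_Pi n a b))" for X using that box by auto
    show "sets (density ?P (\<lambda>x. ennreal (p x))) = sigma_sets (space ?P) (range (\<lambda>(a, b). obox_Pi n a b))"
      "sets (density ?P (\<lambda>x. ennreal (q x))) = sigma_sets (space ?P) (range (\<lambda>(a, b). obox_Pi n a b))"
      using sets_leb_Pi_eq_sigma by auto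
    show "(\<Union>m. obox_Pi n (\<lambda>_. - real m) (\<lambda>_. real m)) = space ?P" by (rule obox_Pi_exhaust)
    show "emeasure (density ?P (\<lambda>x. ennreal (p x))) (obox_Pi n (\<lambda>_. - real m) (\<lambda>_. real m)) \<noteq> \<infinity>" for m
    proof -
      have "emeasure (density ?P (\<lambda>x. ennreal (p x))) (obox_Pi n (\<lambda>_. - real m) (\<lambda>_. real m)) \<le> (\<integral>\<^sup>+x. ennreal (p x) \<partial>?P)"
        by (subst emeasure_density) (auto intro!: nn_integral_mono split: split_indicator)
      also have "\<dots> < \<infinity>" using int(1) nn(1) by (simp add: nn_integral_eq_integral)
      finally show ?thesis by simp
    qed
  qed auto
  then have "AE x in ?P. ennreal (p x) = ennreal (q x)"
    using int(1) nn(1) by (subst (asm) finite_density_unique) (auto simp: nn_integral_eq_integral)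
  then show ?thesis by eventually_elim (use nn in auto)
qed

section \<open>Bumps on boxes and the vanishing criterion by test functions\<close>

definition bump_box :: "nat \<Rightarrow> nat \<Rightarrow> (nat \<Rightarrow> real) \<Rightarrow> (nat \<Rightarrow> real) \<Rightarrow> (nat \<Rightarrow> real) \<Rightarrow> real" where
  "bump_box n m a b = prod_fun n (\<lambda>j. bump m (a j) (b j))"

lemma bump_box_measurable [measurable]: "bump_box n m a b \<in> borel_measurable (leb_Pi {..<n})"
  unfolding bump_box_def prod_fun_def[abs_def]
  by (intro borel_measurable_prod, rule measurable_compose[OF measurable_component_singleton]) auto

lemma bump_box_bounds: "0 \<le> bump_box n m a b x" "bump_box n m a b x \<le> 1"
proof -
  show "0 \<le> bump_box n m a b x" unfolding bump_box_def prod_fun_def by (intro prod_nonneg bump_nonneg)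
  show "bump_box n m a b x \<le> 1" unfolding bump_box_def prod_fun_def by (intro prod_le_1 conjI bump_nonneg bump_le_1)
qed

lemma bump_box_eq_0:
  assumes "x \<in> space (leb_Pi {..<n})" "x \<notin> obox_Pi n a b" shows "bump_box n m a b x = 0"
proof -
  obtain j where "j < n" "x j \<notin> {a j<..<b j}" using assms by (auto simp: obox_Pi_def space_leb_Pi PiE_iff)
  then show ?thesis unfolding bump_box_def prod_fun_def using bump_eq_0 by (intro prod_zero bexI[of _ j]) auto
qed

lemma bump_box_tendsto:
  assumes "x \<in> space (leb_Pi {..<n})"
  shows "(\<lambda>m. bump_box n m a b x) \<longlonglongrightarrow> indicator (obox_Pi n a b) x"
proof -
  have "(\<lambda>m. bump_box n m a b x) \<longlonglongrightarrow> (\<Prod>j<n. indicator {a j<..<b j} (x j))"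
    unfolding bump_box_def prod_fun_def by (intro tendsto_prod bump_tendsto)
  also have "(\<Prod>j<n. indicator {a j<..<b j} (x j)) = (indicator (obox_Pi n a b) x :: real)"
  proof (cases "x \<in> obox_Pi n a b")
    case True
    then show ?thesis by (auto simp: obox_Pi_def PiE_iff intro!: prod.neutral)
  next
    case False
    then obtain j where "j < n" "x j \<notin> {a j<..<b j}" using assms by (auto simp: obox_Pi_def space_leb_Pi PiE_iff)
    then have "(\<Prod>j<n. indicator {a j<..<b j} (x j)) = (0::real)" by (intro prod_zero bexI[of _ j]) auto
    then show ?thesis using False by simp
  qed
  finally show ?thesis .
qed

lemma obox_integral_eq_0:
  assumes f: "integrable (leb_Pi {..<n}) f"
    and 0: "\<And>m. (LINT x|leb_Pi {..<n}. f x * bump_box n m a b x) = (0::real)"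
  shows "(LINT x|leb_Pi {..<n}. f x * indicator (obox_Pi n a b) x) = 0"
proof -
  have "(\<lambda>m. LINT x|leb_Pi {..<n}. f x * bump_box n m a b x) \<longlonglongrightarrow> (LINT x|leb_Pi {..<n}. f x * indicator (obox_Pi n a b) x)"
  proof (rule integral_dominated_convergence[where w="\<lambda>x. \<bar>f x\<bar>"])
    have [measurable]: "f \<in> borel_measurable (leb_Pi {..<n})" using f by auto
    show "(\<lambda>x. f x * indicator (obox_Pi n a b) x) \<in> borel_measurable (leb_Pi {..<n})"
      "(\<lambda>x. f x * bump_box n m a b x) \<in> borel_measurable (leb_Pi {..<n})" for m by measurable
    show "AE x in leb_Pi {..<n}. (\<lambda>m. f x * bump_box n m a b x) \<longlonglongrightarrow> f x * indicator (obox_Pi n a b) x"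
      by (intro AE_I2 tendsto_mult tendsto_const bump_box_tendsto)
    show "AE x in leb_Pi {..<n}. norm (f x * bump_box n m a b x) \<le> \<bar>f x\<bar>" for m
      using bump_box_bounds[of n m a b] by (intro AE_I2) (auto simp: abs_mult intro: mult_left_le)
  qed (use f in auto)
  then show ?thesis using 0 by (simp add: LIMSEQ_unique)
qed

text \<open>Rational corners give countability. The closed boxes are required to lie in
  \<open>U\<close> so that a bump on the open box is a test function on \<open>U\<close>.\<close>

lemma openin_Rn_top_eq_UN:
  assumes "openin (Rn_top n) U"
  obtains C where "countable C" "\<And>a b. (a, b) \<in> C \<Longrightarrow> cbox_Pi n a b \<subseteq> U" "U = (\<Union>(a,b)\<in>C. obox_Pi n a b)"
proof
  define R where "R = PiE {..<n} (\<lambda>_. \<rat> :: real set)"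
  define C where "C = {(a, b) \<in> R \<times> R. cbox_Pi n a b \<subseteq> U}"
  have "countable R" unfolding R_def by (intro countable_PiE countable_rat finite_lessThan)
  then have "countable (R \<times> R)" by simp
  moreover have "C \<subseteq> R \<times> R" unfolding C_def by blast
  ultimately show "countable C" by (rule countable_subset[rotated])
  show "cbox_Pi n a b \<subseteq> U" if "(a, b) \<in> C" for a b using that by (auto simp: C_def)
  show "U = (\<Union>(a,b)\<in>C. obox_Pi n a b)"
  proof (intro equalityI subsetI)
    fix x assume "x \<in> (\<Union>(a,b)\<in>C. obox_Pi n a b)"
    then show "x \<in> U" using obox_Pi_subset by (fastforce simp: C_def)
  next
    fix x assume x: "x \<in> U"
    then obtain V where "\<forall>i\<in>{..<n}. openin euclideanreal (V i)" and xV: "x \<in> PiE {..<n} V" "PiE {..<n} V \<subseteq> U"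
      using assms unfolding Rn_top_def openin_product_topology_alt by blast
    then have V: "\<forall>i\<in>{..<n}. open (V i)" "x \<in> PiE {..<n} V" "PiE {..<n} V \<subseteq> U" by simp_all
    have "\<exists>a b. a \<in> \<rat> \<and> b \<in> \<rat> \<and> a < x i \<and> x i < b \<and> {a..b} \<subseteq> V i" if i: "i < n" for i
    proof -
      have "x i \<in> V i" "open (V i)" using V i by auto
      then obtain e where e: "0 < e" "ball (x i) e \<subseteq> V i" using open_contains_ball by blast
      obtain a where "a \<in> \<rat>" "x i - e < a" "a < x i" using Rats_dense_in_real[of "x i - e" "x i"] e by auto
      moreover obtain b where "b \<in> \<rat>" "x i < b" "b < x i + e" using Rats_dense_in_real[of "x i" "x i + e"] e by auto
      moreover have "{a..b} \<subseteq> ball (x i) e" using calculation by (auto simp: dist_real_def)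
      ultimately show ?thesis using e by blast
    qed
    then obtain a b where ab: "\<And>i. i < n \<Longrightarrow> a i \<in> \<rat> \<and> b i \<in> \<rat> \<and> a i < x i \<and> x i < b i \<and> {a i..b i} \<subseteq> V i"
      by metis
    let ?a = "restrict a {..<n}" and ?b = "restrict b {..<n}"
    have "cbox_Pi n ?a ?b \<subseteq> PiE {..<n} V"
      unfolding cbox_Pi_def using ab by (intro PiE_mono) auto
    then have "(?a, ?b) \<in> C" using ab V by (auto simp: C_def R_def)
    moreover have "x \<in> obox_Pi n ?a ?b" using ab V(2) by (auto simp: obox_Pi_def PiE_iff)
    ultimately show "x \<in> (\<Union>(a,b)\<in>C. obox_Pi n a b)" by blast
  qed
qed

lemma openin_Rn_top_sets: "openin (Rn_top n) U \<Longrightarrow> U \<in> sets (leb_Pi {..<n})"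
proof -
  assume "openin (Rn_top n) U"
  then obtain C where C: "countable C" "U = (\<Union>(a,b)\<in>C. obox_Pi n a b)"
    by (rule openin_Rn_top_eq_UN)
  show ?thesis unfolding C(2) by (intro sets.countable_UN' C(1)) (auto simp: obox_Pi_sets)
qed

lemma space_Rn_leb: "space (Rn_leb n) = PiE {..<n} (\<lambda>_. UNIV)"
  by (simp add: Rn_leb_def space_leb_Pi)

lemma Rn_leb_sets: "A \<in> sets (leb_Pi {..<n}) \<Longrightarrow> A \<in> sets (Rn_leb n)"
  by (simp add: Rn_leb_def)

lemma AE_Rn_leb_iff: "(AE x in Rn_leb n. P x) \<longleftrightarrow> (AE x in leb_Pi {..<n}. P x)"
  unfolding Rn_leb_def by (rule AE_completion_iff)

lemma Rn_leb_borel_version: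
  fixes h :: "(nat \<Rightarrow> real) \<Rightarrow> real"
  assumes "integrable (Rn_leb n) h"
  obtains h' where "integrable (leb_Pi {..<n}) h'" "AE x in Rn_leb n. h x = h' x"
proof -
  obtain h' where h': "h' \<in> borel_measurable (leb_Pi {..<n})" "AE x in leb_Pi {..<n}. h x = h' x"
    using completion_ex_borel_measurable_real[OF borel_measurable_integrable[OF assms[unfolded Rn_leb_def]]] by blast
  have ae: "AE x in Rn_leb n. h x = h' x" using h'(2) by (simp add: AE_Rn_leb_iff)
  have "integrable (Rn_leb n) h'"
  proof (rule integrable_cong_AE_imp[OF assms _ ae])
    show "h' \<in> borel_measurable (Rn_leb n)" unfolding Rn_leb_def by (rule measurable_completion[OF h'(1)])
  qed
  then have "integrable (leb_Pi {..<n}) h'" unfolding Rn_leb_def integrable_completion[OF h'(1)] .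
  then show ?thesis using ae by (rule that)
qed

lemma integral_Rn_leb:
  fixes h :: "(nat \<Rightarrow> real) \<Rightarrow> real"
  shows "h \<in> borel_measurable (leb_Pi {..<n}) \<Longrightarrow> integral\<^sup>L (Rn_leb n) h = integral\<^sup>L (leb_Pi {..<n}) h"
  by (simp add: Rn_leb_def integral_completion)

lemma loc_integrable_obox:
  assumes "loc_integrable n U g" "cbox_Pi n a b \<subseteq> U"
  shows "integrable (Rn_leb n) (\<lambda>x. g x * indicator (obox_Pi n a b) x)"
proof -
  have "set_integrable (Rn_leb n) (cbox_Pi n a b) g"
    using assms compactin_cbox_Pi by (auto simp: loc_integrable_def)
  then have "set_integrable (Rn_leb n) (obox_Pi n a b) g"
    by (rule set_integrable_subset) (simp_all only: Rn_leb_sets obox_Pi_sets obox_Pi_subset)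
  then show ?thesis by (simp add: set_integrable_def mult.commute)
qed

lemma test_function_bump_box:
  assumes "cbox_Pi n a b \<subseteq> U" shows "test_function n U (bump_box n m a b)"
  unfolding bump_box_def
  by (rule test_function_prod_fun[OF _ _ assms]) (auto intro: smooth1_bump bump_eq_0)

text \<open>Local integrability only gives integrability over boxes with closure in
  \<open>U\<close>. On each of countably many such boxes the cut-off function is handled by
  \<open>AE_eq_0_if_obox_integrals\<close>, with bumps in place of indicators.\<close>

lemma AE_eq_0_if_test_integrals:
  assumes U: "openin (Rn_top n) U" and g: "loc_integrable n U g"
    and 0: "\<And>\<phi>. test_function n U \<phi> \<Longrightarrow> (LINT x:U|Rn_leb n. g x * \<phi> x) = 0"
  shows "AE x in Rn_leb n. x \<in> U \<longrightarrow> g x = 0"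
proof -
  obtain C where C: "countable C" "\<And>a b. (a, b) \<in> C \<Longrightarrow> cbox_Pi n a b \<subseteq> U" "U = (\<Union>(a,b)\<in>C. obox_Pi n a b)"
    by (rule openin_Rn_top_eq_UN[OF U]) blast
  have "AE x in Rn_leb n. x \<in> obox_Pi n a0 b0 \<longrightarrow> g x = 0" if ab: "(a0, b0) \<in> C" for a0 b0
  proof -
    let ?h = "\<lambda>x. g x * indicator (obox_Pi n a0 b0) x"
    have h: "integrable (Rn_leb n) ?h" by (rule loc_integrable_obox[OF g C(2)[OF ab]])
    obtain h' where h': "integrable (leb_Pi {..<n}) h'" "AE x in Rn_leb n. ?h x = h' x"
      by (rule Rn_leb_borel_version[OF h])
    have [measurable]: "h' \<in> borel_measurable (leb_Pi {..<n})" using h'(1) by auto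
    have hm: "?h \<in> borel_measurable (Rn_leb n)" using h by auto
    have eq: "(LINT x|leb_Pi {..<n}. h' x * k x) = (LINT x|Rn_leb n. ?h x * k x)"
      if [measurable]: "k \<in> borel_measurable (leb_Pi {..<n})" for k
    proof -
      have km: "k \<in> borel_measurable (Rn_leb n)" "h' \<in> borel_measurable (Rn_leb n)"
        by (auto simp: Rn_leb_def intro: measurable_completion)
      have "(LINT x|leb_Pi {..<n}. h' x * k x) = (LINT x|Rn_leb n. h' x * k x)"
        by (rule integral_Rn_leb[symmetric]) measurable
      also have "\<dots> = (LINT x|Rn_leb n. ?h x * k x)"
      proof (rule integral_cong_AE)
        show "AE x in Rn_leb n. h' x * k x = ?h x * k x" using h'(2) by eventually_elim simp
      qed (intro borel_measurable_times km hm)+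
      finally show ?thesis .
    qed
    have "AE x in leb_Pi {..<n}. h' x = 0"
    proof (rule AE_eq_0_if_obox_integrals[OF h'(1)])
      fix a b
      \<comment> \<open>The given box is first intersected with the one on which \<open>g\<close>
        was cut off, so that the bumps are supported in \<open>U\<close>.\<close>
      let ?a = "\<lambda>j. max (a j) (a0 j)" and ?b = "\<lambda>j. min (b j) (b0 j)"
      have sub: "cbox_Pi n ?a ?b \<subseteq> U" using cbox_Pi_mono[of a0 ?a ?b b0 n] C(2)[OF ab] by auto
      have osub: "obox_Pi n ?a ?b \<subseteq> obox_Pi n a0 b0" using obox_Pi_Int[of n a b a0 b0] by auto
      have "(LINT x|leb_Pi {..<n}. h' x * indicator (obox_Pi n a b) x) = (LINT x|Rn_leb n. ?h x * indicator (obox_Pi n a b) x)"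
        by (rule eq) measurable
      also have "\<dots> = (LINT x|Rn_leb n. ?h x * indicator (obox_Pi n ?a ?b) x)"
        unfolding obox_Pi_Int[symmetric] by (intro Bochner_Integration.integral_cong refl) (auto simp: indicator_def)
      also have "\<dots> = (LINT x|leb_Pi {..<n}. h' x * indicator (obox_Pi n ?a ?b) x)"
        by (rule eq[symmetric]) measurable
      also have "\<dots> = 0"
      proof (rule obox_integral_eq_0[OF h'(1)])
        fix m
        have "(LINT x|leb_Pi {..<n}. h' x * bump_box n m ?a ?b x) = (LINT x|Rn_leb n. ?h x * bump_box n m ?a ?b x)"
          by (rule eq) measurable
        also have "\<dots> = (LINT x:U|Rn_leb n. g x * bump_box n m ?a ?b x)"
          unfolding set_lebesgue_integral_def
        proof (intro Bochner_Integration.integral_cong refl)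
          fix x assume "x \<in> space (Rn_leb n)"
          then have x: "x \<in> space (leb_Pi {..<n})" by (simp add: space_Rn_leb space_leb_Pi)
          show "?h x * bump_box n m ?a ?b x = indicat_real U x *\<^sub>R (g x * bump_box n m ?a ?b x)"
          proof (cases "x \<in> obox_Pi n ?a ?b")
            case True
            then have "x \<in> obox_Pi n a0 b0" "x \<in> U" using osub sub obox_Pi_subset[of n ?a ?b] by blast+
            then show ?thesis by simp
          next
            case False
            then show ?thesis using bump_box_eq_0[OF x False] by simp
          qed
        qed
        also have "\<dots> = 0" by (intro 0 test_function_bump_box sub)
        finally show "(LINT x|leb_Pi {..<n}. h' x * bump_box n m ?a ?b x) = 0" .
      qed
      finally show "(LINT x|leb_Pi {..<n}. h' x * indicator (obox_Pi n a b) x) = 0" .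
    qed
    then have "AE x in Rn_leb n. h' x = 0" by (simp add: AE_Rn_leb_iff)
    with h'(2) show ?thesis by eventually_elim auto
  qed
  then have "AE x in Rn_leb n. \<forall>(a, b)\<in>C. x \<in> obox_Pi n a b \<longrightarrow> g x = 0"
    by (subst AE_ball_countable[OF C(1)]) auto
  then show ?thesis by eventually_elim (use C(3) in auto)
qed

section \<open>Absolutely continuous functions of one variable\<close>

text \<open>The primitive of \<open>g\<close> that vanishes at plus infinity. Along lines this is
  the right normalisation for functions of bounded support.\<close>

definition tail_int :: "(real \<Rightarrow> real) \<Rightarrow> real \<Rightarrow> real" where
  "tail_int g t = - (LINT s|lborel. g s * indicator {t..} s)"

lemma tail_int_diff:
  assumes "integrable lborel g" "p \<le> q"
  shows "tail_int g q - tail_int g p = (LINT s|lborel. g s * indicator {p..<q} s)"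
proof -
  have i: "integrable lborel (\<lambda>s. g s * indicator A s)" if "A \<in> sets borel" for A
    using assms that by (intro integrable_real_mult_indicator) auto
  have "tail_int g q - tail_int g p = (LINT s|lborel. g s * indicator {p..} s) - (LINT s|lborel. g s * indicator {q..} s)"
    by (simp add: tail_int_def)
  also have "\<dots> = (LINT s|lborel. g s * indicator {p..} s - g s * indicator {q..} s)"
    by (intro Bochner_Integration.integral_diff[symmetric] i) auto
  also have "\<dots> = (LINT s|lborel. g s * indicator {p..<q} s)"
    using assms(2) by (intro Bochner_Integration.integral_cong refl) (auto simp: indicator_def)
  finally show ?thesis .
qed

lemma tail_int_continuous:
  assumes "integrable lborel g" shows "continuous_on A (tail_int g)"
proof (rule continuous_at_imp_continuous_on, rule ballI, rule continuous_at_sequentiallyI)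
  fix t u assume u: "u \<longlonglongrightarrow> (t::real)"
  have [measurable]: "g \<in> borel_measurable borel" using assms by auto
  have "(\<lambda>m. LINT s|lborel. g s * indicator {u m..} s) \<longlonglongrightarrow> (LINT s|lborel. g s * indicator {t..} s)"
  proof (rule integral_dominated_convergence[where w="\<lambda>s. \<bar>g s\<bar>"])
    have "AE s in lborel. s \<noteq> t" by (rule AE_lborel_singleton)
    then show "AE s in lborel. (\<lambda>m. g s * indicator {u m..} s) \<longlonglongrightarrow> g s * indicator {t..} s"
    proof eventually_elim
      case (elim s)
      have "eventually (\<lambda>m. indicator {u m..} s = (indicator {t..} s :: real)) sequentially"
      proof (cases "t < s")
        case True
        then have "eventually (\<lambda>m. u m < s) sequentially" by (rule order_tendstoD(2)[OF u])
        then show ?thesis by eventually_elim (use True in auto)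
      next
        case False
        then have "s < t" using elim by simp
        then have "eventually (\<lambda>m. s < u m) sequentially" by (rule order_tendstoD(1)[OF u])
        then show ?thesis by eventually_elim (use \<open>s < t\<close> in auto)
      qed
      then show ?case by (intro tendsto_mult tendsto_const tendsto_eventually)
    qed
    show "integrable lborel (\<lambda>s. \<bar>g s\<bar>)" using assms by auto
  qed (auto split: split_indicator)
  then show "(\<lambda>m. tail_int g (u m)) \<longlonglongrightarrow> tail_int g t"
    unfolding tail_int_def by (rule tendsto_minus)
qed

text \<open>Minkowski's inequality by duality: the squared length of the vector of integrals is the
  integral of its scalar product with the vector function, which Cauchy-Schwarz bounds pointwise;
  then one factor is cancelled.\<close>

lemma L2_set_integral_le:
  fixes f :: "'i \<Rightarrow> 'a \<Rightarrow> real"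
  assumes "finite S" "\<And>l. l \<in> S \<Longrightarrow> integrable N (f l)"
  shows "integrable N (\<lambda>x. L2_set (\<lambda>l. f l x) S)"
    "L2_set (\<lambda>l. \<integral>x. f l x \<partial>N) S \<le> (\<integral>x. L2_set (\<lambda>l. f l x) S \<partial>N)"
proof -
  have [measurable]: "f l \<in> borel_measurable N" if "l \<in> S" for l using assms(2)[OF that] by auto
  have le: "L2_set (\<lambda>l. f l x) S \<le> (\<Sum>l\<in>S. \<bar>f l x\<bar>)" for x
    by (rule L2_set_le_sum_abs)
  show int: "integrable N (\<lambda>x. L2_set (\<lambda>l. f l x) S)"
  proof (rule Bochner_Integration.integrable_bound[where f="\<lambda>x. \<Sum>l\<in>S. \<bar>f l x\<bar>"])
    show "integrable N (\<lambda>x. \<Sum>l\<in>S. \<bar>f l x\<bar>)" using assms by auto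
    show "(\<lambda>x. L2_set (\<lambda>l. f l x) S) \<in> borel_measurable N" unfolding L2_set_def by measurable
    show "AE x in N. norm (L2_set (\<lambda>l. f l x) S) \<le> norm (\<Sum>l\<in>S. \<bar>f l x\<bar>)"
      using le by (intro AE_I2) (simp add: sum_nonneg)
  qed
  let ?c = "\<lambda>l. \<integral>x. f l x \<partial>N"
  have "L2_set ?c S * L2_set ?c S = (\<Sum>l\<in>S. ?c l * ?c l)"
    by (simp add: L2_set_def sum_nonneg flip: power2_eq_square)
  also have "\<dots> = (\<integral>x. (\<Sum>l\<in>S. ?c l * f l x) \<partial>N)"
    using assms by (subst Bochner_Integration.integral_sum) auto
  also have "\<dots> \<le> (\<integral>x. L2_set ?c S * L2_set (\<lambda>l. f l x) S \<partial>N)"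
  proof (rule integral_mono)
    show "(\<Sum>l\<in>S. ?c l * f l x) \<le> L2_set ?c S * L2_set (\<lambda>l. f l x) S" for x
    proof -
      have "(\<Sum>l\<in>S. ?c l * f l x) \<le> (\<Sum>l\<in>S. \<bar>?c l\<bar> * \<bar>f l x\<bar>)"
        by (intro sum_mono) (metis abs_ge_self abs_mult)
      also have "\<dots> \<le> L2_set ?c S * L2_set (\<lambda>l. f l x) S" by (rule L2_set_mult_ineq)
      finally show ?thesis .
    qed
  qed (use assms int in auto)
  also have "\<dots> = L2_set ?c S * (\<integral>x. L2_set (\<lambda>l. f l x) S \<partial>N)" by simp
  finally have *: "L2_set ?c S * L2_set ?c S \<le> L2_set ?c S * (\<integral>x. L2_set (\<lambda>l. f l x) S \<partial>N)" .
  show "L2_set ?c S \<le> (\<integral>x. L2_set (\<lambda>l. f l x) S \<partial>N)"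
  proof (cases "L2_set ?c S = 0")
    case True
    then show ?thesis by (simp add: Bochner_Integration.integral_nonneg)
  next
    case False
    then have "0 < L2_set ?c S" using L2_set_nonneg[of ?c S] by (simp only: order_less_le) simp
    then show ?thesis using * by simp
  qed
qed

text \<open>The curve crosses the shell between the radii \<open>a\<close> and \<open>b\<close>, so no chain rule for
  truncations is needed.\<close>

lemma crossing_le:
  fixes G :: "'i \<Rightarrow> real \<Rightarrow> real"
  assumes S: "finite S" and G: "\<And>l. l \<in> S \<Longrightarrow> integrable lborel (G l)"
    and ab: "0 \<le> a" "a < b" and t: "t0 \<le> t1"
    and t0: "b \<le> L2_set (\<lambda>l. tail_int (G l) t0) S"
    and t1: "\<And>l. l \<in> S \<Longrightarrow> tail_int (G l) t1 = 0"
  shows "ennreal (b - a) \<le> (\<integral>\<^sup>+t. ennreal (L2_set (\<lambda>l. G l t) S) *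
    indicator {t. a < L2_set (\<lambda>l. tail_int (G l) t) S \<and> L2_set (\<lambda>l. tail_int (G l) t) S < b} t \<partial>lborel)"
proof -
  let ?V = "\<lambda>t. L2_set (\<lambda>l. tail_int (G l) t) S"
  have [measurable]: "G l \<in> borel_measurable borel" if "l \<in> S" for l using G[OF that] by auto
  have cont: "continuous_on A ?V" for A
    unfolding L2_set_def by (intro continuous_intros tail_int_continuous G)
  have V1: "?V t1 = 0" using t1 by (simp add: L2_set_def)
  \<comment> \<open>q will be the last time at which the length is at least b, and p the first time
    after q at which it is at most a. Strictly between them the curve stays in the shell, and its
    displacement is at least b - a.\<close>
  define Q where "Q = {t\<in>{t0..t1}. b \<le> ?V t}"
  have "compact Q"
  proof -
    have "closed ({t0..t1} \<inter> ?V -` {b..})" by (intro continuous_closed_preimage cont) auto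
    moreover have "Q = {t0..t1} \<inter> ?V -` {b..}" by (auto simp: Q_def)
    ultimately show ?thesis
      using compact_Int_closed[OF compact_Icc[of t0 t1]] by (metis Int_left_absorb)
  qed
  moreover have "t0 \<in> Q" using t t0 by (auto simp: Q_def)
  ultimately obtain q where q: "q \<in> Q" "\<And>t. t \<in> Q \<Longrightarrow> t \<le> q" using compact_attains_sup[of Q] by auto
  then have q': "t0 \<le> q" "q \<le> t1" "b \<le> ?V q" by (auto simp: Q_def)
  define P where "P = {t\<in>{q..t1}. ?V t \<le> a}"
  have "compact P"
  proof -
    have "closed ({q..t1} \<inter> ?V -` {..a})" by (intro continuous_closed_preimage cont) auto
    moreover have "P = {q..t1} \<inter> ?V -` {..a}" by (auto simp: P_def)
    ultimately show ?thesis
      using compact_Int_closed[OF compact_Icc[of q t1]] by (metis Int_left_absorb)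
  qed
  moreover have "t1 \<in> P" using q' V1 ab by (auto simp: P_def)
  ultimately obtain p where p: "p \<in> P" "\<And>t. t \<in> P \<Longrightarrow> p \<le> t" using compact_attains_inf[of P] by auto
  then have p': "q \<le> p" "p \<le> t1" "?V p \<le> a" by (auto simp: P_def)
  have between: "a < ?V t \<and> ?V t < b" if "q < t" "t < p" for t
  proof -
    have "t \<notin> Q" using q(2)[of t] that by auto
    moreover have "t \<notin> P" using p(2)[of t] that by auto
    ultimately show ?thesis using that q' p' by (auto simp: Q_def P_def)
  qed
  have int: "integrable lborel (\<lambda>s. G l s * indicator {q..<p} s)" if "l \<in> S" for l
    using G[OF that] by (intro integrable_real_mult_indicator) auto
  have L2i: "L2_set (\<lambda>l. G l s * indicator {q..<p} s) S = L2_set (\<lambda>l. G l s) S * indicator {q..<p} s" for s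
    by (cases "s \<in> {q..<p}") (auto simp: L2_set_def)
  have "?V q \<le> L2_set (\<lambda>l. tail_int (G l) p + - (tail_int (G l) p - tail_int (G l) q)) S" by simp
  also have "\<dots> \<le> ?V p + L2_set (\<lambda>l. - (tail_int (G l) p - tail_int (G l) q)) S" by (rule L2_set_triangle_ineq)
  also have "L2_set (\<lambda>l. - (tail_int (G l) p - tail_int (G l) q)) S = L2_set (\<lambda>l. tail_int (G l) p - tail_int (G l) q) S"
    by (simp add: L2_set_def power2_commute)
  also have "\<dots> = L2_set (\<lambda>l. LINT s|lborel. G l s * indicator {q..<p} s) S"
    using G p' by (intro L2_set_cong refl tail_int_diff) auto
  also have "\<dots> \<le> (LINT s|lborel. L2_set (\<lambda>l. G l s * indicator {q..<p} s) S)"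
    by (rule L2_set_integral_le(2)[OF S int])
  finally have "b - a \<le> (LINT s|lborel. L2_set (\<lambda>l. G l s * indicator {q..<p} s) S)"
    using q' p' by simp
  then have "ennreal (b - a) \<le> ennreal (LINT s|lborel. L2_set (\<lambda>l. G l s * indicator {q..<p} s) S)"
    by (rule ennreal_leI)
  also have "\<dots> = (\<integral>\<^sup>+s. ennreal (L2_set (\<lambda>l. G l s * indicator {q..<p} s) S) \<partial>lborel)"
    by (intro nn_integral_eq_integral[symmetric] L2_set_integral_le(1)[OF S int]) auto
  also have "\<dots> \<le> (\<integral>\<^sup>+s. ennreal (L2_set (\<lambda>l. G l s) S) * indicator {t. a < ?V t \<and> ?V t < b} s \<partial>lborel)"
  proof (rule nn_integral_mono_AE)
    have "AE s in lborel. s \<noteq> q" by (rule AE_lborel_singleton)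
    then show "AE s in lborel. ennreal (L2_set (\<lambda>l. G l s * indicator {q..<p} s) S)
      \<le> ennreal (L2_set (\<lambda>l. G l s) S) * indicator {t. a < ?V t \<and> ?V t < b} s"
      unfolding L2i by eventually_elim (use between in \<open>auto split: split_indicator\<close>)
  qed
  finally show ?thesis .
qed

text \<open>An absolutely continuous function has zero derivative almost everywhere on its zero set:
  the zero set is approximated from outside by finite unions of intervals with endpoints in it,
  over each of which the derivative integrates to zero.\<close>

lemma integral_zero_set_tail_int:
  assumes g: "integrable lborel g" and pq: "p < q"
  shows "(LINT t|lborel. g t * indicator ({p..<q} \<inter> {t. tail_int g t = 0}) t) = 0"
proof -
  have [measurable]: "g \<in> borel_measurable borel" using g by auto
  define Z where "Z = {t. tail_int g t = 0}"
  have Zc: "closed Z"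
  proof -
    have "closed (tail_int g -` {0})" by (intro closed_vimage tail_int_continuous g) auto
    then show ?thesis by (simp add: Z_def vimage_def)
  qed
  define x where "x m i = p + (q - p) * real i / real (Suc m)" for m i :: nat
  define J where "J m i = {x m i..x m (Suc i)} \<inter> Z" for m i
  \<comment> \<open>First and last zero in a closed cell of the partition; between them
    \<open>g\<close> integrates to the difference of two zero values of \<open>tail_int g\<close>.
    The value 0 for a cell without zeros is a placeholder, as \<open>I\<close> is then
    empty.\<close>
  define \<alpha> where "\<alpha> m i = (if J m i = {} then 0 else Inf (J m i))" for m i
  define \<beta> where "\<beta> m i = (if J m i = {} then 0 else Sup (J m i))" for m i
  have step: "x m (Suc i) - x m i = (q - p) / real (Suc m)" for m i
    by (simp add: x_def diff_divide_distrib[symmetric] algebra_simps del: of_nat_Suc) (simp add: algebra_simps)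
  have xmono: "x m i \<le> x m j" if "i \<le> j" for m i j
    unfolding x_def using that pq by (intro add_left_mono divide_right_mono mult_left_mono) auto
  have Jc: "compact (J m i)" for m i unfolding J_def by (intro compact_Int_closed compact_Icc Zc)
  have \<alpha>: "\<alpha> m i \<in> J m i" "\<beta> m i \<in> J m i" if "J m i \<noteq> {}" for m i
    using that Jc[of m i] closed_contains_Inf[of "J m i"] closed_contains_Sup[of "J m i"]
    by (auto simp: \<alpha>_def \<beta>_def compact_eq_bounded_closed bounded_imp_bdd_below bounded_imp_bdd_above)
  have bnd: "\<alpha> m i \<le> t" "t \<le> \<beta> m i" if "t \<in> J m i" for m i t
    using that Jc[of m i]
    by (auto simp: \<alpha>_def \<beta>_def compact_eq_bounded_closed bounded_imp_bdd_below bounded_imp_bdd_above intro!: cInf_lower cSup_upper)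
  define I where "I m i = (if J m i = {} then {} else {\<alpha> m i..<\<beta> m i})" for m i
  have Isub: "I m i \<subseteq> {x m i..<x m (Suc i)}" for m i
  proof (cases "J m i = {}")
    case False
    then have "x m i \<le> \<alpha> m i" "\<beta> m i \<le> x m (Suc i)" using \<alpha>[OF False] by (auto simp: J_def)
    then show ?thesis using False by (auto simp: I_def)
  qed (simp add: I_def)
  have Iint: "(LINT t|lborel. g t * indicator (I m i) t) = 0" for m i
  proof (cases "J m i = {}")
    case False
    have "tail_int g (\<alpha> m i) = 0" "tail_int g (\<beta> m i) = 0" using \<alpha>[OF False] by (auto simp: J_def Z_def)
    moreover have "\<alpha> m i \<le> \<beta> m i" using bnd \<alpha>[OF False] by blast
    ultimately show ?thesis using tail_int_diff[OF g, of "\<alpha> m i" "\<beta> m i"] False by (simp add: I_def)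
  qed (simp add: I_def)
  have disj: "I m i \<inter> I m j = {}" if "i \<noteq> j" for m i j
  proof -
    have *: "I m i \<inter> I m j = {}" if "i < j" for i j
      using Isub[of m i] Isub[of m j] xmono[of "Suc i" j m] that by fastforce
    show ?thesis using *[of i j] *[of j i] that by (cases "i < j") auto
  qed
  have [measurable]: "I m i \<in> sets borel" for m i by (simp add: I_def)
  define S where "S m = (\<Union>i<Suc m. I m i)" for m
  have indS: "(indicator (S m) t :: real) = (\<Sum>i<Suc m. indicator (I m i) t)" for m t
    unfolding S_def using disj by (intro indicator_UN_disjoint) (auto simp: disjoint_family_on_def)
  have Sint: "(LINT t|lborel. g t * indicator (S m) t) = 0" for m
  proof -
    have "(LINT t|lborel. g t * indicator (S m) t) = (LINT t|lborel. (\<Sum>i<Suc m. g t * indicator (I m i) t))"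
      by (simp only: indS sum_distrib_left)
    also have "\<dots> = (\<Sum>i<Suc m. LINT t|lborel. g t * indicator (I m i) t)"
      by (intro Bochner_Integration.integral_sum integrable_real_mult_indicator g) auto
    finally show ?thesis by (simp add: Iint)
  qed
  have Zm [measurable]: "Z \<in> sets borel" using Zc by simp
  have [measurable]: "S m \<in> sets borel" for m unfolding S_def by measurable
  have "(\<lambda>m. LINT t|lborel. g t * indicator (S m) t) \<longlonglongrightarrow> (LINT t|lborel. g t * indicator ({p..<q} \<inter> Z) t)"
  proof (rule integral_dominated_convergence[where w="\<lambda>s. \<bar>g s\<bar>"])
    \<comment> \<open>The half-open intervals lose the last zeros \<beta>, which are countably many
      and hence negligible.\<close>
    let ?N = "range (\<lambda>(m, i). \<beta> m i)"
    have "AE t in lborel. t \<notin> ?N"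
      by (rule AE_not_in[OF countable_imp_null_set_lborel]) auto
    then show "AE t in lborel. (\<lambda>m. g t * indicator (S m) t) \<longlonglongrightarrow> g t * indicator ({p..<q} \<inter> Z) t"
    proof eventually_elim
      case (elim t)
      have ind: "indicator (S m) t = (indicator ({p..<q} \<inter> Z) t :: real)" if "t \<in> {p..<q} \<longrightarrow> t \<in> Z" for m
      proof (cases "t \<in> {p..<q}")
        case True
        define i where "i = nat \<lfloor>(t - p) * real (Suc m) / (q - p)\<rfloor>"
        have z: "0 \<le> (t - p) * real (Suc m) / (q - p)" using True pq by simp
        have i1: "real i \<le> (t - p) * real (Suc m) / (q - p)" "(t - p) * real (Suc m) / (q - p) < real (Suc i)"
          using z unfolding i_def by linarith+
        have "x m i \<le> t" "t < x m (Suc i)"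
          using i1 pq by (simp_all add: x_def field_simps del: of_nat_Suc)
        have "(t - p) * real (Suc m) / (q - p) < real (Suc m)"
          using True pq by (simp add: field_simps del: of_nat_Suc)
        then have "i < Suc m" using i1 by linarith
        have "t \<in> J m i" using True that \<open>x m i \<le> t\<close> \<open>t < x m (Suc i)\<close> by (auto simp: J_def)
        moreover have "t \<noteq> \<beta> m i" using elim by auto
        ultimately have "t \<in> I m i" using bnd[of t m i] by (auto simp: I_def order_less_le)
        then have "t \<in> S m" using \<open>i < Suc m\<close> by (auto simp: S_def)
        then show ?thesis using True that by simp
      next
        case False
        have "S m \<subseteq> {p..<q}"
        proof -
          have "I m i \<subseteq> {p..<q}" if "i < Suc m" for i
          proof -
            have "x m 0 \<le> x m i" "x m (Suc i) \<le> x m (Suc m)" using that by (auto intro: xmono)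
            moreover have "x m 0 = p" "x m (Suc m) = q" by (simp_all add: x_def del: of_nat_Suc)
            ultimately show ?thesis using Isub[of m i] by fastforce
          qed
          then show ?thesis by (auto simp: S_def)
        qed
        then have "t \<notin> S m" using False by blast
        then show ?thesis using False by (simp only: indicator_def Int_iff) simp
      qed
      show ?case
      proof (cases "t \<in> {p..<q} \<longrightarrow> t \<in> Z")
        case True
        then show ?thesis using ind by simp
      next
        case False
        then have "t \<in> - Z" by simp
        moreover have "open (- Z)" using Zc by auto
        \<comment> \<open>Away from the closed zero set, an interval covering t would have its left
          endpoint, a zero, within one cell width of t; this is impossible once the width is below
          e.\<close>
        ultimately obtain e where e: "0 < e" "ball t e \<subseteq> - Z" using open_contains_ball by blast
        have "eventually (\<lambda>m. (q - p) * inverse (real (Suc m)) < e) sequentially"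
        proof (rule order_tendstoD(2)[OF _ e(1)])
          have "(\<lambda>m. (q - p) * inverse (real (Suc m))) \<longlonglongrightarrow> (q - p) * 0"
            by (intro tendsto_mult tendsto_const LIMSEQ_inverse_real_of_nat)
          then show "(\<lambda>m. (q - p) * inverse (real (Suc m))) \<longlonglongrightarrow> 0" by simp
        qed
        then have "eventually (\<lambda>m. g t * indicator (S m) t = g t * indicator ({p..<q} \<inter> Z) t) sequentially"
        proof eventually_elim
          case (elim m)
          have "t \<notin> S m"
          proof
            assume "t \<in> S m"
            then obtain i where i: "t \<in> I m i" by (auto simp: S_def)
            then have ne: "J m i \<noteq> {}" "\<alpha> m i \<le> t" by (auto simp: I_def split: if_splits)
            have "t < x m (Suc i)" "x m i \<le> \<alpha> m i" using i Isub[of m i] \<alpha>[OF ne(1)] by (auto simp: J_def)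
            then have "t - \<alpha> m i < (q - p) * inverse (real (Suc m))"
              using step[of m i] by (simp add: divide_inverse del: of_nat_Suc)
            then have "\<alpha> m i \<in> ball t e" using elim ne by (simp add: dist_real_def del: of_nat_Suc)
            then show False using e \<alpha>[OF ne(1)] by (auto simp: J_def)
          qed
          then show ?case using \<open>t \<in> - Z\<close> by simp
        qed
        then show ?thesis by (rule tendsto_eventually)
      qed
    qed
    show "integrable lborel (\<lambda>s. \<bar>g s\<bar>)" using g by auto
  qed (auto split: split_indicator)
  then show ?thesis by (simp add: Sint LIMSEQ_const_iff Z_def)
qed

text \<open>Integration by parts without derivatives: exchanging the integrals over s \<ge> t turns
  the tail of \<open>g\<close> into the primitive of the bump.\<close>

lemma tail_int_bump_Fubini:
  assumes g: "integrable lborel g"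
  shows "(LINT t|lborel. tail_int g t * bump m a b t) = - (LINT s|lborel. g s * bump_primitive m a b s)"
proof -
  have [measurable]: "g \<in> borel_measurable borel" using g by auto
  let ?h = "\<lambda>(t, s). g s * indicator {t..} s * bump m a b t"
  have hm [measurable]: "?h \<in> borel_measurable (lborel \<Otimes>\<^sub>M lborel)"
  proof -
    have "?h = (\<lambda>z. g (snd z) * indicator {z. fst z \<le> snd z} z * bump m a b (fst z))"
      by (auto simp: fun_eq_iff indicator_def)
    then show ?thesis by simp
  qed
  have int: "integrable (lborel \<Otimes>\<^sub>M lborel) ?h"
  proof (rule Bochner_Integration.integrable_bound[OF _ hm])
    show "integrable (lborel \<Otimes>\<^sub>M lborel) (\<lambda>(t, s). bump m a b t * g s)"
    proof (rule lborel_pair.Fubini_integrable)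
      show "integrable lborel (\<lambda>t. LINT s|lborel. norm (case (t, s) of (t, s) \<Rightarrow> bump m a b t * g s))"
        using integrable_bump[of m a b] by (simp add: abs_mult)
      show "AE t in lborel. integrable lborel (\<lambda>s. case (t, s) of (t, s) \<Rightarrow> bump m a b t * g s)"
        using g by simp
    qed measurable
    show "AE z in lborel \<Otimes>\<^sub>M lborel. norm (?h z) \<le> norm (case z of (t, s) \<Rightarrow> bump m a b t * g s)"
      by (intro AE_I2) (auto simp: indicator_def abs_mult)
  qed
  have "(LINT t|lborel. tail_int g t * bump m a b t) = (LINT t|lborel. - (LINT s|lborel. ?h (t, s)))"
    by (simp add: tail_int_def)
  also have "\<dots> = - (LINT t|lborel. LINT s|lborel. ?h (t, s))" by simp
  also have "(LINT t|lborel. LINT s|lborel. ?h (t, s)) = (LINT s|lborel. LINT t|lborel. ?h (t, s))"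
    using lborel_pair.Fubini_integral[OF int] by simp
  also have "\<dots> = (LINT s|lborel. g s * bump_primitive m a b s)"
  proof (intro Bochner_Integration.integral_cong refl)
    fix s
    have "(LINT t|lborel. ?h (t, s)) = (LINT t|lborel. g s * (bump m a b t * indicator {..s} t))"
      by (intro Bochner_Integration.integral_cong refl) (auto simp: indicator_def)
    then show "(LINT t|lborel. ?h (t, s)) = g s * bump_primitive m a b s" by (simp add: bump_primitive_def)
  qed
  finally show ?thesis .
qed

section \<open>Weak derivatives on lines\<close>

context
  fixes n i :: nat
  assumes i: "i < n"
begin

lemma insert_remove_coordinate: "insert i ({..<n} - {i}) = {..<n}"
  "insert i {..<n} = {..<n}"
  using i by auto

text \<open>Two versions of a line: the base point either lacks coordinate \<open>i\<close>, as in
  Fubini, or is a full point whose coordinate \<open>i\<close> is overwritten, as when a line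
  integral is regarded as a function on the whole space.\<close>

lemma measurable_line_pair [measurable]:
  "(\<lambda>z. (fst z)(i := snd z)) \<in> measurable (leb_Pi ({..<n} - {i}) \<Otimes>\<^sub>M lborel) (leb_Pi {..<n})"
  "(\<lambda>z. (fst z)(i := snd z)) \<in> measurable (leb_Pi {..<n} \<Otimes>\<^sub>M lborel) (leb_Pi {..<n})"
  by (rule measurable_fun_upd[where J="{..<n} - {i}"], use i in auto)
     (rule measurable_fun_upd[where J="{..<n}"], use i in auto)

lemma measurable_line [measurable]:
  "x \<in> space (leb_Pi ({..<n} - {i})) \<Longrightarrow> (\<lambda>t. x(i := t)) \<in> measurable lborel (leb_Pi {..<n})"
  "x \<in> space (leb_Pi {..<n}) \<Longrightarrow> (\<lambda>t. x(i := t)) \<in> measurable lborel (leb_Pi {..<n})"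
proof -
  assume "x \<in> space (leb_Pi ({..<n} - {i}))"
  then show "(\<lambda>t. x(i := t)) \<in> measurable lborel (leb_Pi {..<n})"
    using measurable_component_update[of x "{..<n} - {i}" "\<lambda>_. lborel" i] by (simp add: insert_remove_coordinate)
next
  assume "x \<in> space (leb_Pi {..<n})"
  then have "(\<lambda>t. (x, t)) \<in> measurable lborel (leb_Pi {..<n} \<Otimes>\<^sub>M lborel)"
    by (rule measurable_Pair1')
  from measurable_compose[OF this measurable_line_pair(2)]
  show "(\<lambda>t. x(i := t)) \<in> measurable lborel (leb_Pi {..<n})" unfolding fst_conv snd_conv .
qed

lemma space_line: "x \<in> space (leb_Pi ({..<n} - {i})) \<Longrightarrow> x(i := t) \<in> space (leb_Pi {..<n})"
  "x \<in> space (leb_Pi {..<n}) \<Longrightarrow> x(i := t) \<in> space (leb_Pi {..<n})"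
  using i by (auto simp: space_leb_Pi PiE_iff extensional_def)

lemma nn_integral_line:
  assumes "f \<in> borel_measurable (leb_Pi {..<n})"
  shows "(\<integral>\<^sup>+x. f x \<partial>leb_Pi {..<n}) = (\<integral>\<^sup>+x. \<integral>\<^sup>+t. f (x(i := t)) \<partial>lborel \<partial>leb_Pi ({..<n} - {i}))"
  using lebP.product_nn_integral_insert[of "{..<n} - {i}" i f] assms by (simp add: insert_remove_coordinate)

lemma integral_line:
  fixes f :: "(nat \<Rightarrow> real) \<Rightarrow> real"
  assumes "integrable (leb_Pi {..<n}) f"
  shows "(LINT x|leb_Pi {..<n}. f x) = (LINT x|leb_Pi ({..<n} - {i}). LINT t|lborel. f (x(i := t)))"
  using lebP.product_integral_insert[of "{..<n} - {i}" i f] assms by (simp add: insert_remove_coordinate)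

lemma AE_line:
  assumes "AE x in leb_Pi {..<n}. P x"
  shows "AE x in leb_Pi ({..<n} - {i}). AE t in lborel. P (x(i := t))"
proof -
  obtain N where N: "{x \<in> space (leb_Pi {..<n}). \<not> P x} \<subseteq> N" "emeasure (leb_Pi {..<n}) N = 0" "N \<in> sets (leb_Pi {..<n})"
    using assms by (rule AE_E)
  note [measurable] = N(3)
  have "(\<integral>\<^sup>+x. \<integral>\<^sup>+t. indicator N (x(i := t)) \<partial>lborel \<partial>leb_Pi ({..<n} - {i})) = (\<integral>\<^sup>+x. indicator N x \<partial>leb_Pi {..<n})"
    by (rule nn_integral_line[symmetric]) measurable
  also have "\<dots> = 0" using N by simp
  finally have "AE x in leb_Pi ({..<n} - {i}). (\<integral>\<^sup>+t. indicator N (x(i := t)) \<partial>lborel) = (0::ennreal)"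
    by (subst (asm) nn_integral_0_iff_AE) (auto intro!: lborel.borel_measurable_nn_integral simp: split_beta')
  with AE_space show ?thesis
  proof eventually_elim
    fix x assume x: "x \<in> space (leb_Pi ({..<n} - {i}))" and 0: "(\<integral>\<^sup>+t. indicator N (x(i := t)) \<partial>lborel) = (0::ennreal)"
    have m: "(\<lambda>t. indicator N (x(i := t)) :: ennreal) \<in> borel_measurable lborel"
      by (rule measurable_compose[OF measurable_line(1)[OF x]]) measurable
    have "AE t in lborel. indicator N (x(i := t)) = (0::ennreal)"
      using 0 nn_integral_0_iff_AE[OF m] by simp
    then show "AE t in lborel. P (x(i := t))"
    proof eventually_elim
      case (elim t)
      then show ?case using N(1) space_line(1)[OF x, of t] by (auto simp: indicator_def split: if_splits)
    qed
  qed
qed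

lemma AE_line_converse:
  assumes "AE x in leb_Pi ({..<n} - {i}). AE t in lborel. P (x(i := t))"
    and [measurable]: "{x \<in> space (leb_Pi {..<n}). \<not> P x} \<in> sets (leb_Pi {..<n})" (is "?N \<in> _")
  shows "AE x in leb_Pi {..<n}. P x"
proof -
  have "emeasure (leb_Pi {..<n}) ?N = (\<integral>\<^sup>+x. indicator ?N x \<partial>leb_Pi {..<n})" by simp
  also have "\<dots> = (\<integral>\<^sup>+x. \<integral>\<^sup>+t. indicator ?N (x(i := t)) \<partial>lborel \<partial>leb_Pi ({..<n} - {i}))"
    by (rule nn_integral_line) measurable
  also have "\<dots> = (\<integral>\<^sup>+x. 0 \<partial>leb_Pi ({..<n} - {i}))"
  proof (rule nn_integral_cong_AE)
    show "AE x in leb_Pi ({..<n} - {i}). (\<integral>\<^sup>+t. indicator ?N (x(i := t)) \<partial>lborel) = (0::ennreal)"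
      using assms(1)
    proof eventually_elim
      case (elim x)
      have "(\<integral>\<^sup>+t. indicator ?N (x(i := t)) \<partial>lborel) = (\<integral>\<^sup>+t. 0 \<partial>(lborel :: real measure))"
      proof (rule nn_integral_cong_AE)
        show "AE t in lborel. indicator ?N (x(i := t)) = (0::ennreal)"
          using elim by eventually_elim simp
      qed
      then show ?case by simp
    qed
  qed
  finally have "?N \<in> null_sets (leb_Pi {..<n})" by (simp add: null_sets_def)
  then show ?thesis by (rule AE_I'[OF _ subset_refl])
qed

lemma integrable_line:
  fixes f :: "(nat \<Rightarrow> real) \<Rightarrow> real"
  assumes f: "integrable (leb_Pi {..<n}) f"
  shows "AE x in leb_Pi ({..<n} - {i}). integrable lborel (\<lambda>t. f (x(i := t)))"
proof -
  have [measurable]: "f \<in> borel_measurable (leb_Pi {..<n})" using f by auto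
  have "(\<integral>\<^sup>+x. \<integral>\<^sup>+t. ennreal (norm (f (x(i := t)))) \<partial>lborel \<partial>leb_Pi ({..<n} - {i})) = (\<integral>\<^sup>+x. ennreal (norm (f x)) \<partial>leb_Pi {..<n})"
    by (rule nn_integral_line[symmetric]) measurable
  also have "\<dots> < \<infinity>" using f by (simp add: integrable_iff_bounded)
  finally have "AE x in leb_Pi ({..<n} - {i}). (\<integral>\<^sup>+t. ennreal (norm (f (x(i := t)))) \<partial>lborel) \<noteq> \<infinity>"
    by (intro nn_integral_PInf_AE) (auto intro!: lborel.borel_measurable_nn_integral simp: split_beta')
  then show ?thesis
  proof (rule AE_mp, intro AE_I2 impI)
    fix x assume x: "x \<in> space (leb_Pi ({..<n} - {i}))" and fin: "(\<integral>\<^sup>+t. ennreal (norm (f (x(i := t)))) \<partial>lborel) \<noteq> \<infinity>"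
    have "(\<lambda>t. f (x(i := t))) \<in> borel_measurable lborel"
      by (rule measurable_compose[OF measurable_line(1)[OF x]]) measurable
    then show "integrable lborel (\<lambda>t. f (x(i := t)))" using fin by (intro integrableI_bounded) (auto simp: top.not_eq_extremum)
  qed
qed

section \<open>Primitives along coordinate lines\<close>

definition line_tail :: "((nat \<Rightarrow> real) \<Rightarrow> real) \<Rightarrow> (nat \<Rightarrow> real) \<Rightarrow> real" where
  "line_tail g x = tail_int (\<lambda>s. g (x(i := s))) (x i)"

lemma line_tail_upd: "line_tail g (x(i := t)) = tail_int (\<lambda>s. g (x(i := s))) t"
  by (simp add: line_tail_def)

lemma line_tail_measurable [measurable]:
  assumes [measurable]: "g \<in> borel_measurable (leb_Pi {..<n})"
  shows "line_tail g \<in> borel_measurable (leb_Pi {..<n})"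
proof -
  have [measurable]: "(\<lambda>x. x i) \<in> borel_measurable (leb_Pi {..<n})"
    using measurable_component_singleton[of i "{..<n}" "\<lambda>_. lborel"] i by simp
  have "(\<lambda>z. g ((fst z)(i := snd z)) * indicator {z. fst z i \<le> snd z} z) \<in> borel_measurable (leb_Pi {..<n} \<Otimes>\<^sub>M lborel)"
    by measurable
  also have "(\<lambda>z. g ((fst z)(i := snd z)) * indicator {z. fst z i \<le> snd z} z) = (\<lambda>(x, s). g (x(i := s)) * indicator {x i..} s)"
    by (auto simp: fun_eq_iff indicator_def)
  finally have "(\<lambda>x. LINT s|lborel. g (x(i := s)) * indicator {x i..} s) \<in> borel_measurable (leb_Pi {..<n})"
    by (rule lborel.borel_measurable_lebesgue_integral)
  from borel_measurable_uminus[OF this] show ?thesis unfolding line_tail_def[abs_def] tail_int_def .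
qed

text \<open>On a line the primitive is bounded by the integral of |g| over that line, a bound
  constant along the line. A box of half-width D makes it integrable at the cost of a factor
  2D.\<close>

lemma line_tail_integrable:
  assumes g: "integrable (leb_Pi {..<n}) g"
  shows "integrable (leb_Pi {..<n}) (\<lambda>x. line_tail g x * indicator (obox_Pi n (\<lambda>_. - D) (\<lambda>_. D)) x)"
proof (cases "0 < D")
  case False
  have "obox_Pi n (\<lambda>_. - D) (\<lambda>_. D) = {}"
    unfolding obox_Pi_def PiE_eq_empty_iff by (rule bexI[of _ i]) (use False i in auto)
  then show ?thesis by simp
next
  case True
  have [measurable]: "g \<in> borel_measurable (leb_Pi {..<n})" using g by auto
  let ?H = "\<lambda>x. \<integral>\<^sup>+s. ennreal \<bar>g (x(i := s))\<bar> \<partial>lborel"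
  have le: "ennreal \<bar>line_tail g x\<bar> \<le> ?H x" if x: "x \<in> space (leb_Pi {..<n})" for x
  proof (cases "integrable lborel (\<lambda>s. g (x(i := s)) * indicator {x i..} s)")
    case True
    have "ennreal \<bar>line_tail g x\<bar> = ennreal (norm (LINT s|lborel. g (x(i := s)) * indicator {x i..} s))"
      by (simp add: line_tail_def tail_int_def)
    also have "\<dots> \<le> (\<integral>\<^sup>+s. ennreal (norm (g (x(i := s)) * indicator {x i..} s)) \<partial>lborel)"
      by (rule integral_norm_bound_ennreal[OF True])
    also have "\<dots> \<le> ?H x" by (intro nn_integral_mono) (auto split: split_indicator)
    finally show ?thesis .
  qed (simp add: line_tail_def tail_int_def not_integrable_integral_eq)
  have [measurable]: "(\<lambda>x. x i) \<in> borel_measurable (leb_Pi {..<n})"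
    using measurable_component_singleton[of i "{..<n}" "\<lambda>_. lborel"] i by simp
  have Hm [measurable]: "?H \<in> borel_measurable (leb_Pi {..<n})" "?H \<in> borel_measurable (leb_Pi ({..<n} - {i}))"
    by (intro lborel.borel_measurable_nn_integral, simp add: split_beta')+
  have "(\<integral>\<^sup>+x. ennreal (norm (line_tail g x * indicator (obox_Pi n (\<lambda>_. - D) (\<lambda>_. D)) x)) \<partial>leb_Pi {..<n})
      \<le> (\<integral>\<^sup>+x. ?H x * indicator {-D<..<D} (x i) \<partial>leb_Pi {..<n})"
  proof (rule nn_integral_mono)
    fix x assume x: "x \<in> space (leb_Pi {..<n})"
    have "x i \<in> {-D<..<D}" if "x \<in> obox_Pi n (\<lambda>_. - D) (\<lambda>_. D)"
      using that i unfolding obox_Pi_def by (elim PiE_mem) simp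
    then show "ennreal (norm (line_tail g x * indicator (obox_Pi n (\<lambda>_. - D) (\<lambda>_. D)) x)) \<le> ?H x * indicator {-D<..<D} (x i)"
      using le[OF x] by (auto simp: indicator_def)
  qed
  also have "\<dots> = (\<integral>\<^sup>+x. \<integral>\<^sup>+t. ?H (x(i := t)) * indicator {-D<..<D} ((x(i := t)) i) \<partial>lborel \<partial>leb_Pi ({..<n} - {i}))"
    by (rule nn_integral_line) measurable
  also have "\<dots> = (\<integral>\<^sup>+x. ?H x * ennreal (2 * D) \<partial>leb_Pi ({..<n} - {i}))"
    using True by (intro nn_integral_cong) (simp add: nn_integral_cmult)
  also have "\<dots> = (\<integral>\<^sup>+x. ?H x \<partial>leb_Pi ({..<n} - {i})) * ennreal (2 * D)"
    by (rule nn_integral_multc) measurable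
  also have "(\<integral>\<^sup>+x. ?H x \<partial>leb_Pi ({..<n} - {i})) = (\<integral>\<^sup>+x. ennreal \<bar>g x\<bar> \<partial>leb_Pi {..<n})"
    by (rule nn_integral_line[symmetric]) measurable
  also have "(\<integral>\<^sup>+x. ennreal \<bar>g x\<bar> \<partial>leb_Pi {..<n}) * ennreal (2 * D) < \<infinity>"
    using g by (auto simp: integrable_iff_bounded ennreal_mult_less_top)
  finally show ?thesis by (intro integrableI_bounded) auto
qed

lemma bump_primitive_bounded: "\<bar>bump_primitive m a b t\<bar> \<le> (LINT s|lborel. bump m a b s)"
proof -
  have "\<bar>bump_primitive m a b t\<bar> \<le> (LINT s|lborel. \<bar>bump m a b s * indicator {..t} s\<bar>)"
    unfolding bump_primitive_def by (rule integral_abs_bound)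
  also have "\<dots> \<le> (LINT s|lborel. bump m a b s)"
    by (intro integral_mono integrable_abs integrable_real_mult_indicator integrable_bump)
      (auto simp: indicator_def bump_nonneg)
  finally show ?thesis .
qed

lemma bump_primitive_measurable [measurable]: "bump_primitive m a b \<in> borel_measurable borel"
  by (intro borel_measurable_continuous_onI continuous_at_imp_continuous_on ballI DERIV_isCont[OF DERIV_bump_primitive])

text \<open>Tested against a product of bumps, both sides become the same integral of
  \<open>g\<close> against the primitive of the bump in coordinate \<open>i\<close>: for
  \<open>w\<close> by the weak derivative, for \<open>line_tail g\<close> by Fubini on lines. Hence
  they agree on boxes.\<close>

lemma weak_derivative_line:
  assumes w: "integrable (leb_Pi {..<n}) w" and g: "integrable (leb_Pi {..<n}) g"
    and w0: "\<And>x. x \<in> space (leb_Pi {..<n}) \<Longrightarrow> x \<notin> cbox_Pi n (\<lambda>_. - B) (\<lambda>_. B) \<Longrightarrow> w x = 0"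
    and g0: "\<And>x. x \<in> space (leb_Pi {..<n}) \<Longrightarrow> x \<notin> cbox_Pi n (\<lambda>_. - B) (\<lambda>_. B) \<Longrightarrow> g x = 0"
    and weak: "\<And>\<phi>. test_function n (topspace (Rn_top n)) \<phi> \<Longrightarrow>
      (LINT x|leb_Pi {..<n}. w x * partial_deriv i \<phi> x) = - (LINT x|leb_Pi {..<n}. g x * \<phi> x)"
  shows "AE x in leb_Pi {..<n}. w x = line_tail g x"
proof -
  have [measurable]: "w \<in> borel_measurable (leb_Pi {..<n})" "g \<in> borel_measurable (leb_Pi {..<n})" using w g by auto
  have xi [measurable]: "(\<lambda>x. x j) \<in> borel_measurable (leb_Pi {..<n})" if "j < n" for j
    using measurable_component_singleton[of j "{..<n}" "\<lambda>_. lborel"] that by simp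
  have main: "AE x in leb_Pi {..<n}. x \<in> obox_Pi n (\<lambda>_. - D) (\<lambda>_. D) \<longrightarrow> w x = line_tail g x" if D: "B < D" "0 < D" for D
  proof -
    let ?Q = "obox_Pi n (\<lambda>_. - D) (\<lambda>_. D)"
    define f where "f x = (w x - line_tail g x) * indicator ?Q x" for x
    have wQ: "integrable (leb_Pi {..<n}) (\<lambda>x. w x * indicator ?Q x)"
      by (intro integrable_real_mult_indicator w) measurable
    have WQ: "integrable (leb_Pi {..<n}) (\<lambda>x. line_tail g x * indicator ?Q x)"
      by (rule line_tail_integrable[OF g])
    have f: "integrable (leb_Pi {..<n}) f"
      unfolding f_def left_diff_distrib by (intro Bochner_Integration.integrable_diff wQ WQ)
    have "AE x in leb_Pi {..<n}. f x = 0"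
    proof (rule AE_eq_0_if_obox_integrals[OF f])
      fix a b :: "nat \<Rightarrow> real"
      \<comment> \<open>\<open>f\<close> carries the indicator of the large box, so the test box may
        be clipped to it. Clipping yields -D \<le> \<open>a1 i\<close>, on which the translation by
        2D relies.\<close>
      define a1 where "a1 j = max (a j) (- D)" for j
      define b1 where "b1 j = min (b j) D" for j
      have Int: "obox_Pi n a b \<inter> ?Q = obox_Pi n a1 b1" unfolding a1_def b1_def by (rule obox_Pi_Int)
      have "(LINT x|leb_Pi {..<n}. f x * indicator (obox_Pi n a b) x) = (LINT x|leb_Pi {..<n}. f x * indicator (obox_Pi n a1 b1) x)"
        unfolding Int[symmetric] f_def by (intro Bochner_Integration.integral_cong refl) (auto simp: indicator_def)
      also have "\<dots> = 0"
      proof (rule obox_integral_eq_0[OF f])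
        fix m
        let ?b = "bump_box n m a1 b1"
        define c where "c x = (\<Prod>j\<in>{..<n} - {i}. bump m (a1 j) (b1 j) (x j))" for x :: "nat \<Rightarrow> real"
        have cupd: "c (x(i := t)) = c x" for x t unfolding c_def by (intro prod.cong) auto
        have c01: "0 \<le> c x" "c x \<le> 1" for x
          unfolding c_def by (intro prod_nonneg bump_nonneg, intro prod_le_1 conjI bump_nonneg bump_le_1)
        have cm [measurable]: "c \<in> borel_measurable (leb_Pi {..<n})"
          unfolding c_def[abs_def]
          by (intro borel_measurable_prod, rule measurable_compose[OF measurable_component_singleton]) auto
        define P where "P = bump_primitive m (a1 i) (b1 i)"
        have [measurable]: "P \<in> borel_measurable borel" by (simp add: P_def)
        have bb: "?b (x(i := t)) = c x * bump m (a1 i) (b1 i) t" for x t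
          unfolding bump_box_def prod_fun_upd[OF i] c_def by simp
        \<comment> \<open>In coordinate \<open>i\<close> the primitive of the bump is made compactly
          supported by \<open>bump_step\<close>. The shift 2D moves the compensating bump to the
          right of D > B, where \<open>w\<close> and \<open>g\<close> vanish, so that on their
          supports the test function equals the plain primitive.\<close>
        define r where "r = (\<lambda>j. bump m (a1 j) (b1 j))(i := bump_step m (a1 i) (b1 i) (2 * D))"
        have test: "test_function n (topspace (Rn_top n)) (prod_fun n r)"
        proof (rule test_function_prod_fun)
          show "smooth1 (r j)" for j by (simp add: r_def smooth1_bump smooth1_bump_step)
          show "r j t = 0" if "j < n" "t \<notin> {a1 j..(b1(i := b1 i + 2 * D)) j}" for j t
            using that D by (cases "j = i") (auto simp: r_def bump_eq_0 bump_step_eq_0)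
          show "cbox_Pi n a1 (b1(i := b1 i + 2 * D)) \<subseteq> topspace (Rn_top n)"
            by (auto simp: cbox_Pi_def topspace_Rn_top)
        qed
        have dr: "deriv (r i) t = bump m (a1 i) (b1 i) t - bump m (a1 i) (b1 i) (t - 2 * D)" for t
          unfolding r_def by (simp add: DERIV_imp_deriv[OF DERIV_bump_step])
        have inB: "x i \<le> B" if "x \<in> cbox_Pi n (\<lambda>_. - B) (\<lambda>_. B)" for x
          using that i by (auto simp: cbox_Pi_def PiE_iff)
        have a1: "- D \<le> a1 i" by (simp add: a1_def)
        have "(LINT x|leb_Pi {..<n}. w x * ?b x) = (LINT x|leb_Pi {..<n}. w x * partial_deriv i (prod_fun n r) x)"
        proof (intro Bochner_Integration.integral_cong refl)
          fix x assume x: "x \<in> space (leb_Pi {..<n})"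
          show "w x * ?b x = w x * partial_deriv i (prod_fun n r) x"
          proof (cases "x \<in> cbox_Pi n (\<lambda>_. - B) (\<lambda>_. B)")
            case True
            have "partial_deriv i (prod_fun n r) x = prod_fun n (r(i := deriv (r i))) (x(i := x i))"
              by (subst partial_deriv_prod_fun[OF i]) (simp_all add: r_def smooth1_bump_step)
            also have "\<dots> = deriv (r i) (x i) * c x"
              unfolding prod_fun_upd[OF i] c_def by (auto simp: r_def intro!: prod.cong)
            also have "deriv (r i) (x i) = bump m (a1 i) (b1 i) (x i)"
              unfolding dr using inB[OF True] a1 D by (simp add: bump_eq_0)
            also have "\<dots> * c x = ?b (x(i := x i))" unfolding bb by simp
            finally show ?thesis by simp
          qed (simp add: w0[OF x])
        qed
        also have "\<dots> = - (LINT x|leb_Pi {..<n}. g x * prod_fun n r x)" by (rule weak[OF test])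
        also have "(LINT x|leb_Pi {..<n}. g x * prod_fun n r x) = (LINT x|leb_Pi {..<n}. g x * (c x * P (x i)))"
        proof (intro Bochner_Integration.integral_cong refl)
          fix x assume x: "x \<in> space (leb_Pi {..<n})"
          show "g x * prod_fun n r x = g x * (c x * P (x i))"
          proof (cases "x \<in> cbox_Pi n (\<lambda>_. - B) (\<lambda>_. B)")
            case True
            have "prod_fun n r x = prod_fun n r (x(i := x i))" by simp
            also have "\<dots> = r i (x i) * c x"
              unfolding prod_fun_upd[OF i] c_def by (auto simp: r_def intro!: prod.cong)
            also have "r i (x i) = P (x i)"
              unfolding r_def P_def using inB[OF True] a1 D by (simp add: bump_step_eq)
            finally show ?thesis by simp
          qed (simp add: g0[OF x])
        qed
        finally have eq1: "(LINT x|leb_Pi {..<n}. w x * ?b x) = - (LINT x|leb_Pi {..<n}. g x * (c x * P (x i)))" .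
        have gi: "integrable (leb_Pi {..<n}) (\<lambda>x. g x * (c x * P (x i)))"
        proof (rule Bochner_Integration.integrable_bound[where f="\<lambda>x. (LINT s|lborel. bump m (a1 i) (b1 i) s) * g x"])
          show "(\<lambda>x. g x * (c x * P (x i))) \<in> borel_measurable (leb_Pi {..<n})" using xi[OF i] by measurable
          show "AE x in leb_Pi {..<n}. norm (g x * (c x * P (x i))) \<le> norm ((LINT s|lborel. bump m (a1 i) (b1 i) s) * g x)"
          proof (intro AE_I2)
            fix x
            have "\<bar>c x\<bar> * \<bar>P (x i)\<bar> \<le> 1 * (LINT s|lborel. bump m (a1 i) (b1 i) s)"
              using c01[of x] by (intro mult_mono) (auto simp: P_def bump_primitive_bounded)
            then show "norm (g x * (c x * P (x i))) \<le> norm ((LINT s|lborel. bump m (a1 i) (b1 i) s) * g x)"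
              by (simp add: abs_mult mult.commute[of "\<bar>g x\<bar>"] mult_right_mono Bochner_Integration.integral_nonneg bump_nonneg)
          qed
        qed (use g in auto)
        have Wb: "integrable (leb_Pi {..<n}) (\<lambda>x. line_tail g x * ?b x)"
        proof (rule Bochner_Integration.integrable_bound[OF WQ])
          show "AE x in leb_Pi {..<n}. norm (line_tail g x * ?b x) \<le> norm (line_tail g x * indicator ?Q x)"
          proof (intro AE_I2)
            fix x assume x: "x \<in> space (leb_Pi {..<n})"
            show "norm (line_tail g x * ?b x) \<le> norm (line_tail g x * indicator ?Q x)"
            proof (cases "x \<in> obox_Pi n a1 b1")
              case True
              then have "x \<in> ?Q" using Int by blast
              then show ?thesis using bump_box_bounds[of n m a1 b1 x] by (simp add: abs_mult mult_left_le)
            qed (simp add: bump_box_eq_0[OF x])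
          qed
        qed measurable
        have k1m: "(\<lambda>x. LINT t|lborel. h (x(i := t))) \<in> borel_measurable (leb_Pi ({..<n} - {i}))"
          if [measurable]: "h \<in> borel_measurable (leb_Pi {..<n})" for h :: "(nat \<Rightarrow> real) \<Rightarrow> real"
          by (intro lborel.borel_measurable_lebesgue_integral) (simp add: split_beta')
        have "(LINT x|leb_Pi {..<n}. line_tail g x * ?b x) = (LINT x|leb_Pi ({..<n} - {i}). LINT t|lborel. line_tail g (x(i := t)) * ?b (x(i := t)))"
          by (rule integral_line[OF Wb])
        also have "\<dots> = (LINT x|leb_Pi ({..<n} - {i}). - (LINT t|lborel. g (x(i := t)) * (c (x(i := t)) * P ((x(i := t)) i))))"
        proof (rule integral_cong_AE)
          show "AE x in leb_Pi ({..<n} - {i}). (LINT t|lborel. line_tail g (x(i := t)) * ?b (x(i := t))) =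
             - (LINT t|lborel. g (x(i := t)) * (c (x(i := t)) * P ((x(i := t)) i)))"
            using integrable_line[OF g]
          proof eventually_elim
            case (elim x)
            have "(LINT t|lborel. line_tail g (x(i := t)) * ?b (x(i := t))) =
               (LINT t|lborel. c x * (tail_int (\<lambda>s. g (x(i := s))) t * bump m (a1 i) (b1 i) t))"
              unfolding line_tail_upd bb by (simp add: mult.left_commute)
            also have "\<dots> = c x * - (LINT s|lborel. g (x(i := s)) * P s)"
              unfolding P_def by (simp add: tail_int_bump_Fubini[OF elim])
            also have "\<dots> = - (LINT t|lborel. c x * (g (x(i := t)) * P t))" by simp
            also have "(\<lambda>t. c x * (g (x(i := t)) * P t)) = (\<lambda>t. g (x(i := t)) * (c (x(i := t)) * P ((x(i := t)) i)))"
              by (simp add: cupd mult.left_commute)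
            finally show ?case .
          qed
        qed (intro borel_measurable_uminus k1m, use xi[OF i] in measurable)+
        also have "\<dots> = - (LINT x|leb_Pi {..<n}. g x * (c x * P (x i)))"
          unfolding integral_line[OF gi] by simp
        finally have eq2: "(LINT x|leb_Pi {..<n}. line_tail g x * ?b x) = - (LINT x|leb_Pi {..<n}. g x * (c x * P (x i)))" .
        have wb: "integrable (leb_Pi {..<n}) (\<lambda>x. w x * ?b x)"
          by (rule Bochner_Integration.integrable_bound[OF w]) (use bump_box_bounds[of n m a1 b1] in \<open>auto simp: abs_mult intro!: AE_I2 mult_left_le\<close>)
        have "(LINT x|leb_Pi {..<n}. f x * ?b x) = (LINT x|leb_Pi {..<n}. w x * ?b x - line_tail g x * ?b x)"
        proof (intro Bochner_Integration.integral_cong refl)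
          fix x assume x: "x \<in> space (leb_Pi {..<n})"
          show "f x * ?b x = w x * ?b x - line_tail g x * ?b x"
          proof (cases "x \<in> obox_Pi n a1 b1")
            case True
            then have "x \<in> ?Q" using Int by blast
            then show ?thesis by (simp add: f_def left_diff_distrib)
          qed (simp add: bump_box_eq_0[OF x])
        qed
        also have "\<dots> = 0" using eq1 eq2 wb Wb by simp
        finally show "(LINT x|leb_Pi {..<n}. f x * ?b x) = 0" .
      qed
      finally show "(LINT x|leb_Pi {..<n}. f x * indicator (obox_Pi n a b) x) = 0" .
    qed
    then show ?thesis by eventually_elim (auto simp: f_def)
  qed
  \<comment> \<open>The half-widths |B| + 1 + m satisfy both conditions on D, and the boxes exhaust
    the space.\<close>
  have "AE x in leb_Pi {..<n}. \<forall>m::nat. x \<in> obox_Pi n (\<lambda>_. - (\<bar>B\<bar> + 1 + real m)) (\<lambda>_. \<bar>B\<bar> + 1 + real m) \<longrightarrow> w x = line_tail g x"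
    by (subst AE_all_countable) (intro allI main, auto)
  then show ?thesis
  proof (rule AE_mp, intro AE_I2 impI)
    fix x assume x: "x \<in> space (leb_Pi {..<n})"
      and all: "\<forall>m::nat. x \<in> obox_Pi n (\<lambda>_. - (\<bar>B\<bar> + 1 + real m)) (\<lambda>_. \<bar>B\<bar> + 1 + real m) \<longrightarrow> w x = line_tail g x"
    obtain m where "x \<in> obox_Pi n (\<lambda>_. - real m) (\<lambda>_. real m)" using x obox_Pi_exhaust by blast
    then have "x \<in> obox_Pi n (\<lambda>_. - (\<bar>B\<bar> + 1 + real m)) (\<lambda>_. \<bar>B\<bar> + 1 + real m)"
      unfolding obox_Pi_def by (rule rev_subsetD) (intro PiE_mono, auto)
    then show "w x = line_tail g x" using all by blast
  qed
qed

text \<open>Fubini reduces the claim to lines, where \<open>integral_zero_set_tail_int\<close>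
  applies. It will show that derivatives of the zero extension vanish outside \<Omega>.\<close>

lemma weak_derivative_zero_set:
  assumes w: "integrable (leb_Pi {..<n}) w" and g: "integrable (leb_Pi {..<n}) g"
    and wg: "AE x in leb_Pi {..<n}. w x = line_tail g x"
  shows "AE x in leb_Pi {..<n}. w x = 0 \<longrightarrow> g x = 0"
proof -
  have [measurable]: "w \<in> borel_measurable (leb_Pi {..<n})" "g \<in> borel_measurable (leb_Pi {..<n})" using w g by auto
  have Z [measurable]: "{x \<in> space (leb_Pi {..<n}). w x = 0} \<in> sets (leb_Pi {..<n})" by measurable
  let ?Z = "{x \<in> space (leb_Pi {..<n}). w x = 0}"
  have gz: "integrable (leb_Pi {..<n}) (\<lambda>x. g x * indicator ?Z x)"
    by (intro integrable_real_mult_indicator g Z)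
  have "AE x in leb_Pi {..<n}. g x * indicator ?Z x = 0"
  proof (rule AE_eq_0_if_obox_integrals[OF gz])
    fix a b :: "nat \<Rightarrow> real"
    have "integrable (leb_Pi {..<n}) (\<lambda>x. g x * indicator ?Z x * indicator (obox_Pi n a b) x)"
      by (intro integrable_real_mult_indicator gz obox_Pi_sets)
    from integral_line[OF this]
    have "(LINT x|leb_Pi {..<n}. g x * indicator ?Z x * indicator (obox_Pi n a b) x) =
      (LINT x|leb_Pi ({..<n} - {i}). LINT t|lborel. g (x(i := t)) * indicator ?Z (x(i := t)) * indicator (obox_Pi n a b) (x(i := t)))" .
    also have "\<dots> = (LINT x|leb_Pi ({..<n} - {i}). 0)"
    proof (rule integral_cong_AE)
      show "AE x in leb_Pi ({..<n} - {i}). (LINT t|lborel. g (x(i := t)) * indicator ?Z (x(i := t)) * indicator (obox_Pi n a b) (x(i := t))) = 0"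
      proof (rule AE_mp[OF AE_line[OF wg]], rule AE_mp[OF integrable_line[OF g]], intro AE_I2 impI)
        fix x assume x: "x \<in> space (leb_Pi ({..<n} - {i}))" and gx: "integrable lborel (\<lambda>t. g (x(i := t)))"
          and eq: "AE t in lborel. w (x(i := t)) = line_tail g (x(i := t))"
        let ?g = "\<lambda>t. g (x(i := t))"
        show "(LINT t|lborel. g (x(i := t)) * indicator ?Z (x(i := t)) * indicator (obox_Pi n a b) (x(i := t))) = 0"
        \<comment> \<open>The line either meets the box in the whole open interval (a_i, b_i) or
          misses it.\<close>
        proof (cases "(\<forall>j\<in>{..<n} - {i}. x j \<in> {a j<..<b j}) \<and> a i < b i")
          case True
          have tm [measurable]: "tail_int ?g \<in> borel_measurable borel"
            by (rule borel_measurable_continuous_onI[OF tail_int_continuous[OF gx]])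
          have [measurable]: "?g \<in> borel_measurable borel" using gx by auto
          have lm: "(\<lambda>t. h (x(i := t))) \<in> borel_measurable lborel" if "h \<in> borel_measurable (leb_Pi {..<n})" for h :: "_ \<Rightarrow> real"
            by (rule measurable_compose[OF measurable_line(1)[OF x] that])
          have "(LINT t|lborel. g (x(i := t)) * indicator ?Z (x(i := t)) * indicator (obox_Pi n a b) (x(i := t))) =
             (LINT t|lborel. ?g t * indicator ({a i..<b i} \<inter> {t. tail_int ?g t = 0}) t)"
          proof (rule integral_cong_AE)
            show "(\<lambda>t. g (x(i := t)) * indicator ?Z (x(i := t)) * indicator (obox_Pi n a b) (x(i := t))) \<in> borel_measurable lborel"
              by (rule lm) measurable
            have "AE t in lborel. t \<noteq> a i" by (rule AE_lborel_singleton)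
            with eq show "AE t in lborel. g (x(i := t)) * indicator ?Z (x(i := t)) * indicator (obox_Pi n a b) (x(i := t))
               = ?g t * indicator ({a i..<b i} \<inter> {t. tail_int ?g t = 0}) t"
            proof eventually_elim
              case (elim t)
              have "x(i := t) \<in> obox_Pi n a b \<longleftrightarrow> t \<in> {a i<..<b i}"
                using True space_line(1)[OF x, of t] i by (auto simp: obox_Pi_def space_leb_Pi PiE_iff)
              then show ?case using elim space_line(1)[OF x, of t] by (auto simp: line_tail_upd indicator_def)
            qed
          qed measurable
          also have "\<dots> = 0" using True by (intro integral_zero_set_tail_int gx) auto
          finally show ?thesis .
        next
          case False
          have "x(i := t) \<notin> obox_Pi n a b" for t
          proof
            assume "x(i := t) \<in> obox_Pi n a b"
            then have *: "(x(i := t)) j \<in> {a j<..<b j}" if "j < n" for j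
              using that unfolding obox_Pi_def by (elim PiE_mem) simp
            have "x j \<in> {a j<..<b j}" if "j \<in> {..<n} - {i}" for j using *[of j] that by simp
            moreover have "a i < b i" using *[OF i] by simp
            ultimately show False using False by blast
          qed
          then show ?thesis by simp
        qed
      qed
    qed (intro lborel.borel_measurable_lebesgue_integral, simp_all add: split_beta')
    finally show "(LINT x|leb_Pi {..<n}. g x * indicator ?Z x * indicator (obox_Pi n a b) x) = 0" by simp
  qed
  then show ?thesis
  proof (rule AE_mp, intro AE_I2 impI)
    fix x assume "x \<in> space (leb_Pi {..<n})" "g x * indicator ?Z x = 0" "w x = 0"
    then show "g x = 0" by simp
  qed
qed

end

section \<open>The weak type inequality\<close>

lemma L2_set_measurable:
  "(\<And>l. l \<in> S \<Longrightarrow> f l \<in> borel_measurable N) \<Longrightarrow> (\<lambda>x. L2_set (\<lambda>l. f l x) S) \<in> borel_measurable N"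
  unfolding L2_set_def by measurable

text \<open>Cauchy-Schwarz over the directions: the partial derivatives in n directions add up to at
  most \<open>sqrt n\<close> times the length of the full gradient array.\<close>

lemma sum_L2_set_le:
  assumes "finite I" "finite S"
  shows "(\<Sum>i\<in>I. L2_set (c i) S) \<le> sqrt (card I) * L2_set (\<lambda>(i, l). c i l) (I \<times> S)"
proof -
  have "(\<Sum>i\<in>I. L2_set (c i) S) = (\<Sum>i\<in>I. \<bar>1\<bar> * \<bar>L2_set (c i) S\<bar>)" by simp
  also have "\<dots> \<le> L2_set (\<lambda>_. 1) I * L2_set (\<lambda>i. L2_set (c i) S) I" by (rule L2_set_mult_ineq)
  also have "L2_set (\<lambda>i. L2_set (c i) S) I = L2_set (\<lambda>(i, l). c i l) (I \<times> S)"
    by (simp add: L2_set_def sum_nonneg sum.cartesian_product case_prod_beta')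
  finally show ?thesis by (simp add: L2_set_def)
qed

lemma L2_set_pair_ge:
  assumes "finite I" "finite S" "i \<in> I"
  shows "L2_set (c i) S \<le> L2_set (\<lambda>(i, l). c i l) (I \<times> S)"
proof -
  have "(\<Sum>l\<in>S. (c i l)\<^sup>2) \<le> (\<Sum>i\<in>I. \<Sum>l\<in>S. (c i l)\<^sup>2)"
    using assms by (intro member_le_sum[of i I "\<lambda>i. \<Sum>l\<in>S. (c i l)\<^sup>2"]) (auto intro: sum_nonneg)
  then show ?thesis
    unfolding L2_set_def by (simp add: sum.cartesian_product case_prod_beta')
qed

text \<open>The factor $n^{-1/2}$ comes from the arithmetic-geometric mean inequality, which gives
  $1/n$, and the Cauchy-Schwarz inequality, which loses $\sqrt n$.\<close>

lemma weak_type_inequality: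
  fixes V :: "'l \<Rightarrow> (nat \<Rightarrow> real) \<Rightarrow> real"
  assumes n: "0 < n" and S: "finite S"
    and V: "\<And>l. l \<in> S \<Longrightarrow> V l \<in> borel_measurable (leb_Pi {..<n})"
    and G: "\<And>i l. i < n \<Longrightarrow> l \<in> S \<Longrightarrow> integrable (leb_Pi {..<n}) (G i l)"
    and G0: "\<And>i l x. i < n \<Longrightarrow> l \<in> S \<Longrightarrow> x \<in> space (leb_Pi {..<n}) \<Longrightarrow> x \<notin> cbox_Pi n (\<lambda>_. - B) (\<lambda>_. B) \<Longrightarrow> G i l x = 0"
    and VG: "\<And>i l. i < n \<Longrightarrow> l \<in> S \<Longrightarrow> AE x in leb_Pi {..<n}. V l x = line_tail i (G i l) x"
    and ab: "0 \<le> a" "a < b" and s: "0 < s"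
    and big: "ennreal s < emeasure (leb_Pi {..<n}) {x \<in> space (leb_Pi {..<n}). b < L2_set (\<lambda>l. V l x) S}"
  shows "ennreal ((b - a) * s powr (1 - 1 / n)) \<le> ennreal (1 / sqrt n) *
    (\<integral>\<^sup>+x. ennreal (L2_set (\<lambda>(i, l). G i l x) ({..<n} \<times> S)) *
      indicator {x. a < L2_set (\<lambda>l. V l x) S \<and> L2_set (\<lambda>l. V l x) S < b} x \<partial>leb_Pi {..<n})"
proof -
  let ?P = "leb_Pi {..<n}"
  define v where "v x = L2_set (\<lambda>l. V l x) S" for x
  have v [measurable]: "v \<in> borel_measurable ?P"
    unfolding v_def by (intro L2_set_measurable V)
  have Gm [measurable]: "G i l \<in> borel_measurable ?P" if "i < n" "l \<in> S" for i l using G[OF that] by auto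
  define L where "L i x = L2_set (\<lambda>l. G i l x) S" for i x
  have L [measurable]: "L i \<in> borel_measurable ?P" if "i < n" for i
    unfolding L_def using that by (intro L2_set_measurable) auto
  define W where "W = {x. a < v x \<and> v x < b}"
  have Wm [measurable]: "(\<lambda>x. indicator W x :: ennreal) \<in> borel_measurable ?P"
  proof -
    have "(\<lambda>x. indicator {y. a < y \<and> y < b} (v x) :: ennreal) \<in> borel_measurable ?P" by measurable
    then show ?thesis by (simp add: W_def indicator_def)
  qed
  define h where "h i x = ennreal (L i x) * indicator W x" for i x
  have h [measurable]: "h i \<in> borel_measurable ?P" if "i < n" for i
    unfolding h_def using L[OF that] by measurable
  \<comment> \<open>The integral of |d_i V| over the part of the line in direction i through x on
    which |V| lies in the shell. It is constant in coordinate i, as Loomis-Whitney requires, and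
    integrating it over the other coordinates gives \<open>A i\<close>.\<close>
  define F where "F i x = (\<integral>\<^sup>+t. h i (x(i := t)) \<partial>lborel)" for i x
  have Fm: "F i \<in> borel_measurable ?P" if "i < n" for i
    unfolding F_def[abs_def]
    by (intro lborel.borel_measurable_nn_integral, simp only: split_beta')
       (rule measurable_compose[OF measurable_line_pair(2)[OF that] h[OF that]])
  let ?E = "{x \<in> space ?P. b < v x}"
  have lines: "AE x in ?P. x \<in> ?E \<longrightarrow> ennreal (b - a) \<le> F i x" if i: "i < n" for i
  proof (rule AE_line_converse[OF i])
    have ae: "AE x in ?P. \<forall>l\<in>S. V l x = line_tail i (G i l) x"
      using VG[OF i] S by (intro AE_finite_allI)
    have int: "AE x in leb_Pi ({..<n} - {i}). \<forall>l\<in>S. integrable lborel (\<lambda>t. G i l (x(i := t)))"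
      using integrable_line[OF i G[OF i]] S by (intro AE_finite_allI)
    show "AE x in leb_Pi ({..<n} - {i}). AE t in lborel. x(i := t) \<in> ?E \<longrightarrow> ennreal (b - a) \<le> F i (x(i := t))"
      using AE_space AE_line[OF i ae] int
    proof eventually_elim
      fix x assume x: "x \<in> space (leb_Pi ({..<n} - {i}))"
        and eq: "AE t in lborel. \<forall>l\<in>S. V l (x(i := t)) = line_tail i (G i l) (x(i := t))"
        and int: "\<forall>l\<in>S. integrable lborel (\<lambda>t. G i l (x(i := t)))"
      let ?G = "\<lambda>l t. G i l (x(i := t))"
      let ?v = "\<lambda>t. L2_set (\<lambda>l. tail_int (?G l) t) S"
      have eqv: "AE t in lborel. v (x(i := t)) = ?v t"
        using eq by eventually_elim (auto simp: v_def line_tail_upd[OF i] intro!: L2_set_cong)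
      have tail0: "tail_int (?G l) t = 0" if "B < t" "l \<in> S" for t l
      proof -
        have "?G l s * indicator {t..} s = 0" for s
        proof (cases "t \<le> s")
          case True
          have "x(i := s) \<notin> cbox_Pi n (\<lambda>_. - B) (\<lambda>_. B)"
          proof
            assume "x(i := s) \<in> cbox_Pi n (\<lambda>_. - B) (\<lambda>_. B)"
            then have "(x(i := s)) i \<in> {- B..B}" using i unfolding cbox_Pi_def by (elim PiE_mem) simp
            then show False using True that by simp
          qed
          then show ?thesis using G0[OF i that(2) space_line(1)[OF i x]] by simp
        qed simp
        then show ?thesis by (simp only: tail_int_def) simp
      qed
      show "AE t in lborel. x(i := t) \<in> ?E \<longrightarrow> ennreal (b - a) \<le> F i (x(i := t))"
        using eqv
      proof eventually_elim
        case (elim t0)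
        show ?case
        proof
          assume "x(i := t0) \<in> ?E"
          then have t0: "b \<le> ?v t0" using elim by simp
          \<comment> \<open>Beyond B the derivative, and with it the primitive, vanishes, so the
            point max t0 (B + 1) serves as the end of the crossing.\<close>
          have "ennreal (b - a) \<le> (\<integral>\<^sup>+t. ennreal (L2_set (\<lambda>l. ?G l t) S) * indicator {t. a < ?v t \<and> ?v t < b} t \<partial>lborel)"
            by (rule crossing_le[OF S _ ab _ t0, of "max t0 (B + 1)"]) (use int tail0 in auto)
          also have "\<dots> = (\<integral>\<^sup>+t. h i (x(i := t)) \<partial>lborel)"
          proof (rule nn_integral_cong_AE)
            show "AE t in lborel. ennreal (L2_set (\<lambda>l. ?G l t) S) * indicator {t. a < ?v t \<and> ?v t < b} t = h i (x(i := t))"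
              using eqv by eventually_elim (simp add: h_def L_def W_def indicator_def)
          qed
          also have "\<dots> = F i (x(i := t0))" by (simp add: F_def)
          finally show "ennreal (b - a) \<le> F i (x(i := t0))" .
        qed
      qed
    qed
    show "{x \<in> space ?P. \<not> (x \<in> ?E \<longrightarrow> ennreal (b - a) \<le> F i x)} \<in> sets ?P"
      using Fm[OF i] by measurable
  qed
  define A where "A i = (\<integral>\<^sup>+x. h i x \<partial>?P)" for i
  define R where "R = (\<integral>\<^sup>+x. ennreal (L2_set (\<lambda>(i, l). G i l x) ({..<n} \<times> S)) * indicator W x \<partial>?P)"
  have AR: "A i \<le> R" if "i < n" for i
    unfolding A_def R_def h_def L_def
    by (intro nn_integral_mono mult_right_mono ennreal_leI L2_set_pair_ge[where c="\<lambda>i l. G i l _"]) (use that S in auto)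
  have "ennreal (b - a) ^ n * emeasure ?P ?E ^ (n - 1) \<le> (\<Prod>i<n. \<integral>\<^sup>+x. F i x \<partial>leb_Pi ({..<n} - {i}))"
  proof (rule loomis_whitney[OF n _ _ Fm])
    show "?E \<in> sets ?P" by measurable
    show "emeasure ?P ?E \<noteq> 0" using big unfolding v_def by auto
    show "F i (x(i := y)) = F i x" for i x y by (simp add: F_def)
    have "AE x in ?P. \<forall>i\<in>{..<n}. x \<in> ?E \<longrightarrow> ennreal (b - a) \<le> F i x"
      using lines by (intro AE_finite_allI) auto
    then show "AE x in ?P. x \<in> ?E \<longrightarrow> (\<forall>i<n. ennreal (b - a) \<le> F i x)"
      by eventually_elim auto
  qed
  also have "(\<Prod>i<n. \<integral>\<^sup>+x. F i x \<partial>leb_Pi ({..<n} - {i})) = (\<Prod>i<n. A i)"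
    unfolding A_def F_def by (intro prod.cong refl nn_integral_line[symmetric] h) auto
  finally have lw: "ennreal (b - a) ^ n * emeasure ?P ?E ^ (n - 1) \<le> (\<Prod>i<n. A i)" .
  show ?thesis
  proof (cases "R = top")
    case True
    have "ennreal (1 / sqrt n) * R = top" using n unfolding True by (simp add: ennreal_mult_top)
    then show ?thesis unfolding R_def W_def v_def by simp
  next
    case False
    define \<alpha> where "\<alpha> i = enn2real (A i)" for i
    have \<alpha>: "A i = ennreal (\<alpha> i)" "0 \<le> \<alpha> i" if "i < n" for i
      using AR[OF that] False unfolding \<alpha>_def by (auto simp: less_top top_unique)
    obtain r where r: "R = ennreal r" "0 \<le> r" using False by (cases R) auto
    have "ennreal ((b - a) ^ n * s ^ (n - 1)) = ennreal (b - a) ^ n * ennreal s ^ (n - 1)"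
      using ab s by (simp add: ennreal_mult ennreal_power)
    also have "\<dots> \<le> ennreal (b - a) ^ n * emeasure ?P ?E ^ (n - 1)"
      using big unfolding v_def by (intro mult_left_mono power_mono) auto
    also have "\<dots> \<le> (\<Prod>i<n. A i)" by (rule lw)
    also have "\<dots> = (\<Prod>i<n. ennreal (\<alpha> i))" using \<alpha>(1) by (intro prod.cong) auto
    also have "\<dots> = ennreal (\<Prod>i<n. \<alpha> i)" using \<alpha>(2) by (intro prod_ennreal) auto
    finally have le: "(b - a) ^ n * s ^ (n - 1) \<le> (\<Prod>i<n. \<alpha> i)"
      using \<alpha> by (subst (asm) ennreal_le_iff) (auto intro: prod_nonneg)
    \<comment> \<open>The n-th root of the Loomis-Whitney bound produces the isoperimetric exponent
      1 - 1/n.\<close>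
    have "(b - a) * s powr (1 - 1 / n) = root n ((b - a) ^ n * s ^ (n - 1))"
    proof -
      have "root n (s ^ (n - 1)) = (s powr real (n - 1)) powr (1 / n)"
        using s n by (simp only: root_powr_inverse[OF n less_imp_le[OF zero_less_power[OF s]]] powr_realpow[OF s])
      also have "\<dots> = s powr (1 - 1 / n)"
        using n by (simp add: powr_powr of_nat_diff diff_divide_distrib)
      finally show ?thesis using ab n by (simp add: real_root_mult real_root_power_cancel)
    qed
    also have "\<dots> \<le> root n (\<Prod>i<n. \<alpha> i)" using le n by simp
    also have "\<dots> = (\<Prod>i<n. root n (\<alpha> i))"
    proof -
      have "root n (\<Prod>i<m. \<alpha> i) = (\<Prod>i<m. root n (\<alpha> i))" for m by (induction m) (use n in \<open>simp_all add: real_root_mult\<close>)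
      then show ?thesis .
    qed
    also have "\<dots> \<le> (\<Sum>i<n. \<alpha> i) / n" using \<alpha>(2) n by (intro prod_root_le_sum) auto
    finally have 1: "(b - a) * s powr (1 - 1 / n) \<le> (\<Sum>i<n. \<alpha> i) / n" .
    have "ennreal (\<Sum>i<n. \<alpha> i) = (\<Sum>i<n. ennreal (\<alpha> i))" using \<alpha>(2) by (intro sum_ennreal[symmetric]) auto
    also have "\<dots> = (\<Sum>i<n. A i)" using \<alpha>(1) by (intro sum.cong) auto
    also have "\<dots> = (\<integral>\<^sup>+x. (\<Sum>i<n. h i x) \<partial>?P)"
      unfolding A_def by (subst nn_integral_sum) auto
    also have "\<dots> \<le> (\<integral>\<^sup>+x. ennreal (sqrt n) * (ennreal (L2_set (\<lambda>(i, l). G i l x) ({..<n} \<times> S)) * indicator W x) \<partial>?P)"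
    proof (intro nn_integral_mono)
      fix x
      have "(\<Sum>i<n. h i x) = ennreal (\<Sum>i<n. L i x) * indicator W x"
        unfolding h_def L_def by (simp add: sum_distrib_right[symmetric] sum_ennreal)
      also have "\<dots> \<le> ennreal (sqrt n * L2_set (\<lambda>(i, l). G i l x) ({..<n} \<times> S)) * indicator W x"
        using sum_L2_set_le[of "{..<n}" S "\<lambda>i l. G i l x"] S
        by (intro mult_right_mono ennreal_leI) (auto simp: L_def)
      finally show "(\<Sum>i<n. h i x) \<le> ennreal (sqrt n) * (ennreal (L2_set (\<lambda>(i, l). G i l x) ({..<n} \<times> S)) * indicator W x)"
        by (simp add: ennreal_mult mult.assoc)
    qed
    also have "\<dots> = ennreal (sqrt n) * R"
      unfolding R_def
    proof (rule nn_integral_cmult)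
      have "(\<lambda>x. L2_set (\<lambda>p. (case p of (i, l) \<Rightarrow> G i l) x) ({..<n} \<times> S)) \<in> borel_measurable ?P"
        by (intro L2_set_measurable) auto
      then have "(\<lambda>x. L2_set (\<lambda>(i, l). G i l x) ({..<n} \<times> S)) \<in> borel_measurable ?P"
        by (simp add: case_prod_beta')
      then show "(\<lambda>x. ennreal (L2_set (\<lambda>(i, l). G i l x) ({..<n} \<times> S)) * indicator W x) \<in> borel_measurable ?P"
        by measurable
    qed
    also have "\<dots> = ennreal (sqrt n * r)" using r by (simp add: ennreal_mult)
    finally have 2: "(\<Sum>i<n. \<alpha> i) \<le> sqrt n * r" using r by (subst (asm) ennreal_le_iff) auto
    have "(\<Sum>i<n. \<alpha> i) / n \<le> sqrt n * r / n" using 2 n by (simp add: divide_right_mono)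
    also have "\<dots> = 1 / sqrt n * r" using n by (simp add: field_simps)
    finally have "(b - a) * s powr (1 - 1 / n) \<le> 1 / sqrt n * r" using 1 by simp
    then have "ennreal ((b - a) * s powr (1 - 1 / n)) \<le> ennreal (1 / sqrt n) * R"
      using r by (simp add: ennreal_mult[symmetric] ennreal_leI)
    then show ?thesis unfolding R_def W_def v_def .
  qed
qed

section \<open>Zero extensions of Sobolev functions\<close>

lemma continuous_map_Rn_measurable:
  assumes "continuous_map (Rn_top n) euclideanreal \<phi>"
  shows "\<phi> \<in> borel_measurable (leb_Pi {..<n})"
proof (rule borel_measurableI)
  fix S :: "real set" assume "open S"
  then have "openin (Rn_top n) {x \<in> topspace (Rn_top n). \<phi> x \<in> S}"
    using assms by (intro openin_continuous_map_preimage) auto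
  then have "{x \<in> topspace (Rn_top n). \<phi> x \<in> S} \<in> sets (leb_Pi {..<n})" by (rule openin_Rn_top_sets)
  moreover have "{x \<in> topspace (Rn_top n). \<phi> x \<in> S} = \<phi> -` S \<inter> space (leb_Pi {..<n})"
    by (auto simp: topspace_Rn_top space_leb_Pi)
  ultimately show "\<phi> -` S \<inter> space (leb_Pi {..<n}) \<in> sets (leb_Pi {..<n})" by simp
qed

lemma test_function_continuous: "test_function n U \<phi> \<Longrightarrow> continuous_map (Rn_top n) euclideanreal \<phi>"
  unfolding test_function_def smooth_def partial_derivs_def
  by (metis empty_subsetI foldr.simps(1) id_apply list.set(1))

lemma test_function_measurable: "test_function n U \<phi> \<Longrightarrow> \<phi> \<in> borel_measurable (leb_Pi {..<n})"
  by (intro continuous_map_Rn_measurable test_function_continuous)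

lemma test_function_mono: "test_function n U \<phi> \<Longrightarrow> U \<subseteq> U' \<Longrightarrow> test_function n U' \<phi>"
  unfolding test_function_def by blast

lemma test_function_partial_derivs:
  assumes "test_function n U \<phi>" "set is \<subseteq> {..<n}"
  shows "test_function n U (partial_derivs is \<phi>)"
  using assms(2)
proof (induction "is")
  case Nil
  then show ?case using assms(1) by (simp add: partial_derivs_def)
next
  case (Cons i "is")
  then have "test_function n U (partial_deriv i (partial_derivs is \<phi>))"
    by (intro test_function_partial_deriv) auto
  then show ?case by (simp add: partial_derivs_def)
qed

lemma test_function_support:
  assumes "test_function n U \<phi>"
  obtains K where "compactin (Rn_top n) K" "K \<subseteq> U" "\<And>x. x \<in> space (Rn_leb n) \<Longrightarrow> x \<notin> K \<Longrightarrow> \<phi> x = 0"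
  using assms unfolding test_function_def by (auto simp: space_Rn_leb topspace_Rn_top)

lemma test_function_integrable:
  assumes U: "U \<in> sets (Rn_leb n)" and g: "loc_integrable n U g" and \<phi>: "test_function n U \<phi>"
  shows "set_integrable (Rn_leb n) U (\<lambda>x. g x * \<phi> x)"
proof -
  obtain K where K: "compactin (Rn_top n) K" "K \<subseteq> U" "\<And>x. x \<in> space (Rn_leb n) \<Longrightarrow> x \<notin> K \<Longrightarrow> \<phi> x = 0"
    using test_function_support[OF \<phi>] by blast
  have gK: "integrable (Rn_leb n) (\<lambda>x. indicat_real K x *\<^sub>R g x)"
    using g K unfolding loc_integrable_def set_integrable_def by blast
  have "compactin euclideanreal (\<phi> ` K)"
    by (rule image_compactin[OF K(1) test_function_continuous[OF \<phi>]])
  then have "compact (\<phi> ` K)" by simp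
  then obtain c where c: "\<And>x. x \<in> K \<Longrightarrow> \<bar>\<phi> x\<bar> \<le> c"
    using compact_imp_bounded bounded_iff by (metis imageI real_norm_def)
  have \<phi>m: "\<phi> \<in> borel_measurable (Rn_leb n)"
    using test_function_measurable[OF \<phi>] unfolding Rn_leb_def by (rule measurable_completion)
  have "integrable (Rn_leb n) (\<lambda>x. (indicat_real K x *\<^sub>R g x) * \<phi> x)"
  proof (rule Bochner_Integration.integrable_bound[where f="\<lambda>x. c * (indicat_real K x *\<^sub>R g x)"])
    show "(\<lambda>x. (indicat_real K x *\<^sub>R g x) * \<phi> x) \<in> borel_measurable (Rn_leb n)"
      using gK \<phi>m by (intro borel_measurable_times) auto
    show "AE x in Rn_leb n. norm ((indicat_real K x *\<^sub>R g x) * \<phi> x) \<le> norm (c * (indicat_real K x *\<^sub>R g x))"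
    proof (intro AE_I2)
      fix x
      show "norm ((indicat_real K x *\<^sub>R g x) * \<phi> x) \<le> norm (c * (indicat_real K x *\<^sub>R g x))"
      proof (cases "x \<in> K")
        case True
        then have "\<bar>g x\<bar> * \<bar>\<phi> x\<bar> \<le> \<bar>g x\<bar> * \<bar>c\<bar>" using c[OF True] by (intro mult_left_mono) auto
        then show ?thesis using True by (simp add: abs_mult mult.commute)
      qed simp
    qed
  qed (use gK in auto)
  also have "?this \<longleftrightarrow> integrable (Rn_leb n) (\<lambda>x. indicat_real U x *\<^sub>R (g x * \<phi> x))"
  proof (intro Bochner_Integration.integrable_cong refl)
    fix x assume "x \<in> space (Rn_leb n)"
    then show "(indicat_real K x *\<^sub>R g x) * \<phi> x = indicat_real U x *\<^sub>R (g x * \<phi> x)"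
      using K(2,3) by (cases "x \<in> K") auto
  qed
  finally show ?thesis unfolding set_integrable_def .
qed

lemma weak_deriv_unique:
  assumes U: "openin (Rn_top n) U" and g: "is_weak_deriv n U is f g" and h: "is_weak_deriv n U is f h"
  shows "AE x in Rn_leb n. x \<in> U \<longrightarrow> g x = h x"
proof -
  have Us: "U \<in> sets (Rn_leb n)" by (intro Rn_leb_sets openin_Rn_top_sets U)
  have li: "loc_integrable n U g" "loc_integrable n U h" using g h by (auto simp: is_weak_deriv_def)
  have lid: "loc_integrable n U (\<lambda>x. g x - h x)"
    using li unfolding loc_integrable_def by (auto intro: set_integral_diff)
  have "AE x in Rn_leb n. x \<in> U \<longrightarrow> g x - h x = 0"
  proof (rule AE_eq_0_if_test_integrals[OF U lid])
    fix \<phi> assume \<phi>: "test_function n U \<phi>"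
    have eq: "(-1) ^ length is * (LINT x:U|Rn_leb n. g x * \<phi> x) = (-1) ^ length is * (LINT x:U|Rn_leb n. h x * \<phi> x)"
      using g h \<phi> unfolding is_weak_deriv_def by metis
    have "(LINT x:U|Rn_leb n. (g x - h x) * \<phi> x) = (LINT x:U|Rn_leb n. g x * \<phi> x) - (LINT x:U|Rn_leb n. h x * \<phi> x)"
      unfolding left_diff_distrib by (intro set_integral_diff test_function_integrable Us li \<phi>)
    then show "(LINT x:U|Rn_leb n. (g x - h x) * \<phi> x) = 0" using eq by simp
  qed
  then show ?thesis by eventually_elim simp
qed

lemma loc_integrable_mono: "loc_integrable n U f \<Longrightarrow> U' \<subseteq> U \<Longrightarrow> loc_integrable n U' f"
  unfolding loc_integrable_def by blast

lemma set_integral_test_restrict: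
  assumes "test_function n U \<phi>" "U \<subseteq> U'"
  shows "(LINT x:U'|Rn_leb n. g x * \<phi> x) = (LINT x:U|Rn_leb n. g x * \<phi> x)"
proof -
  obtain K where K: "K \<subseteq> U" "\<And>x. x \<in> space (Rn_leb n) \<Longrightarrow> x \<notin> K \<Longrightarrow> \<phi> x = 0"
    using test_function_support[OF assms(1)] by blast
  show ?thesis
    unfolding set_lebesgue_integral_def
  proof (intro Bochner_Integration.integral_cong refl)
    fix x assume x: "x \<in> space (Rn_leb n)"
    show "indicat_real U' x *\<^sub>R (g x * \<phi> x) = indicat_real U x *\<^sub>R (g x * \<phi> x)"
    proof (cases "x \<in> K")
      case True
      then have "x \<in> U" "x \<in> U'" using K(1) assms(2) by blast+
      then show ?thesis by simp
    qed (simp add: K(2)[OF x])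
  qed
qed

text \<open>Two families of derivatives meet here: those of \<open>f\<close> on \<Omega>, in which
  the norms are expressed, and those of the zero extension on the whole space, which can be
  integrated along complete lines.\<close>

locale sobolev_extension =
  fixes n k :: nat and \<Omega> :: "(nat \<Rightarrow> real) set" and f :: "(nat \<Rightarrow> real) \<Rightarrow> real"
  assumes dom: "bounded_domain n \<Omega>" and f: "f \<in> W0_1 n \<Omega> k"
begin

abbreviation "T \<equiv> topspace (Rn_top n)"
abbreviation "F \<equiv> zero_extension \<Omega> f"

definition multi_index :: "nat list \<Rightarrow> bool" where "multi_index is \<longleftrightarrow> set is \<subseteq> {..<n} \<and> length is \<le> k"

definition D :: "nat list \<Rightarrow> (nat \<Rightarrow> real) \<Rightarrow> real" where "D is = weak_deriv n T is F"

lemma T_eq: "T = space (Rn_leb n)" "T = space (leb_Pi {..<n})"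
  by (auto simp: topspace_Rn_top space_Rn_leb space_leb_Pi)

lemma openin_\<Omega>: "openin (Rn_top n) \<Omega>" using dom by (simp add: bounded_domain_def)

lemma \<Omega>_T: "\<Omega> \<subseteq> T" using openin_\<Omega> by (rule openin_subset)

lemma \<Omega>_sets: "\<Omega> \<in> sets (leb_Pi {..<n})" "\<Omega> \<in> sets (Rn_leb n)"
  using openin_\<Omega> by (auto intro: openin_Rn_top_sets Rn_leb_sets)

lemma D_weak: assumes "multi_index is" shows "is_weak_deriv n T is F (D is)"
proof -
  have "\<exists>g. is_weak_deriv n T is F g"
    using f assms by (simp add: W0_1_def weakly_differentiable_def multi_index_def)
  from someI_ex[OF this] show ?thesis unfolding D_def weak_deriv_def .
qed

lemma f_weak: assumes "multi_index is" shows "is_weak_deriv n \<Omega> is f (weak_deriv n \<Omega> is f)"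
proof -
  have "\<exists>g. is_weak_deriv n \<Omega> is f g"
    using f assms by (simp add: W0_1_def weakly_differentiable_def multi_index_def)
  from someI_ex[OF this] show ?thesis unfolding weak_deriv_def .
qed

text \<open>A test function on \<Omega> is one on the whole space, so the derivative of the zero
  extension restricts to a weak derivative on \<Omega>; uniqueness then identifies it with the
  chosen one.\<close>

lemma f_D_weak:
  assumes "multi_index is" shows "is_weak_deriv n \<Omega> is f (D is)"
  unfolding is_weak_deriv_def
proof (intro conjI allI impI)
  show "loc_integrable n \<Omega> f" using f_weak[OF assms] by (simp add: is_weak_deriv_def)
  show "loc_integrable n \<Omega> (D is)"
    using D_weak[OF assms] \<Omega>_T by (auto simp: is_weak_deriv_def intro: loc_integrable_mono)
  fix \<phi> assume \<phi>: "test_function n \<Omega> \<phi>"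
  have "(LINT x:\<Omega>|Rn_leb n. f x * partial_derivs is \<phi> x) = (LINT x:T|Rn_leb n. F x * partial_derivs is \<phi> x)"
    unfolding set_lebesgue_integral_def using \<Omega>_T
    by (intro Bochner_Integration.integral_cong refl) (auto simp: zero_extension_def indicator_def)
  also have "\<dots> = (-1) ^ length is * (LINT x:T|Rn_leb n. D is x * \<phi> x)"
    using D_weak[OF assms] test_function_mono[OF \<phi> \<Omega>_T] by (auto simp: is_weak_deriv_def)
  also have "(LINT x:T|Rn_leb n. D is x * \<phi> x) = (LINT x:\<Omega>|Rn_leb n. D is x * \<phi> x)"
    by (rule set_integral_test_restrict[OF \<phi> \<Omega>_T])
  finally show "(LINT x:\<Omega>|Rn_leb n. f x * partial_derivs is \<phi> x) = (-1) ^ length is * (LINT x:\<Omega>|Rn_leb n. D is x * \<phi> x)" .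
qed

lemma weak_deriv_eq_D: "multi_index is \<Longrightarrow> AE x in Rn_leb n. x \<in> \<Omega> \<longrightarrow> weak_deriv n \<Omega> is f x = D is x"
  by (rule weak_deriv_unique[OF openin_\<Omega> f_weak f_D_weak])

lemma D_Nil: "AE x in Rn_leb n. D [] x = F x"
proof -
  have "is_weak_deriv n T [] F F"
    using D_weak[of "[]"] by (auto simp: is_weak_deriv_def multi_index_def partial_derivs_def)
  then have "AE x in Rn_leb n. x \<in> T \<longrightarrow> D [] x = F x"
    by (intro weak_deriv_unique[OF _ D_weak]) (auto simp: multi_index_def)
  with AE_space show ?thesis by eventually_elim (simp add: T_eq)
qed

definition B :: real where "B = (SOME B. \<forall>x\<in>\<Omega>. L2_set x {..<n} \<le> B)"

abbreviation "Q \<equiv> cbox_Pi n (\<lambda>_. - B) (\<lambda>_. B)"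

lemma \<Omega>_Q: "\<Omega> \<subseteq> Q"
proof
  fix x assume x: "x \<in> \<Omega>"
  have "\<forall>x\<in>\<Omega>. L2_set x {..<n} \<le> B"
    unfolding B_def by (rule someI_ex) (use dom in \<open>simp add: bounded_domain_def\<close>)
  then have "\<bar>x j\<bar> \<le> B" if "j < n" for j
    using member_le_L2_set[of "{..<n}" j "\<lambda>i. \<bar>x i\<bar>"] x that by (force simp: L2_set_def)
  then have "- B \<le> x j \<and> x j \<le> B" if "j < n" for j using that by (simp add: abs_le_iff) (metis minus_le_iff)
  then show "x \<in> Q" using x \<Omega>_T by (auto simp: cbox_Pi_def topspace_Rn_top PiE_iff)
qed

text \<open>The complement of the closed box is open, so it can be tested directly, and there the
  extension is zero. The complement of \<Omega> is in general not open and is treated in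
  \<open>V_off_\<Omega>\<close>.\<close>

lemma D_off_Q: assumes "multi_index is" shows "AE x in Rn_leb n. x \<notin> Q \<longrightarrow> D is x = 0"
proof -
  have "Hausdorff_space (Rn_top n)" unfolding Rn_top_def by (simp add: Hausdorff_space_product_topology)
  then have cl: "closedin (Rn_top n) Q" using compactin_cbox_Pi by (rule compactin_imp_closedin)
  let ?U = "T - Q"
  have U: "openin (Rn_top n) ?U" using cl by blast
  have "AE x in Rn_leb n. x \<in> ?U \<longrightarrow> D is x = 0"
  proof (rule AE_eq_0_if_test_integrals[OF U])
    show "loc_integrable n ?U (D is)"
      using D_weak[OF assms] by (auto simp: is_weak_deriv_def intro: loc_integrable_mono)
    fix \<phi> assume \<phi>: "test_function n ?U \<phi>"
    have \<phi>T: "test_function n T \<phi>" using \<phi> by (rule test_function_mono) auto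
    have d: "test_function n ?U (partial_derivs is \<phi>)"
      using \<phi> assms by (intro test_function_partial_derivs) (auto simp: multi_index_def)
    have "(LINT x:T|Rn_leb n. F x * partial_derivs is \<phi> x) = (LINT x:?U|Rn_leb n. F x * partial_derivs is \<phi> x)"
      by (rule set_integral_test_restrict[OF d]) auto
    also have "\<dots> = (LINT x|Rn_leb n. 0)"
      unfolding set_lebesgue_integral_def using \<Omega>_Q
      by (intro Bochner_Integration.integral_cong refl) (auto simp: zero_extension_def indicator_def)
    finally have "(LINT x:T|Rn_leb n. D is x * \<phi> x) = 0"
      using D_weak[OF assms] \<phi>T by (simp add: is_weak_deriv_def)
    then show "(LINT x:?U|Rn_leb n. D is x * \<phi> x) = 0"
      using set_integral_test_restrict[OF \<phi>, of T "D is"] by simp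
  qed
  with AE_space show ?thesis by eventually_elim (auto simp: T_eq)
qed

text \<open>Weak derivatives are only measurable for the completed measure; \<open>V is\<close> is a representative
  measurable for the product measure itself, so that Fubini applies.\<close>

definition V :: "nat list \<Rightarrow> (nat \<Rightarrow> real) \<Rightarrow> real" where
  "V is = (SOME h. integrable (leb_Pi {..<n}) h \<and> (\<forall>x. x \<notin> Q \<longrightarrow> h x = 0) \<and> (AE x in Rn_leb n. D is x = h x))"

lemma V_props:
  assumes "multi_index is"
  shows "integrable (leb_Pi {..<n}) (V is)" "x \<notin> Q \<Longrightarrow> V is x = 0" "AE x in Rn_leb n. D is x = V is x"
proof -
  have "set_integrable (Rn_leb n) Q (D is)"
    using D_weak[OF assms] compactin_cbox_Pi[of n] compactin_subset_topspace[OF compactin_cbox_Pi]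
    unfolding is_weak_deriv_def loc_integrable_def by blast
  then have "integrable (Rn_leb n) (\<lambda>x. indicat_real Q x *\<^sub>R D is x)" unfolding set_integrable_def .
  then obtain h where h: "integrable (leb_Pi {..<n}) h" "AE x in Rn_leb n. indicat_real Q x *\<^sub>R D is x = h x"
    by (rule Rn_leb_borel_version)
  have "integrable (leb_Pi {..<n}) (\<lambda>x. h x * indicator Q x)"
    by (intro integrable_real_mult_indicator h cbox_Pi_sets)
  moreover have "AE x in Rn_leb n. D is x = h x * indicator Q x"
    using h(2) D_off_Q[OF assms] by eventually_elim (auto simp: indicator_def split: if_splits)
  ultimately have "\<exists>h. integrable (leb_Pi {..<n}) h \<and> (\<forall>x. x \<notin> Q \<longrightarrow> h x = 0) \<and> (AE x in Rn_leb n. D is x = h x)"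
    by (intro exI[of _ "\<lambda>x. h x * indicator Q x"]) auto
  from someI_ex[OF this]
  show "integrable (leb_Pi {..<n}) (V is)" "x \<notin> Q \<Longrightarrow> V is x = 0" "AE x in Rn_leb n. D is x = V is x"
    unfolding V_def by blast+
qed

lemma V_measurable: "multi_index is \<Longrightarrow> V is \<in> borel_measurable (leb_Pi {..<n})"
  by (rule borel_measurable_integrable[OF V_props(1)])

lemma integral_V:
  assumes "multi_index is" "test_function n T \<phi>"
  shows "(LINT x|leb_Pi {..<n}. V is x * \<phi> x) = (LINT x:T|Rn_leb n. D is x * \<phi> x)"
proof -
  have \<phi>m: "\<phi> \<in> borel_measurable (leb_Pi {..<n})" by (rule test_function_measurable[OF assms(2)])
  have m: "(\<lambda>x. V is x * \<phi> x) \<in> borel_measurable (leb_Pi {..<n})"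
    by (intro borel_measurable_times V_measurable assms \<phi>m)
  have Ts: "T \<in> sets (Rn_leb n)" unfolding T_eq(1) by simp
  have "set_integrable (Rn_leb n) T (\<lambda>x. D is x * \<phi> x)"
    using D_weak[OF assms(1)] by (intro test_function_integrable Ts assms) (simp add: is_weak_deriv_def)
  then have m2: "(\<lambda>x. indicat_real T x *\<^sub>R (D is x * \<phi> x)) \<in> borel_measurable (Rn_leb n)"
    unfolding set_integrable_def by auto
  have "(LINT x|leb_Pi {..<n}. V is x * \<phi> x) = (LINT x|Rn_leb n. V is x * \<phi> x)"
    by (rule integral_Rn_leb[OF m, symmetric])
  also have "\<dots> = (LINT x|Rn_leb n. indicat_real T x *\<^sub>R (D is x * \<phi> x))"
  proof (rule integral_cong_AE)
    show "(\<lambda>x. V is x * \<phi> x) \<in> borel_measurable (Rn_leb n)"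
      using m unfolding Rn_leb_def by (rule measurable_completion)
    show "AE x in Rn_leb n. V is x * \<phi> x = indicat_real T x *\<^sub>R (D is x * \<phi> x)"
      using AE_space V_props(3)[OF assms(1)] by eventually_elim (simp add: T_eq(1))
  qed (rule m2)
  finally show ?thesis unfolding set_lebesgue_integral_def .
qed

text \<open>\<open>foldr\<close> lets the last index of a list act first on the test function.
  Testing order \<open>is\<close> with the i-th derivative of \<phi> is therefore testing
  \<open>is @ [i]\<close> with \<phi>, and new indices are appended at the end.\<close>

lemma V_line:
  assumes i: "i < n" and "is": "multi_index (is @ [i])"
  shows "AE x in leb_Pi {..<n}. V is x = line_tail i (V (is @ [i])) x"
proof (rule weak_derivative_line[OF i, where B=B])
  have is': "multi_index is" using "is" by (auto simp: multi_index_def)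
  show "integrable (leb_Pi {..<n}) (V is)" "integrable (leb_Pi {..<n}) (V (is @ [i]))"
    using V_props(1) "is" is' by auto
  show "V is x = 0" "V (is @ [i]) x = 0" if "x \<notin> Q" for x using V_props(2) "is" is' that by auto
  fix \<phi> assume \<phi>: "test_function n T \<phi>"
  have d\<phi>: "test_function n T (partial_deriv i \<phi>)" by (rule test_function_partial_deriv[OF \<phi> i])
  have "(-1) ^ length is * (LINT x|leb_Pi {..<n}. V is x * partial_deriv i \<phi> x) =
     (LINT x:T|Rn_leb n. F x * partial_derivs is (partial_deriv i \<phi>) x)"
    unfolding integral_V[OF is' d\<phi>] using D_weak[OF is'] d\<phi> by (simp add: is_weak_deriv_def)
  also have "partial_derivs is (partial_deriv i \<phi>) = partial_derivs (is @ [i]) \<phi>"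
    by (simp add: partial_derivs_def)
  also have "(LINT x:T|Rn_leb n. F x * partial_derivs (is @ [i]) \<phi> x) =
     (-1) ^ length (is @ [i]) * (LINT x|leb_Pi {..<n}. V (is @ [i]) x * \<phi> x)"
    unfolding integral_V[OF "is" \<phi>] using D_weak[OF "is"] \<phi> by (simp add: is_weak_deriv_def)
  finally have "(-1) ^ length is * (LINT x|leb_Pi {..<n}. V is x * partial_deriv i \<phi> x) =
     (-1) ^ length is * (- (LINT x|leb_Pi {..<n}. V (is @ [i]) x * \<phi> x))" by simp
  then show "(LINT x|leb_Pi {..<n}. V is x * partial_deriv i \<phi> x) = - (LINT x|leb_Pi {..<n}. V (is @ [i]) x * \<phi> x)"
    by (simp only: mult_cancel_left) simp
qed

text \<open>The boundary of \<Omega> may have positive measure, so local arguments do not suffice.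
  The extension itself vanishes outside \<Omega>, and each further derivative vanishes almost
  everywhere on the zero set of the previous one.\<close>

lemma V_off_\<Omega>: "multi_index is \<Longrightarrow> AE x in leb_Pi {..<n}. x \<notin> \<Omega> \<longrightarrow> V is x = 0"
proof (induction "is" rule: rev_induct)
  case Nil
  have "AE x in Rn_leb n. x \<notin> \<Omega> \<longrightarrow> V [] x = 0"
    using V_props(3)[OF Nil] D_Nil by eventually_elim (auto simp: zero_extension_def)
  then show ?case by (simp only: AE_Rn_leb_iff)
next
  case (snoc i "is")
  then have i: "i < n" and is': "multi_index is" by (auto simp: multi_index_def)
  have "AE x in leb_Pi {..<n}. V is x = 0 \<longrightarrow> V (is @ [i]) x = 0"
    by (rule weak_derivative_zero_set[OF i V_props(1)[OF is'] V_props(1)[OF snoc.prems] V_line[OF i snoc.prems]])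
  with snoc.IH[OF is'] show ?case by eventually_elim simp
qed

definition lists_of :: "nat \<Rightarrow> nat list set" where "lists_of j = {is. set is \<subseteq> {..<n} \<and> length is = j}"

lemma finite_lists_of: "finite (lists_of j)"
  unfolding lists_of_def by (rule finite_lists_length_eq) simp

lemma multi_index_lists_of: "is \<in> lists_of j \<Longrightarrow> j \<le> k \<Longrightarrow> multi_index is" by (simp add: lists_of_def multi_index_def)

definition v :: "nat \<Rightarrow> (nat \<Rightarrow> real) \<Rightarrow> real" where "v j x = L2_set (\<lambda>is. V is x) (lists_of j)"

lemma v_measurable: "j \<le> k \<Longrightarrow> v j \<in> borel_measurable (leb_Pi {..<n})"
  unfolding v_def by (intro L2_set_measurable V_measurable multi_index_lists_of)

lemma v_measurable_\<Omega>: "j \<le> k \<Longrightarrow> v j \<in> borel_measurable (leb_on n \<Omega>)"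
  unfolding Rn_leb_def by (intro measurable_restrict_space1 measurable_completion v_measurable)

lemma AE_leb_on_iff: "(AE x in leb_on n \<Omega>. P x) \<longleftrightarrow> (AE x in Rn_leb n. x \<in> \<Omega> \<longrightarrow> P x)"
  by (rule AE_restrict_space_iff) (use \<Omega>_sets(2) sets.sets_into_space[OF \<Omega>_sets(2)] in \<open>auto simp: Int_absorb1\<close>)

lemma deriv_norm_eq_v:
  assumes "j \<le> k" shows "AE x in leb_on n \<Omega>. deriv_norm n \<Omega> j f x = ennreal (v j x)"
proof -
  have "AE x in Rn_leb n. \<forall>is\<in>lists_of j. x \<in> \<Omega> \<longrightarrow> weak_deriv n \<Omega> is f x = V is x"
  proof (rule AE_finite_allI[OF finite_lists_of])
    fix "is" assume "is \<in> lists_of j"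
    then have m: "multi_index is" using assms by (rule multi_index_lists_of)
    show "AE x in Rn_leb n. x \<in> \<Omega> \<longrightarrow> weak_deriv n \<Omega> is f x = V is x"
      using weak_deriv_eq_D[OF m] V_props(3)[OF m] by eventually_elim simp
  qed
  then show ?thesis unfolding AE_leb_on_iff
    by eventually_elim (auto simp: deriv_norm_def v_def lists_of_def intro!: L2_set_cong arg_cong[where f=ennreal])
qed

lemma abs_f_eq_v: "AE x in leb_on n \<Omega>. ennreal \<bar>f x\<bar> = ennreal (v 0 x)"
proof -
  have m: "multi_index []" by (simp add: multi_index_def)
  have l: "lists_of 0 = {[]}" by (auto simp: lists_of_def)
  show ?thesis unfolding AE_leb_on_iff using D_Nil V_props(3)[OF m]
    by eventually_elim (auto simp: v_def l zero_extension_def L2_set_def)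
qed

text \<open>Transfer of \<open>weak_type_inequality\<close> to \<Omega>. Since a \<ge> 0 and the
  derivatives vanish almost everywhere outside \<Omega>, the shell lies in \<Omega> up to a null
  set.\<close>

lemma sobolev_weak_type:
  assumes n: "0 < n" and j: "j < k" and ab: "0 \<le> a" "a < b" and s: "0 < s"
    and big: "ennreal s < emeasure (leb_on n \<Omega>) {x \<in> space (leb_on n \<Omega>). ennreal b < ennreal (v j x)}"
  shows "ennreal ((b - a) * s powr (1 - 1 / n)) \<le> ennreal (1 / sqrt n) *
    (\<integral>\<^sup>+x. ennreal (v (Suc j) x) * indicator {x. ennreal a < ennreal (v j x) \<and> ennreal (v j x) < ennreal b} x \<partial>leb_on n \<Omega>)"
proof -
  let ?P = "leb_Pi {..<n}" and ?S = "lists_of j"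
  have mi1: "multi_index (is @ [i])" if "i < n" "is \<in> ?S" for "is" i using that j by (auto simp: lists_of_def multi_index_def)
  have mi0: "multi_index is" if "is \<in> ?S" for "is" using that j by (auto simp: lists_of_def multi_index_def)
  have \<Omega>sp: "\<Omega> \<inter> space (Rn_leb n) = \<Omega>" using \<Omega>_T T_eq by auto
  have [measurable]: "v j \<in> borel_measurable ?P" using v_measurable j by simp
  have "emeasure (leb_on n \<Omega>) {x \<in> space (leb_on n \<Omega>). ennreal b < ennreal (v j x)}
      = emeasure (Rn_leb n) {x \<in> space (leb_on n \<Omega>). ennreal b < ennreal (v j x)}"
    using \<Omega>_sets(2) \<Omega>sp by (intro emeasure_restrict_space) (auto simp: space_restrict_space)
  also have "\<dots> \<le> emeasure (Rn_leb n) {x \<in> space ?P. b < v j x}"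
  proof (rule emeasure_mono)
    show "{x \<in> space (leb_on n \<Omega>). ennreal b < ennreal (v j x)} \<subseteq> {x \<in> space ?P. b < v j x}"
      using \<Omega>_T ab by (auto simp: space_restrict_space topspace_Rn_top space_leb_Pi ennreal_less_iff)
    show "{x \<in> space ?P. b < v j x} \<in> sets (Rn_leb n)" by (intro Rn_leb_sets) measurable
  qed
  also have "\<dots> = emeasure ?P {x \<in> space ?P. b < v j x}"
  proof -
    have "{x \<in> space ?P. b < v j x} \<in> sets ?P" by measurable
    then show ?thesis unfolding Rn_leb_def by simp
  qed
  finally have big': "ennreal s < emeasure ?P {x \<in> space ?P. b < v j x}" using big by simp
  have "ennreal ((b - a) * s powr (1 - 1 / n)) \<le> ennreal (1 / sqrt n) *
    (\<integral>\<^sup>+x. ennreal (L2_set (\<lambda>(i, l). V (l @ [i]) x) ({..<n} \<times> ?S)) *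
      indicator {x. a < L2_set (\<lambda>l. V l x) ?S \<and> L2_set (\<lambda>l. V l x) ?S < b} x \<partial>?P)"
    using big' unfolding v_def
    by (intro weak_type_inequality[where G="\<lambda>i l. V (l @ [i])" and B=B] n finite_lists_of ab s
        V_measurable V_props(1) V_props(2) V_line mi0 mi1) auto
  also have "(\<integral>\<^sup>+x. ennreal (L2_set (\<lambda>(i, l). V (l @ [i]) x) ({..<n} \<times> ?S)) *
      indicator {x. a < L2_set (\<lambda>l. V l x) ?S \<and> L2_set (\<lambda>l. V l x) ?S < b} x \<partial>?P)
    = (\<integral>\<^sup>+x. ennreal (v (Suc j) x) * indicator {x. a < v j x \<and> v j x < b} x \<partial>?P)"
  proof (intro nn_integral_cong arg_cong2[where f="(*)"] arg_cong[where f=ennreal])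
    fix x
    \<comment> \<open>Splitting off the last index identifies the full array of order j + 1 with the
      gradients of the components of order j.\<close>
    have bij: "bij_betw (\<lambda>(i, l). l @ [i]) ({..<n} \<times> ?S) (lists_of (Suc j))"
    proof (rule bij_betwI[where g="\<lambda>l. (last l, butlast l)"])
      show "(\<lambda>l. (last l, butlast l)) \<in> lists_of (Suc j) \<rightarrow> {..<n} \<times> ?S"
      proof
        fix l assume "l \<in> lists_of (Suc j)"
        then have l: "set l \<subseteq> {..<n}" "length l = Suc j" by (auto simp: lists_of_def)
        then have "l \<noteq> []" by auto
        then have "last l \<in> set l" "set (butlast l) \<subseteq> set l" by (auto dest: in_set_butlastD)
        then show "(last l, butlast l) \<in> {..<n} \<times> ?S" using l by (auto simp: lists_of_def)
      qed
      show "(case (last l, butlast l) of (i, l) \<Rightarrow> l @ [i]) = l" if "l \<in> lists_of (Suc j)" for l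
      proof -
        have "l \<noteq> []" using that by (auto simp: lists_of_def)
        then show ?thesis by simp
      qed
    qed (auto simp: lists_of_def)
    have "(\<Sum>p\<in>{..<n} \<times> ?S. (V (case p of (i, l) \<Rightarrow> l @ [i]) x)\<^sup>2) = (\<Sum>l\<in>lists_of (Suc j). (V l x)\<^sup>2)"
      by (rule sum.reindex_bij_betw[OF bij])
    then show "L2_set (\<lambda>(i, l). V (l @ [i]) x) ({..<n} \<times> ?S) = v (Suc j) x"
      by (simp add: L2_set_def v_def case_prod_beta')
  qed (auto simp: v_def)
  also have "\<dots> = (\<integral>\<^sup>+x. ennreal (v (Suc j) x) * indicator {x. a < v j x \<and> v j x < b} x \<partial>Rn_leb n)"
    unfolding Rn_leb_def by (rule nn_integral_completion[symmetric])
  also have "\<dots> = (\<integral>\<^sup>+x. ennreal (v (Suc j) x) * indicator {x. ennreal a < ennreal (v j x) \<and> ennreal (v j x) < ennreal b} x * indicator \<Omega> x \<partial>Rn_leb n)"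
  proof (rule nn_integral_cong_AE)
    have "AE x in ?P. \<forall>is\<in>?S. x \<notin> \<Omega> \<longrightarrow> V is x = 0"
      by (intro AE_finite_allI finite_lists_of V_off_\<Omega> mi0)
    then have "AE x in Rn_leb n. \<forall>is\<in>?S. x \<notin> \<Omega> \<longrightarrow> V is x = 0" by (simp only: AE_Rn_leb_iff)
    then show "AE x in Rn_leb n. ennreal (v (Suc j) x) * indicator {x. a < v j x \<and> v j x < b} x =
       ennreal (v (Suc j) x) * indicator {x. ennreal a < ennreal (v j x) \<and> ennreal (v j x) < ennreal b} x * indicator \<Omega> x"
    proof eventually_elim
      case (elim x)
      have vn: "0 \<le> v j x" by (simp add: v_def)
      show ?case
      proof (cases "x \<in> \<Omega>")
        case True
        then show ?thesis using ab vn by (simp add: indicator_def ennreal_less_iff)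
      next
        case False
        then have "v j x = 0" using elim by (simp add: v_def L2_set_def)
        then show ?thesis using ab False by simp
      qed
    qed
  qed
  also have "\<dots> = (\<integral>\<^sup>+x. ennreal (v (Suc j) x) * indicator {x. ennreal a < ennreal (v j x) \<and> ennreal (v j x) < ennreal b} x \<partial>leb_on n \<Omega>)"
    using \<Omega>_sets(2) \<Omega>sp by (intro nn_integral_restrict_space[symmetric]) simp
  finally show ?thesis .
qed

end

section \<open>The dimension-free embedding\<close>

text \<open>The substitution t = exp(-y/\<theta>) turns the integral into Euler's integral for
  Gamma, and the scaling by \<theta> leaves \<theta>^(-\<kappa>).\<close>

lemma nn_integral_log_weight:
  fixes \<kappa> \<theta> :: real
  assumes "0 < \<kappa>" "0 < \<theta>"
  shows "(\<integral>\<^sup>+t\<in>{0<..<1}. ennreal (t powr \<theta> * (1 / (t * ln (1 / t) powr (1 - \<kappa>)))) \<partial>lborel)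
    = ennreal (Gamma \<kappa> * \<theta> powr - \<kappa>)"
proof -
  define w where "w t = t powr \<theta> * (1 / (t * ln (1 / t) powr (1 - \<kappa>)))" for t
  define g where "g y = exp (- (y / \<theta>))" for y :: real
  define g' where "g' y = - (exp (- (y / \<theta>)) / \<theta>)" for y :: real
  have gS: "g ` {0<..} = {0<..<1}"
  proof (intro equalityI subsetI)
    fix t :: real assume t: "t \<in> {0<..<1}"
    then have "t = g (- \<theta> * ln t)" "0 < - \<theta> * ln t" using assms by (auto simp: g_def mult_pos_neg)
    then show "t \<in> g ` {0<..}" by blast
  qed (use assms in \<open>auto simp: g_def\<close>)
  have eq: "\<bar>g' y\<bar> * w (g y) = \<theta> powr - \<kappa> * (y powr (\<kappa> - 1) / exp y)" if "0 < y" for y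
  proof -
    have "ln (1 / g y) = y / \<theta>" by (simp add: g_def ln_div)
    moreover have "g y powr \<theta> = exp (- y)" using assms by (simp add: g_def powr_def)
    ultimately have "\<bar>g' y\<bar> * w (g y) = exp (- y) * (1 / \<theta>) / (y / \<theta>) powr (1 - \<kappa>)"
      using assms by (simp add: w_def g'_def) (simp add: g_def)
    also have "(y / \<theta>) powr (1 - \<kappa>) = y powr (1 - \<kappa>) / \<theta> powr (1 - \<kappa>)"
      using assms that by (simp add: powr_divide)
    also have "exp (- y) * (1 / \<theta>) / (y powr (1 - \<kappa>) / \<theta> powr (1 - \<kappa>)) = (\<theta> powr (1 - \<kappa>) / \<theta> powr 1) * ((1 / y powr (1 - \<kappa>)) / exp y)"
      using assms by (simp add: exp_minus divide_inverse)
    also have "\<theta> powr (1 - \<kappa>) / \<theta> powr 1 = \<theta> powr - \<kappa>" by (simp only: powr_diff[symmetric]) simp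
    also have "1 / y powr (1 - \<kappa>) = y powr (\<kappa> - 1)" by (simp add: powr_minus_divide[symmetric])
    finally show ?thesis .
  qed
  have "((\<lambda>y. \<theta> powr - \<kappa> * (y powr (\<kappa> - 1) / exp y)) has_integral \<theta> powr - \<kappa> * Gamma \<kappa>) {0..}"
    by (intro has_integral_mult_right Gamma_integral_real assms)
  also have "?this \<longleftrightarrow> ((\<lambda>y. \<theta> powr - \<kappa> * (y powr (\<kappa> - 1) / exp y)) has_integral \<theta> powr - \<kappa> * Gamma \<kappa>) {0<..}"
    by (rule has_integral_spike_set_eq; rule negligible_subset[OF negligible_sing[of 0]]) auto
  finally have "((\<lambda>y. \<theta> powr - \<kappa> * (y powr (\<kappa> - 1) / exp y)) has_integral \<theta> powr - \<kappa> * Gamma \<kappa>) {0<..}" .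
  then have hi: "((\<lambda>y. \<bar>g' y\<bar> * w (g y)) has_integral \<theta> powr - \<kappa> * Gamma \<kappa>) {0<..}"
    by (rule has_integral_eq[rotated]) (simp add: eq)
  have "(\<lambda>y. \<bar>g' y\<bar> * w (g y)) absolutely_integrable_on {0<..}"
    using hi by (intro nonnegative_absolutely_integrable_1) (auto simp: eq intro: has_integral_integrable)
  moreover have "integral {0<..} (\<lambda>y. \<bar>g' y\<bar> * w (g y)) = \<theta> powr - \<kappa> * Gamma \<kappa>"
    using hi by (rule integral_unique)
  moreover have "(g has_field_derivative g' y) (at y within {0<..})" for y
    unfolding g_def g'_def using assms by (auto intro!: derivative_eq_intros)
  moreover have "inj_on g {0<..}" using assms by (auto simp: inj_on_def g_def)
  ultimately have "w absolutely_integrable_on g ` {0<..} \<and> integral (g ` {0<..}) w = \<theta> powr - \<kappa> * Gamma \<kappa>"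
    by (subst has_absolute_integral_change_of_variables_1'[symmetric, where g'=g']) auto
  then have "(w has_integral \<theta> powr - \<kappa> * Gamma \<kappa>) {0<..<1}"
    unfolding gS by (metis absolutely_integrable_on_def integrable_integral)
  then have "integral\<^sup>N lborel (\<lambda>t. indicator {0<..<1} t * w t) = ennreal (\<theta> powr - \<kappa> * Gamma \<kappa>)"
    by (rule nn_integral_has_integral_lebesgue[rotated]) (auto simp: w_def)
  also have "integral\<^sup>N lborel (\<lambda>t. indicator {0<..<1} t * w t) = (\<integral>\<^sup>+t\<in>{0<..<1}. ennreal (w t) \<partial>lborel)"
    by (intro nn_integral_cong) (auto split: split_indicator)
  finally show ?thesis by (simp add: w_def mult.commute)
qed

text \<open>A strict lower bound for a supremum is attained at one q; since ln q < 0, the inequality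
  for the quotient reads h < q^\<mu>.\<close>

lemma lower_boyd_index_witness:
  assumes "lower_boyd_index \<rho> > ereal \<mu>" "0 < \<mu>"
  obtains q h where "0 < q" "q < 1" "dilation_norm \<rho> q = ennreal h" "0 < h" "h * q powr (- \<mu>) < 1"
proof -
  obtain q where q: "0 < q" "q < 1" and less: "\<mu> < ln (enn2real (dilation_norm \<rho> q)) / ln q"
    using assms(1) unfolding lower_boyd_index_def less_SUP_iff by auto
  define h where "h = enn2real (dilation_norm \<rho> q)"
  have lq: "ln q < 0" using q by simp
  have lh: "ln h < \<mu> * ln q" using less lq by (simp add: h_def neg_less_divide_eq)
  have "\<mu> * ln q < 0" using assms(2) lq by (simp add: mult_pos_neg)
  \<comment> \<open>Both \<open>ln 0\<close> and \<open>enn2real top\<close> are 0, so a dilation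
    norm equal to 0 or \<open>top\<close> would give ln h = 0, whereas ln h is negative here. This
    excludes both values.\<close>
  then have "h \<noteq> 0" using lh by auto
  then have h: "0 < h" by (simp add: h_def order_less_le)
  have "dilation_norm \<rho> q = ennreal h"
    using h unfolding h_def by (metis enn2real_top ennreal_enn2real less_irrefl less_top)
  moreover have "h * q powr (- \<mu>) < 1"
  proof -
    have "h * q powr (- \<mu>) = exp (ln h - \<mu> * ln q)"
      using h q by (simp add: powr_def exp_diff exp_minus divide_inverse)
    also have "\<dots> < 1" using lh by simp
    finally show ?thesis .
  qed
  ultimately show ?thesis using that q h by blast
qed

context sobolev_extension
begin

lemma emeasure_leb_on_space: "emeasure (leb_on n \<Omega>) (space (leb_on n \<Omega>)) = emeasure (Rn_leb n) \<Omega>"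
proof -
  have sp: "\<Omega> \<inter> space (Rn_leb n) = \<Omega>" using \<Omega>_T T_eq by auto
  then have "space (leb_on n \<Omega>) = \<Omega>" by (simp add: space_restrict_space)
  then show ?thesis using sp \<Omega>_sets(2) by (simp add: emeasure_restrict_space)
qed

text \<open>\<open>u\<close> stands for \<open>deriv_norm\<close> or |f|, which involve arbitrary
  representatives. Subsets of null sets are measurable for the completed measure, so the level sets
  of \<open>u\<close> are measurable without any assumption on \<open>u\<close>.\<close>

lemma rearr_cong_AE_v:
  assumes j: "j \<le> k" and ae: "AE x in leb_on n \<Omega>. u x = ennreal (v j x)"
  shows "rearr (leb_on n \<Omega>) u = rearr (leb_on n \<Omega>) (\<lambda>x. ennreal (v j x))"
proof (rule rearr_cong_dist)
  fix y
  have sp: "\<Omega> \<inter> space (Rn_leb n) = \<Omega>" using \<Omega>_T T_eq by auto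
  have spr: "space (leb_on n \<Omega>) = \<Omega>" using sp by (simp add: space_restrict_space)
  note [measurable] = v_measurable_\<Omega>[OF j]
  let ?N = "leb_on n \<Omega>"
  let ?bad = "\<lambda>x. x \<in> \<Omega> \<and> u x \<noteq> ennreal (v j x)"
  have good: "AE x in Rn_leb n. \<not> ?bad x" using ae unfolding AE_leb_on_iff by eventually_elim blast
  have pred: "{x \<in> space (Rn_leb n). P x} \<in> sets (Rn_leb n)" if "\<And>x. P x \<Longrightarrow> ?bad x" for P
  proof -
    have "AE x in leb_Pi {..<n}. \<not> ?bad x" using good unfolding AE_Rn_leb_iff .
    then have "AE x in leb_Pi {..<n}. \<not> P x" by eventually_elim (use that in blast)
    then have "Measurable.pred (completion (leb_Pi {..<n})) P" by (rule sets_completion_AE)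
    then show ?thesis unfolding Rn_leb_def pred_def .
  qed
  have A: "{x \<in> \<Omega>. y < ennreal (v j x)} \<in> sets (Rn_leb n)"
  proof -
    have "{x \<in> space ?N. y < ennreal (v j x)} \<in> sets ?N" by measurable
    then show ?thesis using sp \<Omega>_sets(2) by (simp add: spr sets_restrict_space_iff)
  qed
  have "{x \<in> \<Omega>. y < u x} = ({x \<in> \<Omega>. y < ennreal (v j x)} - {x \<in> space (Rn_leb n). ?bad x})
     \<union> {x \<in> space (Rn_leb n). ?bad x \<and> y < u x}" using sp by auto
  also have "\<dots> \<in> sets (Rn_leb n)" by (intro sets.Un sets.Diff A pred) auto
  finally have B: "{x \<in> \<Omega>. y < u x} \<in> sets (Rn_leb n)" .
  show "dist_fun ?N u y = dist_fun ?N (\<lambda>x. ennreal (v j x)) y"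
  proof (rule emeasure_eq_AE)
    show "AE x in ?N. (x \<in> {x \<in> space ?N. y < u x}) = (x \<in> {x \<in> space ?N. y < ennreal (v j x)})"
      using ae by eventually_elim simp
  qed (use A B sp \<Omega>_sets(2) in \<open>auto simp: spr sets_restrict_space_iff\<close>)
qed

end

context ri_norm
begin

text \<open>The induction descends from order k to order k - i. Each application of
  \<open>rho_step\<close> contributes C0 / sqrt n, where C0 depends on q, h and \<mu> only, and adds
  1/n to the exponent until the cap \<mu> is reached.\<close>

lemma rho_iterate:
  assumes q: "0 < q" "q < 1" and h: "dilation_norm \<rho> q = ennreal h" "0 < h"
    and x: "h * q powr (- \<mu>) < 1" and \<mu>: "0 < \<mu>"
    and se: "sobolev_extension n k \<Omega> f" and n: "0 < n" and one: "emeasure (Rn_leb n) \<Omega> = 1"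
    and i: "i \<le> k"
  defines "N \<equiv> leb_on n \<Omega>" and "C0 \<equiv> (1 / q - 1) / (1 - h * q powr (- \<mu>))"
  shows "\<rho> (\<lambda>t. rearr N (\<lambda>x. ennreal (sobolev_extension.v n \<Omega> f (k - i) x)) t * indicator {0..<q ^ m} t)
    \<le> ennreal ((C0 / sqrt n) ^ i) * \<rho> (rearr N (\<lambda>x. ennreal (sobolev_extension.v n \<Omega> f k x)))
       * ennreal (q powr (real m * min (real i / n) \<mu>))"
  using i
proof (induction i arbitrary: m)
  interpret sobolev_extension n k \<Omega> f by (rule se)
  have vm: "(\<lambda>x. ennreal (v j x)) \<in> borel_measurable N" if "j \<le> k" for j
    using v_measurable_\<Omega>[OF that] unfolding N_def by measurable
  {
    case 0
    have "\<rho> (\<lambda>t. rearr N (\<lambda>x. ennreal (v k x)) t * indicator {0..<q ^ m} t) \<le> \<rho> (rearr N (\<lambda>x. ennreal (v k x)))"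
      using vm[of k] by (intro rho_mono borel_measurable_unit_leb) (auto simp: indicator_def)
    then show ?case using \<mu> q by simp
  next
    case (Suc i)
    then have ik: "Suc (k - Suc i) = k - i" "k - Suc i < k" by auto
    have N1: "emeasure N (space N) \<le> 1" unfolding N_def emeasure_leb_on_space one by simp
    let ?R = "\<rho> (rearr N (\<lambda>x. ennreal (v k x)))"
    have "\<rho> (\<lambda>t. rearr N (\<lambda>x. ennreal (v (k - Suc i) x)) t * indicator {0..<q ^ m} t)
      \<le> ennreal (C0 * (1 / sqrt n)) * (ennreal ((C0 / sqrt n) ^ i) * ?R) * ennreal (q powr (real m * min (real (Suc i) / n) \<mu>))"
      unfolding C0_def
    proof (rule rho_step[OF q h x N1, where G="\<lambda>x. ennreal (v (k - i) x)" and \<sigma>="1 / n" and \<theta>="min (real i / n) \<mu>"])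
      show "(\<lambda>x. ennreal (v (k - Suc i) x)) \<in> borel_measurable N" "(\<lambda>x. ennreal (v (k - i) x)) \<in> borel_measurable N"
        by (auto intro: vm)
      show "ennreal ((b - a) * s powr (1 - 1 / n)) \<le> ennreal (1 / sqrt n) *
        (\<integral>\<^sup>+x. ennreal (v (k - i) x) * indicator {x. ennreal a < ennreal (v (k - Suc i) x) \<and> ennreal (v (k - Suc i) x) < ennreal b} x \<partial>N)"
        if "0 \<le> a" "a < b" "0 < s" "s < 1" "ennreal s < dist_fun N (\<lambda>x. ennreal (v (k - Suc i) x)) (ennreal b)" for a b s
        using sobolev_weak_type[OF n ik(2) that(1,2,3)] that(5) unfolding N_def ik(1) by simp
      show "\<rho> (\<lambda>t. rearr N (\<lambda>x. ennreal (v (k - i) x)) t * indicator {0..<q ^ p} t)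
        \<le> ennreal (((1 / q - 1) / (1 - h * q powr (- \<mu>)) / sqrt n) ^ i) * ?R * ennreal (q powr (real p * min (real i / n) \<mu>))" for p
        using Suc.IH[of p] Suc.prems unfolding C0_def by simp
      show "min (real (Suc i) / n) \<mu> \<le> min (real i / n) \<mu> + 1 / n"
      proof -
        have "real (Suc i) / n = real i / n + 1 / n" by (simp add: add_divide_distrib)
        moreover have "0 \<le> 1 / real n" by simp
        ultimately show ?thesis by linarith
      qed
      show "0 \<le> min (real i / n) \<mu>" "0 \<le> min (real (Suc i) / n) \<mu>" using \<mu> by simp_all
      show "0 \<le> 1 / sqrt n" "0 \<le> 1 / real n" by simp_all
      show "min (real (Suc i) / n) \<mu> \<le> \<mu>" by (rule min.cobounded2)
    qed
    also have "ennreal (C0 * (1 / sqrt n)) * (ennreal ((C0 / sqrt n) ^ i) * ?R) = ennreal ((C0 / sqrt n) ^ Suc i) * ?R"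
    proof -
      have "0 \<le> C0" using q x by (simp add: C0_def)
      then have "ennreal ((C0 / sqrt n) ^ Suc i) = ennreal (C0 * (1 / sqrt n)) * ennreal ((C0 / sqrt n) ^ i)"
        by (subst ennreal_mult[symmetric]) auto
      then show ?thesis by (simp only: mult.assoc)
    qed
    finally show ?case .
  }
qed

end

theorem theorem5:
  fixes \<rho> :: "(real \<Rightarrow> ennreal) \<Rightarrow> ennreal" and k M :: nat
  assumes "ri_norm \<rho>"
    and "lower_boyd_index \<rho> > 0"
    and "k \<ge> 1"
    and "M = (LEAST m::nat. m \<ge> 1 \<and> lower_boyd_index \<rho> > ereal (1 / real m))"
  shows "\<exists>c::real. \<forall>n \<Omega> f.
    n \<ge> M \<longrightarrow> bounded_domain n \<Omega> \<longrightarrow> emeasure (Rn_leb n) \<Omega> = 1 \<longrightarrow> f \<in> W0_X \<rho> n \<Omega> k \<longrightarrow>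
      log_norm \<rho> k (leb_on n \<Omega>) (\<lambda>x. ennreal \<bar>f x\<bar>)
        \<le> ennreal c * \<rho> (rearr (leb_on n \<Omega>) (deriv_norm n \<Omega> k f))"
proof -
  interpret ri_norm \<rho> by fact
  have "\<exists>m::nat. m \<ge> 1 \<and> lower_boyd_index \<rho> > ereal (1 / real m)"
  proof -
    obtain y where y: "0 < ereal y" "ereal y < lower_boyd_index \<rho>"
      using ereal_dense2[OF assms(2)] by auto
    obtain m where m: "1 / real (Suc m) < y" using y(1) nat_approx_posE[of y] by auto
    then have "ereal (1 / real (Suc m)) < lower_boyd_index \<rho>" using y(2) by (meson less_ereal.simps(1) less_trans)
    then show ?thesis by (intro exI[of _ "Suc m"]) auto
  qed
  then have M: "M \<ge> 1" "lower_boyd_index \<rho> > ereal (1 / real M)"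
    unfolding assms(4) by (metis (mono_tags, lifting) LeastI_ex)+
  define \<mu> where "\<mu> = 1 / real M"
  have \<mu>: "0 < \<mu>" "\<mu> \<le> 1" using M by (auto simp: \<mu>_def)
  obtain q h where q: "0 < q" "q < 1" and h: "dilation_norm \<rho> q = ennreal h" "0 < h" and x: "h * q powr (- \<mu>) < 1"
    using lower_boyd_index_witness[of \<mu> \<rho>] M \<mu> unfolding \<mu>_def by metis
  define C0 where "C0 = (1 / q - 1) / (1 - h * q powr (- \<mu>))"
  have C0: "0 \<le> C0" using q x by (simp add: C0_def)
  define \<kappa> where "\<kappa> = real k / 2"
  have \<kappa>: "0 < \<kappa>" using assms(3) by (simp add: \<kappa>_def)
  have \<Gamma>: "0 < Gamma \<kappa>" using \<kappa> by (rule Gamma_real_pos)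
  show ?thesis
  \<comment> \<open>The factors come from k derivative steps, from replacing t by a neighbouring
    power of q, and from the logarithmic integral.\<close>
  proof (intro exI[of _ "C0 ^ k * (1 / q) * Gamma \<kappa>"] allI impI)
    fix n \<Omega> f
    assume n: "n \<ge> M" and dom: "bounded_domain n \<Omega>" and one: "emeasure (Rn_leb n) \<Omega> = 1" and f: "f \<in> W0_X \<rho> n \<Omega> k"
    have n0: "0 < n" using n M by simp
    have se: "sobolev_extension n k \<Omega> f"
      using dom f by unfold_locales (auto simp: W0_X_def)
    interpret sobolev_extension n k \<Omega> f by (rule se)
    define \<theta> where "\<theta> = min (real k / n) \<mu>"
    have \<theta>: "0 < \<theta>" "\<theta> \<le> 1" using \<mu> assms(3) n0 by (auto simp: \<theta>_def)
    \<comment> \<open>Either entry of the minimum suffices: n times k/n is k, and n times 1/M is at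
      least 1 because n \<ge> M.\<close>
    have n\<theta>: "1 \<le> n * \<theta>" using assms(3) n n0 M by (auto simp: \<theta>_def \<mu>_def min_def)
    let ?N = "leb_on n \<Omega>"
    define R where "R = \<rho> (rearr ?N (\<lambda>x. ennreal (v k x)))"
    have Rd: "\<rho> (rearr ?N (deriv_norm n \<Omega> k f)) = R"
      unfolding R_def by (subst rearr_cong_AE_v[OF order_refl deriv_norm_eq_v[OF order_refl]]) (rule refl)
    have rf: "rearr ?N (\<lambda>x. ennreal \<bar>f x\<bar>) = rearr ?N (\<lambda>x. ennreal (v 0 x))"
      by (rule rearr_cong_AE_v[OF _ abs_f_eq_v]) simp
    have vm: "(\<lambda>x. ennreal (v 0 x)) \<in> borel_measurable ?N"
      using v_measurable_\<Omega>[of 0] by measurable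
    have pt: "\<rho> (\<lambda>s. rearr ?N (\<lambda>x. ennreal \<bar>f x\<bar>) s * indicator {0..<t} s)
      \<le> ennreal ((C0 / sqrt n) ^ k * (1 / q)) * R * ennreal (t powr \<theta>)" if t: "0 < t" "t < 1" for t
    proof -
      \<comment> \<open>The block index is at least 1, so q^(m+1) \<le> t < q^m.\<close>
      define m where "m = blk q t - 1"
      have "0 < blk q t" by (rule blk_pos[OF q t])
      then have tm: "t < q ^ m" "q ^ Suc m \<le> t"
        using less_blk_iff[OF q t(1), of m] blk_le[OF q t(1)] by (auto simp: m_def)
      have "\<rho> (\<lambda>s. rearr ?N (\<lambda>x. ennreal \<bar>f x\<bar>) s * indicator {0..<t} s)
        \<le> \<rho> (\<lambda>s. rearr ?N (\<lambda>x. ennreal (v (k - k) x)) s * indicator {0..<q ^ m} s)"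
        unfolding rf using vm tm
        by (intro rho_mono borel_measurable_unit_leb) (auto simp: indicator_def)
      also have "\<dots> \<le> ennreal ((C0 / sqrt n) ^ k) * R * ennreal (q powr (real m * \<theta>))"
        unfolding C0_def R_def \<theta>_def by (rule rho_iterate[OF q h x \<mu>(1) se n0 one order_refl])
      \<comment> \<open>Replacing q^m by t costs q^(-\<theta>), at most 1/q since \<theta> \<le> 1,
        hence a factor free of n.\<close>
      also have "q powr (real m * \<theta>) \<le> 1 / q * t powr \<theta>"
      proof -
        have "q powr (real m * \<theta>) = q powr (- \<theta>) * (q ^ Suc m) powr \<theta>"
          using q by (simp add: powr_realpow[symmetric] powr_powr powr_add[symmetric] algebra_simps del: power_Suc)
        also have "\<dots> \<le> q powr (- 1) * t powr \<theta>"
          using tm q \<theta> by (intro mult_mono powr_mono' powr_mono2) auto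
        finally show ?thesis using q by (simp add: powr_minus_divide)
      qed
      then have "ennreal ((C0 / sqrt n) ^ k) * R * ennreal (q powr (real m * \<theta>)) \<le> ennreal ((C0 / sqrt n) ^ k) * R * ennreal (1 / q * t powr \<theta>)"
        by (intro mult_left_mono ennreal_leI) auto
      also have "\<dots> = ennreal ((C0 / sqrt n) ^ k * (1 / q)) * R * ennreal (t powr \<theta>)"
      proof -
        have "ennreal (1 / q * t powr \<theta>) = ennreal (1 / q) * ennreal (t powr \<theta>)"
          "ennreal ((C0 / sqrt n) ^ k * (1 / q)) = ennreal ((C0 / sqrt n) ^ k) * ennreal (1 / q)"
          using C0 q by (auto intro!: ennreal_mult simp del: times_divide_eq_left times_divide_eq_right mult_1_left mult_1_right)
        then show ?thesis by (simp only: mult_ac)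
      qed
      finally show ?thesis .
    qed
    let ?w = "\<lambda>t. 1 / (t * ln (1 / t) powr (1 - real k / 2))"
    let ?c = "ennreal ((C0 / sqrt n) ^ k * (1 / q)) * R"
    have "log_norm \<rho> k ?N (\<lambda>x. ennreal \<bar>f x\<bar>) \<le> (\<integral>\<^sup>+t. ?c * (ennreal (t powr \<theta> * ?w t) * indicator {0<..<1} t) \<partial>lborel)"
      unfolding log_norm_def
    proof (intro nn_integral_mono)
      fix t :: real
      show "\<rho> (\<lambda>s. rearr ?N (\<lambda>x. ennreal \<bar>f x\<bar>) s * indicator {0..<t} s) * ennreal (?w t) * indicator {0<..<1} t
        \<le> ?c * (ennreal (t powr \<theta> * ?w t) * indicator {0<..<1} t)"
      proof (cases "t \<in> {0<..<1}")
        case True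
        then have "0 \<le> ?w t" by simp
        then have "ennreal (t powr \<theta> * ?w t) = ennreal (t powr \<theta>) * ennreal (?w t)" by (intro ennreal_mult) auto
        moreover have "\<rho> (\<lambda>s. rearr ?N (\<lambda>x. ennreal \<bar>f x\<bar>) s * indicator {0..<t} s) * ennreal (?w t)
          \<le> ?c * ennreal (t powr \<theta>) * ennreal (?w t)"
          using True by (intro mult_right_mono pt) auto
        ultimately show ?thesis using True by (simp add: mult.assoc)
      qed simp
    qed
    also have "\<dots> = ?c * (\<integral>\<^sup>+t\<in>{0<..<1}. ennreal (t powr \<theta> * ?w t) \<partial>lborel)"
      by (rule nn_integral_cmult) measurable
    also have "\<dots> = ?c * ennreal (Gamma \<kappa> * \<theta> powr - \<kappa>)"
      using nn_integral_log_weight[OF \<kappa> \<theta>(1)] unfolding \<kappa>_def by simp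
    also have "\<dots> = ennreal ((C0 / sqrt n) ^ k * (1 / q) * (Gamma \<kappa> * \<theta> powr - \<kappa>)) * R"
    proof -
      have "ennreal ((C0 / sqrt n) ^ k * (1 / q) * (Gamma \<kappa> * \<theta> powr - \<kappa>))
        = ennreal ((C0 / sqrt n) ^ k * (1 / q)) * ennreal (Gamma \<kappa> * \<theta> powr - \<kappa>)"
        using C0 q \<Gamma> by (intro ennreal_mult) auto
      then show ?thesis by (simp only: mult_ac)
    qed
    also have "\<dots> \<le> ennreal (C0 ^ k * (1 / q) * Gamma \<kappa>) * R"
    proof (intro mult_right_mono ennreal_leI)
      \<comment> \<open>Here the powers of n disappear: n^(-\<kappa>) from the k steps and
        \<theta>^(-\<kappa>) from the weight combine to (n\<theta>)^(-\<kappa>), at most 1.\<close>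
      have "sqrt n ^ k = real n powr \<kappa>"
        using n0 by (simp add: \<kappa>_def powr_half_sqrt[symmetric] powr_power)
      then have "(C0 / sqrt n) ^ k * \<theta> powr - \<kappa> = C0 ^ k * (n * \<theta>) powr - \<kappa>"
        using n0 \<theta> by (simp add: power_divide powr_mult powr_minus_divide)
      also have "\<dots> \<le> C0 ^ k * 1"
        using n\<theta> \<kappa> C0 powr_mono2'[of "- \<kappa>" 1 "n * \<theta>"] by (intro mult_left_mono) auto
      finally have "((C0 / sqrt n) ^ k * \<theta> powr - \<kappa>) * (1 / q * Gamma \<kappa>) \<le> C0 ^ k * (1 / q * Gamma \<kappa>)"
        using q \<Gamma> by (intro mult_right_mono) auto
      then show "(C0 / sqrt n) ^ k * (1 / q) * (Gamma \<kappa> * \<theta> powr - \<kappa>) \<le> C0 ^ k * (1 / q) * Gamma \<kappa>"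
        by (simp add: mult_ac)
    qed auto
    finally show "log_norm \<rho> k ?N (\<lambda>x. ennreal \<bar>f x\<bar>) \<le> ennreal (C0 ^ k * (1 / q) * Gamma \<kappa>) * \<rho> (rearr ?N (deriv_norm n \<Omega> k f))"
      unfolding Rd .
  qed
qed

end
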